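(* Let $P=[P_{kn}]_{k,n\in\mathbb N_0}\in\mathbb P(V)$ and let $(P_n(\omega))_{n=0}^\infty$ be the corresponding polynomial sequence. Assume that $P_0=1$ and $P_n(0)=0$ for all $n\in\mathbb N$. Let $(Q(\theta))_{\theta\in V^*}$ be the corresponding lowering operators and $Q$ the lowering differential. Then the following conditions are equivalent: (B1) $(P_n(\omega))_{n=0}^\infty$ is a binomial sequence. (B2) The lowering differential $Q$ is shift-invariant; equivalently, for each $\theta\in V^*$, $Q(\theta)$ is shift-invariant. (B3) There exists $L(v)=\sum_{k=1}^\infty L_kv^{\otimes k}\in\mathcal F_1(V)$ such that $Q=L(D)$; equivalently, for each $\theta\in V^*$, $Q(\theta)=\sum_{k=1}^\infty\langle\theta L_k,D^k\rangle$. (B4) There exists $B(v)\in\mathcal F_1(V)$ such that, for each $\omega\in V^*$, $$\sum_{n=0}^\infty\frac1{n!}\langle P_n(\omega),v^{\otimes n}\rangle=\exp[\langle\omega,B(v)\rangle]$$ (equality of formal tensor power series in $\mathcal F(V,\mathbb F)$). (B5) There exists $B(v)\in\mathcal F_1(V)$ such that, for each $k\in\mathbb N$, $$\sum_{n=k}^\infty\frac{k!}{n!}P_{kn}v^{\otimes n}=B(v)^{\otimes k}$$ (equality of formal tensor power series in $\mathcal F(V,V^{\odot k})$). Furthermore, the formal tensor power series $B(v)\in\mathcal F_1(V)$ in (B4) and (B5) are the same, while $L(v)\in\mathcal F_1(V)$ in (B3) is the compositional inverse of $B(v)$, i.e., $L(v)=B^{\langle-1\rangle}(v)$.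
   Context: $\mathbb F=\mathbb R$ or $\mathbb C$; $V$ is a vector space over $\mathbb F$ (of any dimension); $V^*$ is its algebraic dual; $\langle\cdot,\cdot\rangle$ denotes the dual pairing (also between $(V^{\odot n})^*$ and $V^{\odot n}$). $\mathbb N=\{1,2,\dots\}$, $\mathbb N_0=\mathbb N\cup\{0\}$. $\mathcal L(U,W)$ is the space of linear operators from $U$ to $W$, $\mathcal L(U)=\mathcal L(U,U)$. $V^{\odot n}$ is the $n$th algebraic symmetric tensor power of $V$, the linear span of the vectors $v_1\odot\dots\odot v_n=\frac1{n!}\sum_{\pi\in S_n}v_{\pi(1)}\otimes\dots\otimes v_{\pi(n)}$ (equivalently, of the vectors $v^{\otimes n}$, $v\in V$); $V^{\odot 0}=\mathbb F$, $v^{\otimes 0}=1$. For $\omega\in V^*$, $\omega^{\otimes n}\in(V^{\odot n})^*$ is given by $\langle\omega^{\otimes n},v_1\odot\dots\odot v_n\rangle=\prod_i\langle\omega,v_i\rangle$, and $\omega^{\otimes 0}=1$. For linear operators $A_i$ on $V^{\odot l_i}$ ($i=1,\dots,n$), $m=l_1+\dots+l_n$, the operator $A_1\odot\dots\odot A_n$ on $V^{\odot m}$ is determined by $(A_1\odot\dots\odot A_n)v^{\otimes m}=(A_1v^{\otimes l_1})\odot\dots\odot(A_nv^{\otimes l_n})$. Polynomials: $\mathcal P(V^* )$ is the vector space of functions $p:V^*\to\mathbb F$ of the form $p(\omega)=\sum_{k=0}^n\langle\omega^{\otimes k},f_k\rangle$ with $f_k\in V^{\odot k}$ (uniquely determined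 by $p$). $\mathcal P(V^*,W)$ is the linear span of the functions $\omega\mapsto p(\omega)w$, $p\in\mathcal P(V^* )$, $w\in W$. $(E(\theta)p)(\omega)=p(\omega+\theta)$ and $(D(\theta)p)(\omega)=\frac{d}{dt}\big|_{t=0}p(\omega+t\theta)$, $\theta\in V^*$. $T\in\mathcal L(\mathcal P(V^* ))$ is shift-invariant if $TE(\theta)=E(\theta)T$ for all $\theta$; $G\in\mathcal L(\mathcal P(V^* ),\mathcal P(V^*,V))$ is shift-invariant if $(GE(\theta)p)(\omega)=(Gp)(\omega+\theta)$ for all $p,\omega,\theta$. Polynomial sequences: $\mathbb P(V)$ is the set of operators $P\in\mathcal L(\mathcal P(V^* ))$ of the form $(P\langle\cdot^{\otimes n},f_n\rangle)(\omega)=\sum_{k=0}^n\langle\omega^{\otimes k},P_{kn}f_n\rangle$ for $f_n\in V^{\odot n}$, $n\in\mathbb N_0$, with $P_{kn}\in\mathcal L(V^{\odot n},V^{\odot k})$ and each $P_{nn}$ bijective; one writes $P=[P_{kn}]_{k,n\in\mathbb N_0}$ with $P_{kn}=0$ for $k>n$. Such $P$ is a bijection. The corresponding polynomial sequence, $P_n(\omega)\in(V^{\odot n})^*$, is defined by $\langle P_n(\omega),f_n\rangle=(P\langle\cdot^{\otimes n},f_n\rangle)(\omega)$. It is a binomial sequence (and $P$ an umbral operator) if $P_0=1$ and $P_n(\omega+\theta)=\sum_{k=0}^n\binom nkP_k(\omega)\odot P_{n-k}(\theta)$ for all $\omega,\theta\in V^*$, $n\in\mathbb N$. The lowering operators are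 $Q(\theta)=PD(\theta)P^{-1}$; the lowering differential $Q\in\mathcal L(\mathcal P(V^* ),\mathcal P(V^*,V))$ is determined by $\langle\theta,(Qp)(\omega)\rangle=(Q(\theta)p)(\omega)$ for all $\theta\in V^*$. $D^k\in\mathcal L(\mathcal P(V^* ),\mathcal P(V^*,V^{\odot k}))$ is determined by $(D^k\langle\cdot^{\otimes n},v^{\otimes n}\rangle)(\omega)=n(n-1)\dotsm(n-k+1)\langle\omega,v\rangle^{n-k}v^{\otimes k}$ (zero if $k>n$). For $L_k\in\mathcal L(V^{\odot k},V)$, $(L_kD^kp)(\omega)=L_k((D^kp)(\omega))$, and $L(D)=\sum_{k\ge1}L_kD^k$; for $T_k\in(V^{\odot k})^*$, $(\langle T_k,D^k\rangle p)(\omega)=\langle T_k,(D^kp)(\omega)\rangle$; $\theta L_k\in(V^{\odot k})^*$ is the composition $f\mapsto\langle\theta,L_kf\rangle$. (These sums are finite on each polynomial.) Formal tensor power series: $\mathcal F(V,W)$ is the set of formal series $A(v)=A_0+\sum_{n\ge1}A_nv^{\otimes n}$ with $A_0\in W$, $A_n\in\mathcal L(V^{\odot n},W)$, identified with the coefficient sequence $(A_n)_n$; $A(0)=A_0$; for $W=\mathbb F$ one writes $\langle A_n,v^{\otimes n}\rangle$. Products in $\mathcal F(V,\mathbb F)$ have coefficients $\sum_{k=0}^nA^{(1)}_k\odot A^{(2)}_{n-k}$. $\langle\omega,B(v)\rangle=\sum_n\langle\omega B_n,v^{\otimes n}\rangle$; $\exp[C(v)]=\sum_{k\ge0}\frac1{k!}C(v)^k$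 when $C(0)=0$. For $B(v)\in\mathcal F(V,V)$ with $B(0)=0$, $B(v)^{\otimes k}\in\mathcal F(V,V^{\odot k})$ has $n$th coefficient $\sum_{i_1,\dots,i_k\ge1,\,i_1+\dots+i_k=n}B_{i_1}\odot\dots\odot B_{i_k}$, and $A(B(v))=A_0+\sum_{k\ge1}A_kB(v)^{\otimes k}$. $\mathcal F_1(V)$ is the set of $B(v)=\sum_{n\ge1}B_nv^{\otimes n}\in\mathcal F(V,V)$ with $B(0)=0$ and $B_1\in\mathcal L(V)$ invertible; it is a group under composition with identity $v$, and $B^{\langle-1\rangle}(v)$ is the inverse of $B(v)$ in it. *)

theory Defs
  imports
    "HOL-Analysis.Analysis"
    "HOL-Library.Function_Algebras"
    "HOL-Combinatorics.Permutations"
begin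

text \<open>
  The scalar field is a type of class \<open>real_normed_field\<close>; by the Gelfand-Mazur theorem such a
  field is isomorphic to the real or the complex numbers, and both are instances. The vector space
  \<open>V\<close> is a type with scalar multiplication \<open>s\<close> satisfying \<open>vector_space s\<close>.

  Function spaces carry the pointwise addition of \<open>Function_Algebras\<close>. Throughout, a function on
  a proper subset of a type (a function on the dual space, a linear operator on a subspace) is
  represented by its extension by zero, so that equality of such functions is HOL equality.
\<close>

definition pscale :: "('k \<Rightarrow> 'w \<Rightarrow> 'w) \<Rightarrow> 'k \<Rightarrow> ('x \<Rightarrow> 'w) \<Rightarrow> ('x \<Rightarrow> 'w)" where
  "pscale sw c f = (\<lambda>x. sw c (f x))"

definition lin_maps ::
  "('k \<Rightarrow> 'u \<Rightarrow> 'u) \<Rightarrow> 'u set \<Rightarrow> ('k \<Rightarrow> 'w \<Rightarrow> 'w) \<Rightarrow> 'w set \<Rightarrow> ('u::ab_group_add \<Rightarrow> 'w::ab_group_add) set"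
  where
  "lin_maps su U sw W = {T. (\<forall>x\<in>U. T x \<in> W) \<and>
     (\<forall>x\<in>U. \<forall>y\<in>U. T (x + y) = T x + T y) \<and>
     (\<forall>c. \<forall>x\<in>U. T (su c x) = sw c (T x)) \<and>
     (\<forall>x. x \<notin> U \<longrightarrow> T x = 0)}"

definition dual_space :: "('k::field \<Rightarrow> 'v::ab_group_add \<Rightarrow> 'v) \<Rightarrow> ('v \<Rightarrow> 'k) set" where
  "dual_space s = {\<omega>. Vector_Spaces.linear s (*) \<omega>}"


section \<open>Symmetric tensor powers\<close>

text \<open>
  The algebraic tensor power is realised inside the multilinear forms on the dual space: the
  tensor product of \<open>v\<^sub>1, \<dots>, v\<^sub>n\<close> is the form sending \<open>\<omega>\<^sub>1, \<dots>, \<omega>\<^sub>n\<close> to the product of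
  the \<open>\<omega>\<^sub>i v\<^sub>i\<close>. As the dual space separates the points of \<open>V\<close>, the canonical map from the
  tensor power to these forms is injective. The arguments form a list, so all tensor powers share
  one type; a tensor of degree \<open>n\<close> vanishes off the lists of length \<open>n\<close> over the dual space.
  The scalar 1, as a tensor of degree 0, is \<open>tensor s []\<close>, and the scalar represented by a tensor
  \<open>f\<close> of degree 0 is \<open>f []\<close>.
\<close>

type_synonym ('v, 'k) tensor = "('v \<Rightarrow> 'k) list \<Rightarrow> 'k"

definition tensor :: "('k::field \<Rightarrow> 'v::ab_group_add \<Rightarrow> 'v) \<Rightarrow> 'v list \<Rightarrow> ('v, 'k) tensor" where
  "tensor s vs = (\<lambda>\<omega>s. if length \<omega>s = length vs \<and> set \<omega>s \<subseteq> dual_space s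
     then \<Prod>i<length vs. (\<omega>s ! i) (vs ! i) else 0)"

definition sym_tensor ::
  "('k::field_char_0 \<Rightarrow> 'v::ab_group_add \<Rightarrow> 'v) \<Rightarrow> 'v list \<Rightarrow> ('v, 'k) tensor" where
  "sym_tensor s vs = pscale (*) (1 / fact (length vs))
     (\<Sum>\<pi> | \<pi> permutes {..<length vs}. tensor s (permute_list \<pi> vs))"

definition sym_power ::
  "('k::field_char_0 \<Rightarrow> 'v::ab_group_add \<Rightarrow> 'v) \<Rightarrow> nat \<Rightarrow> ('v, 'k) tensor set" where
  "sym_power s n = module.span (pscale (*)) {sym_tensor s vs | vs. length vs = n}"

definition tpow ::
  "('k::field \<Rightarrow> 'v::ab_group_add \<Rightarrow> 'v) \<Rightarrow> 'v \<Rightarrow> nat \<Rightarrow> ('v, 'k) tensor" where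
  "tpow s v n = tensor s (replicate n v)"

text \<open>
  On \<open>sym_tensor s [v\<^sub>1, \<dots>, v\<^sub>n]\<close> the following pairing is the product of the \<open>\<omega> v\<^sub>i\<close>.
\<close>

definition dual_tpow :: "('v \<Rightarrow> 'k) \<Rightarrow> nat \<Rightarrow> ('v, 'k) tensor \<Rightarrow> 'k" where
  "dual_tpow \<omega> n f = f (replicate n \<omega>)"

text \<open>
  The linear map on the \<open>n\<close>th symmetric tensor power determined by its values on the \<open>n\<close>th tensor
  powers of vectors. It exists in all uses below, where \<open>\<phi>\<close> is the diagonal of an \<open>n\<close>-linear map.
\<close>

definition sym_lift ::
  "('k::field_char_0 \<Rightarrow> 'v::ab_group_add \<Rightarrow> 'v) \<Rightarrow> nat \<Rightarrow> ('k \<Rightarrow> 'w \<Rightarrow> 'w) \<Rightarrow> ('v \<Rightarrow> 'w)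
    \<Rightarrow> ('v, 'k) tensor \<Rightarrow> 'w::ab_group_add" where
  "sym_lift s n sw \<phi> = (THE A. A \<in> lin_maps (pscale (*)) (sym_power s n) sw UNIV \<and>
     (\<forall>v. A (tpow s v n) = \<phi> v))"

text \<open>
  Symmetric products of linear operators: of two scalar-valued ones (elements of the duals of the
  symmetric tensor powers of degrees \<open>k\<close> and \<open>m\<close>), and of the \<open>V\<close>-valued operators \<open>B i\<close>,
  \<open>i\<close> running through the list \<open>is\<close>, where \<open>B i\<close> acts on the \<open>i\<close>th symmetric tensor power.
\<close>

definition odot ::
  "('k::field_char_0 \<Rightarrow> 'v::ab_group_add \<Rightarrow> 'v) \<Rightarrow> nat \<Rightarrow> (('v, 'k) tensor \<Rightarrow> 'k) \<Rightarrow> nat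
    \<Rightarrow> (('v, 'k) tensor \<Rightarrow> 'k) \<Rightarrow> ('v, 'k) tensor \<Rightarrow> 'k" where
  "odot s k F m G = sym_lift s (k + m) (*) (\<lambda>v. F (tpow s v k) * G (tpow s v m))"

definition odot_list ::
  "('k::field_char_0 \<Rightarrow> 'v::ab_group_add \<Rightarrow> 'v) \<Rightarrow> (nat \<Rightarrow> ('v, 'k) tensor \<Rightarrow> 'v) \<Rightarrow> nat list
    \<Rightarrow> ('v, 'k) tensor \<Rightarrow> ('v, 'k) tensor" where
  "odot_list s B is = sym_lift s (sum_list is) (pscale (*))
     (\<lambda>v. sym_tensor s (map (\<lambda>i. B i (tpow s v i)) is))"

text \<open>The element 1 of the dual of the symmetric tensor power of degree 0.\<close>

definition unit_functional ::
  "('k::field_char_0 \<Rightarrow> 'v::ab_group_add \<Rightarrow> 'v) \<Rightarrow> ('v, 'k) tensor \<Rightarrow> 'k" where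
  "unit_functional s = (\<lambda>f. if f \<in> sym_power s 0 then f [] else 0)"


section \<open>Polynomials on the dual space\<close>

definition homog ::
  "('k::field \<Rightarrow> 'v::ab_group_add \<Rightarrow> 'v) \<Rightarrow> nat \<Rightarrow> ('v, 'k) tensor \<Rightarrow> ('v \<Rightarrow> 'k) \<Rightarrow> 'k" where
  "homog s n f = (\<lambda>\<omega>. if \<omega> \<in> dual_space s then dual_tpow \<omega> n f else 0)"

definition polys ::
  "('k::field_char_0 \<Rightarrow> 'v::ab_group_add \<Rightarrow> 'v) \<Rightarrow> (('v \<Rightarrow> 'k) \<Rightarrow> 'k) set" where
  "polys s = {\<Sum>k\<le>n. homog s k (f k) | n f. \<forall>k\<le>n. f k \<in> sym_power s k}"

definition vec_polys ::
  "('k::field_char_0 \<Rightarrow> 'v::ab_group_add \<Rightarrow> 'v) \<Rightarrow> ('k \<Rightarrow> 'w \<Rightarrow> 'w) \<Rightarrow> 'w set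
    \<Rightarrow> (('v \<Rightarrow> 'k) \<Rightarrow> 'w::ab_group_add) set" where
  "vec_polys s sw W = module.span (pscale sw) {\<lambda>\<omega>. sw (p \<omega>) w | p w. p \<in> polys s \<and> w \<in> W}"

definition shift_op ::
  "('k::field \<Rightarrow> 'v::ab_group_add \<Rightarrow> 'v) \<Rightarrow> ('v \<Rightarrow> 'k) \<Rightarrow> (('v \<Rightarrow> 'k) \<Rightarrow> 'k) \<Rightarrow> ('v \<Rightarrow> 'k) \<Rightarrow> 'k" where
  "shift_op s \<theta> p = (\<lambda>\<omega>. if \<omega> \<in> dual_space s then p (\<omega> + \<theta>) else 0)"

definition dir_deriv ::
  "('k::real_normed_field \<Rightarrow> 'v::ab_group_add \<Rightarrow> 'v) \<Rightarrow> ('v \<Rightarrow> 'k) \<Rightarrow> (('v \<Rightarrow> 'k) \<Rightarrow> 'k)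
    \<Rightarrow> ('v \<Rightarrow> 'k) \<Rightarrow> 'k" where
  "dir_deriv s \<theta> p = (\<lambda>\<omega>. if \<omega> \<in> dual_space s
     then deriv (\<lambda>t. p (\<omega> + pscale (*) t \<theta>)) 0 else 0)"

definition shift_invariant ::
  "('k::field_char_0 \<Rightarrow> 'v::ab_group_add \<Rightarrow> 'v)
    \<Rightarrow> ((('v \<Rightarrow> 'k) \<Rightarrow> 'k) \<Rightarrow> (('v \<Rightarrow> 'k) \<Rightarrow> 'k)) \<Rightarrow> bool" where
  "shift_invariant s T \<longleftrightarrow>
     T \<in> lin_maps (pscale (*)) (polys s) (pscale (*)) (polys s) \<and>
     (\<forall>\<theta>\<in>dual_space s. \<forall>p\<in>polys s. T (shift_op s \<theta> p) = shift_op s \<theta> (T p))"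

definition vec_shift_invariant ::
  "('k::field_char_0 \<Rightarrow> 'v::ab_group_add \<Rightarrow> 'v)
    \<Rightarrow> ((('v \<Rightarrow> 'k) \<Rightarrow> 'k) \<Rightarrow> (('v \<Rightarrow> 'k) \<Rightarrow> 'v)) \<Rightarrow> bool" where
  "vec_shift_invariant s G \<longleftrightarrow>
     G \<in> lin_maps (pscale (*)) (polys s) (pscale s) (vec_polys s s UNIV) \<and>
     (\<forall>p\<in>polys s. \<forall>\<omega>\<in>dual_space s. \<forall>\<theta>\<in>dual_space s. G (shift_op s \<theta> p) \<omega> = G p (\<omega> + \<theta>))"

text \<open>
  The natural-number factor \<open>\<Prod>i<k. n - i\<close> is the falling factorial; it is 0 for \<open>k > n\<close>.
\<close>

definition Dpow ::
  "('k::field_char_0 \<Rightarrow> 'v::ab_group_add \<Rightarrow> 'v) \<Rightarrow> nat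
    \<Rightarrow> (('v \<Rightarrow> 'k) \<Rightarrow> 'k) \<Rightarrow> ('v \<Rightarrow> 'k) \<Rightarrow> ('v, 'k) tensor" where
  "Dpow s k = (THE D.
     D \<in> lin_maps (pscale (*)) (polys s)
           (pscale (pscale (*))) (vec_polys s (pscale (*)) (sym_power s k)) \<and>
     (\<forall>n v. \<forall>\<omega>\<in>dual_space s. D (homog s n (tpow s v n)) \<omega> =
        pscale (*) (of_nat (\<Prod>i<k. n - i) * \<omega> v ^ (n - k)) (tpow s v k)))"

text \<open>
  The operator \<open>\<Sum>k\<ge>1. A k \<circ> D\<^sup>k\<close>, for \<open>A k\<close> linear on the \<open>k\<close>th symmetric tensor power. Only
  finitely many \<open>D\<^sup>k p\<close> are non-zero. With values in \<open>V\<close> this is \<open>L(D)\<close>, with scalar values it is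
  the sum of the operators \<open>\<langle>T\<^sub>k, D\<^sup>k\<rangle>\<close>.
\<close>

definition series_D ::
  "('k::field_char_0 \<Rightarrow> 'v::ab_group_add \<Rightarrow> 'v) \<Rightarrow> (nat \<Rightarrow> ('v, 'k) tensor \<Rightarrow> 'w::ab_group_add)
    \<Rightarrow> (('v \<Rightarrow> 'k) \<Rightarrow> 'k) \<Rightarrow> ('v \<Rightarrow> 'k) \<Rightarrow> 'w" where
  "series_D s A p = (\<lambda>\<omega>. \<Sum>k | 1 \<le> k \<and> Dpow s k p \<noteq> 0. A k (Dpow s k p \<omega>))"


section \<open>Polynomial sequences\<close>

text \<open>\<open>poly_operator s P M\<close>: \<open>P\<close> belongs to \<open>\<bbbP>(V)\<close> and \<open>M k n\<close> is its entry \<open>P\<^sub>k\<^sub>n\<close>.\<close>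

definition poly_operator ::
  "('k::field_char_0 \<Rightarrow> 'v::ab_group_add \<Rightarrow> 'v)
    \<Rightarrow> ((('v \<Rightarrow> 'k) \<Rightarrow> 'k) \<Rightarrow> (('v \<Rightarrow> 'k) \<Rightarrow> 'k))
    \<Rightarrow> (nat \<Rightarrow> nat \<Rightarrow> ('v, 'k) tensor \<Rightarrow> ('v, 'k) tensor) \<Rightarrow> bool" where
  "poly_operator s P M \<longleftrightarrow>
     P \<in> lin_maps (pscale (*)) (polys s) (pscale (*)) (polys s) \<and>
     (\<forall>k n. M k n \<in> lin_maps (pscale (*)) (sym_power s n) (pscale (*)) (sym_power s k)) \<and>
     (\<forall>k n. n < k \<longrightarrow> M k n = 0) \<and>
     (\<forall>n. bij_betw (M n n) (sym_power s n) (sym_power s n)) \<and>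
     (\<forall>n. \<forall>f\<in>sym_power s n. P (homog s n f) = (\<Sum>k\<le>n. homog s k (M k n f)))"

definition poly_seq ::
  "('k::field_char_0 \<Rightarrow> 'v::ab_group_add \<Rightarrow> 'v)
    \<Rightarrow> ((('v \<Rightarrow> 'k) \<Rightarrow> 'k) \<Rightarrow> (('v \<Rightarrow> 'k) \<Rightarrow> 'k))
    \<Rightarrow> nat \<Rightarrow> ('v \<Rightarrow> 'k) \<Rightarrow> ('v, 'k) tensor \<Rightarrow> 'k" where
  "poly_seq s P n \<omega> = (\<lambda>f. if f \<in> sym_power s n then P (homog s n f) \<omega> else 0)"

definition binomial_seq ::
  "('k::field_char_0 \<Rightarrow> 'v::ab_group_add \<Rightarrow> 'v)
    \<Rightarrow> (nat \<Rightarrow> ('v \<Rightarrow> 'k) \<Rightarrow> ('v, 'k) tensor \<Rightarrow> 'k) \<Rightarrow> bool" where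
  "binomial_seq s p \<longleftrightarrow>
     (\<forall>\<omega>\<in>dual_space s. p 0 \<omega> = unit_functional s) \<and>
     (\<forall>n\<ge>1. \<forall>\<omega>\<in>dual_space s. \<forall>\<theta>\<in>dual_space s.
        p n (\<omega> + \<theta>) =
          (\<Sum>k\<le>n. pscale (*) (of_nat (n choose k)) (odot s k (p k \<omega>) (n - k) (p (n - k) \<theta>))))"

definition lowering_op ::
  "('k::real_normed_field \<Rightarrow> 'v::ab_group_add \<Rightarrow> 'v)
    \<Rightarrow> ((('v \<Rightarrow> 'k) \<Rightarrow> 'k) \<Rightarrow> (('v \<Rightarrow> 'k) \<Rightarrow> 'k))
    \<Rightarrow> ('v \<Rightarrow> 'k) \<Rightarrow> (('v \<Rightarrow> 'k) \<Rightarrow> 'k) \<Rightarrow> ('v \<Rightarrow> 'k) \<Rightarrow> 'k" where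
  "lowering_op s P \<theta> =
     (\<lambda>p. if p \<in> polys s then P (dir_deriv s \<theta> (inv_into (polys s) P p)) else 0)"

definition lowering_diff ::
  "('k::real_normed_field \<Rightarrow> 'v::ab_group_add \<Rightarrow> 'v)
    \<Rightarrow> ((('v \<Rightarrow> 'k) \<Rightarrow> 'k) \<Rightarrow> (('v \<Rightarrow> 'k) \<Rightarrow> 'k))
    \<Rightarrow> (('v \<Rightarrow> 'k) \<Rightarrow> 'k) \<Rightarrow> ('v \<Rightarrow> 'k) \<Rightarrow> 'v" where
  "lowering_diff s P = (THE Q.
     Q \<in> lin_maps (pscale (*)) (polys s) (pscale s) (vec_polys s s UNIV) \<and>
     (\<forall>p\<in>polys s. \<forall>\<theta>\<in>dual_space s. \<forall>\<omega>\<in>dual_space s. \<theta> (Q p \<omega>) = lowering_op s P \<theta> p \<omega>))"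


section \<open>Formal tensor power series\<close>

text \<open>
  A series is the sequence of its coefficients. The constant term, an element of \<open>W\<close>, is given as
  a linear map on the symmetric tensor power of degree 0 (which is the field), through its value
  at 1.
\<close>

definition fseries ::
  "('k::field_char_0 \<Rightarrow> 'v::ab_group_add \<Rightarrow> 'v) \<Rightarrow> ('k \<Rightarrow> 'w \<Rightarrow> 'w) \<Rightarrow> 'w set
    \<Rightarrow> (nat \<Rightarrow> ('v, 'k) tensor \<Rightarrow> 'w::ab_group_add) set" where
  "fseries s sw W = {A. \<forall>n. A n \<in> lin_maps (pscale (*)) (sym_power s n) sw W}"

definition series_one ::
  "('k::field_char_0 \<Rightarrow> 'v::ab_group_add \<Rightarrow> 'v) \<Rightarrow> nat \<Rightarrow> ('v, 'k) tensor \<Rightarrow> 'k" where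
  "series_one s n = (if n = 0 then unit_functional s else 0)"

definition series_mult ::
  "('k::field_char_0 \<Rightarrow> 'v::ab_group_add \<Rightarrow> 'v) \<Rightarrow> (nat \<Rightarrow> ('v, 'k) tensor \<Rightarrow> 'k)
    \<Rightarrow> (nat \<Rightarrow> ('v, 'k) tensor \<Rightarrow> 'k) \<Rightarrow> nat \<Rightarrow> ('v, 'k) tensor \<Rightarrow> 'k" where
  "series_mult s A B n = (\<Sum>k\<le>n. odot s k (A k) (n - k) (B (n - k)))"

definition series_power ::
  "('k::field_char_0 \<Rightarrow> 'v::ab_group_add \<Rightarrow> 'v) \<Rightarrow> (nat \<Rightarrow> ('v, 'k) tensor \<Rightarrow> 'k) \<Rightarrow> nat
    \<Rightarrow> nat \<Rightarrow> ('v, 'k) tensor \<Rightarrow> 'k" where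
  "series_power s C k = (series_mult s C ^^ k) (series_one s)"

text \<open>
  Meant for \<open>C\<close> with zero constant term: then the \<open>n\<close>th coefficient of the \<open>k\<close>th power vanishes
  for \<open>k > n\<close>, so the sum over all \<open>k\<close> stops at \<open>n\<close>. The same remark applies to \<open>series_comp\<close>.
\<close>

definition series_exp ::
  "('k::field_char_0 \<Rightarrow> 'v::ab_group_add \<Rightarrow> 'v) \<Rightarrow> (nat \<Rightarrow> ('v, 'k) tensor \<Rightarrow> 'k)
    \<Rightarrow> nat \<Rightarrow> ('v, 'k) tensor \<Rightarrow> 'k" where
  "series_exp s C n = (\<Sum>k\<le>n. pscale (*) (1 / fact k) (series_power s C k n))"

definition series_pair ::
  "('v \<Rightarrow> 'k) \<Rightarrow> (nat \<Rightarrow> ('v, 'k) tensor \<Rightarrow> 'v) \<Rightarrow> nat \<Rightarrow> ('v, 'k) tensor \<Rightarrow> 'k" where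
  "series_pair \<omega> B n = (\<lambda>f. \<omega> (B n f))"

definition series_tpow ::
  "('k::field_char_0 \<Rightarrow> 'v::ab_group_add \<Rightarrow> 'v) \<Rightarrow> (nat \<Rightarrow> ('v, 'k) tensor \<Rightarrow> 'v) \<Rightarrow> nat
    \<Rightarrow> nat \<Rightarrow> ('v, 'k) tensor \<Rightarrow> ('v, 'k) tensor" where
  "series_tpow s B k n =
     (\<Sum>is | length is = k \<and> (\<forall>i\<in>set is. 1 \<le> i) \<and> sum_list is = n. odot_list s B is)"

definition series_comp ::
  "('k::field_char_0 \<Rightarrow> 'v::ab_group_add \<Rightarrow> 'v) \<Rightarrow> (nat \<Rightarrow> ('v, 'k) tensor \<Rightarrow> 'w::ab_group_add)
    \<Rightarrow> (nat \<Rightarrow> ('v, 'k) tensor \<Rightarrow> 'v) \<Rightarrow> nat \<Rightarrow> ('v, 'k) tensor \<Rightarrow> 'w" where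
  "series_comp s A B n =
     (if n = 0 then A 0 else (\<Sum>k = 1..n. (\<lambda>f. A k (series_tpow s B k n f))))"

text \<open>
  Invertibility of the first coefficient uses the identification of \<open>V\<close> with the symmetric tensor
  power of degree 1 by \<open>\<lambda>v. tpow s v 1\<close>.
\<close>

definition fseries1 ::
  "('k::field_char_0 \<Rightarrow> 'v::ab_group_add \<Rightarrow> 'v) \<Rightarrow> (nat \<Rightarrow> ('v, 'k) tensor \<Rightarrow> 'v) set" where
  "fseries1 s = {B \<in> fseries s s UNIV. B 0 = 0 \<and> bij (\<lambda>v. B 1 (tpow s v 1))}"

definition series_id ::
  "('k::field_char_0 \<Rightarrow> 'v::ab_group_add \<Rightarrow> 'v) \<Rightarrow> nat \<Rightarrow> ('v, 'k) tensor \<Rightarrow> 'v" where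
  "series_id s n = (if n = 1 then sym_lift s 1 s (\<lambda>v. v) else 0)"

definition is_comp_inverse ::
  "('k::field_char_0 \<Rightarrow> 'v::ab_group_add \<Rightarrow> 'v) \<Rightarrow> (nat \<Rightarrow> ('v, 'k) tensor \<Rightarrow> 'v)
    \<Rightarrow> (nat \<Rightarrow> ('v, 'k) tensor \<Rightarrow> 'v) \<Rightarrow> bool" where
  "is_comp_inverse s B L \<longleftrightarrow> B \<in> fseries1 s \<and> L \<in> fseries1 s \<and>
     series_comp s L B = series_id s \<and> series_comp s B L = series_id s"

end

theory Submission
  imports Defs
begin

text \<open>
  Write \<open>e\<^sub>n\<^sub>,\<^sub>v\<close> for the polynomial \<open>\<omega> \<mapsto> (\<omega> v)\<^sup>n\<close>. By polarization the powers \<open>v\<^sup>n\<close> span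
  the \<open>n\<close>th symmetric tensor power, so the \<open>e\<^sub>n\<^sub>,\<^sub>v\<close> span the polynomials, a linear operator is
  determined by its values on them, and an identity between formal tensor power series may be tested
  for one vector \<open>v\<close> at a time, as an identity in the ring of formal power series in one variable.
  The converse task, to produce a linear map with prescribed values on these generators, is settled
  by \<open>linear_extension\<close>: it suffices that the compositions with a separating family of functionals
  extend linearly.

  In these terms a binomial sequence is one with
  \<open>E(\<eta>) P e\<^sub>n\<^sub>,\<^sub>v = \<Sum>\<^sub>k (n choose k) (P e\<^sub>k\<^sub>,\<^sub>v)(\<eta>) P e\<^sub>n\<^sub>-\<^sub>k\<^sub>,\<^sub>v\<close> (\<open>umbral\<close>), while
  \<open>Q(\<theta>) P e\<^sub>n\<^sub>,\<^sub>v = n \<theta>(v) P e\<^sub>n\<^sub>-\<^sub>1\<^sub>,\<^sub>v\<close> always. Operators that act on the \<open>P e\<^sub>n\<^sub>,\<^sub>v\<close> by a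
  binomial convolution commute (\<open>convolution_ops_commute\<close>), hence the shift invariance of \<open>Q(\<theta>)\<close>.
  Conversely, if the \<open>Q(\<theta>)\<close> are shift-invariant, then, by induction on \<open>n\<close>, all \<open>Q(\<theta>)\<close>
  annihilate the difference of the two sides of the umbral identity; it vanishes at 0, so it is zero
  (\<open>shift_invariant_imp_umbral\<close>). The lowering differential has the \<open>Q(\<theta>)\<close> as its components.

  For an umbral operator the derivative \<open>D(\<theta>)\<close> is again a convolution operator, with coefficients
  \<open>\<langle>\<theta>, P\<^sub>1\<^sub>k v\<^sup>k\<rangle>\<close>. Let \<open>a\<^sub>k\<close> be the power series whose coefficients are
  the values of \<open>P\<^sub>k\<^sub>n v\<^sup>n / n!\<close> on the diagonal at \<open>\<theta>\<close>. Iterating \<open>D(\<theta>)\<close> gives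
  \<open>(k + 1) a\<^sub>k\<^sub>+\<^sub>1 = a\<^sub>1 a\<^sub>k\<close>, so \<open>a\<^sub>k = a\<^sub>1\<^sup>k / k!\<close>; this is \<open>B5\<close>, with \<open>B\<^sub>n = P\<^sub>1\<^sub>n / n!\<close>
  (\<open>umbral_imp_coeff_identity\<close>). \<open>B4\<close> is \<open>B5\<close> summed over \<open>k\<close>, and comparison of homogeneous
  components leads back. The exponential law returns from \<open>B4\<close> to the umbral identity.

  For \<open>B3\<close>, Taylor's formula computes \<open>D\<^sup>k P e\<^sub>n\<^sub>,\<^sub>v\<close>, and \<open>Q = L(D)\<close> turns out to mean that
  \<open>\<Sum>\<^sub>k k! L\<^sub>k P\<^sub>k\<^sub>n v\<^sup>n\<close> is \<open>v\<close> for \<open>n = 1\<close> and 0 otherwise. In other words, the \<open>k! L\<^sub>k\<close> form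
  the row with index 1 of the inverse of the matrix of \<open>P\<close>. As the inverse of an umbral operator is
  umbral (\<open>inverse_umbral\<close>), this \<open>L\<close> is the series that \<open>B5\<close> attaches to the inverse operator, and
  the two products of the matrix with its inverse read off at row 1 are \<open>B(L(v)) = v\<close> and
  \<open>L(B(v)) = v\<close>.
\<close>

section \<open>Linear maps on subspaces\<close>

lemma vector_space_pscale:
  assumes "vector_space sw"
  shows "vector_space (pscale sw)"
proof -
  interpret vector_space sw by fact
  show ?thesis
    by unfold_locales (auto simp: pscale_def fun_eq_iff algebra_simps)
qed

lemma vector_space_times: "vector_space ((*) :: 'k::field \<Rightarrow> 'k \<Rightarrow> 'k)"
  by unfold_locales (auto simp: algebra_simps)

interpretation form: vector_space "pscale ((*) :: 'k::field \<Rightarrow> 'k \<Rightarrow> 'k)"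
  by (rule vector_space_pscale[OF vector_space_times])

lemma pscale_apply [simp]: "pscale sw c f x = sw c (f x)"
  by (simp add: pscale_def)

lemma lin_mapsI:
  assumes "\<And>x. x \<in> U \<Longrightarrow> T x \<in> W"
    and "\<And>x y. x \<in> U \<Longrightarrow> y \<in> U \<Longrightarrow> T (x + y) = T x + T y"
    and "\<And>c x. x \<in> U \<Longrightarrow> T (su c x) = sw c (T x)"
    and "\<And>x. x \<notin> U \<Longrightarrow> T x = 0"
  shows "T \<in> lin_maps su U sw W"
  using assms by (auto simp: lin_maps_def)

lemma lin_maps_restrictI:
  assumes "module.subspace su U" "vector_space su"
    and "\<And>x. x \<in> U \<Longrightarrow> T x \<in> W"
    and "\<And>x y. x \<in> U \<Longrightarrow> y \<in> U \<Longrightarrow> T (x + y) = T x + T y"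
    and "\<And>c x. x \<in> U \<Longrightarrow> T (su c x) = sw c (T x)"
  shows "(\<lambda>x. if x \<in> U then T x else 0) \<in> lin_maps su U sw W"
proof -
  interpret vector_space su by fact
  show ?thesis
    using assms subspace_add[OF assms(1)] subspace_scale[OF assms(1)]
    by (intro lin_mapsI) auto
qed

lemma lin_maps_in: "T \<in> lin_maps su U sw W \<Longrightarrow> x \<in> U \<Longrightarrow> T x \<in> W"
  and lin_maps_add: "T \<in> lin_maps su U sw W \<Longrightarrow> x \<in> U \<Longrightarrow> y \<in> U \<Longrightarrow> T (x + y) = T x + T y"
  and lin_maps_scale: "T \<in> lin_maps su U sw W \<Longrightarrow> x \<in> U \<Longrightarrow> T (su c x) = sw c (T x)"
  and lin_maps_outside: "T \<in> lin_maps su U sw W \<Longrightarrow> x \<notin> U \<Longrightarrow> T x = 0"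
  by (auto simp: lin_maps_def)

lemma lin_maps_zero:
  assumes "T \<in> lin_maps su U sw W"
  shows "T 0 = 0"
  using lin_maps_add[OF assms, of 0 0] lin_maps_outside[OF assms, of 0] by (cases "0 \<in> U") auto

lemma lin_maps_mono: "T \<in> lin_maps su U sw W \<Longrightarrow> W \<subseteq> W' \<Longrightarrow> T \<in> lin_maps su U sw W'"
  by (auto simp: lin_maps_def)

lemma lin_maps_sum:
  assumes T: "T \<in> lin_maps su U sw W" and "vector_space su" and U: "module.subspace su U"
    and x: "\<And>i. i \<in> I \<Longrightarrow> x i \<in> U"
  shows "T (\<Sum>i\<in>I. x i) = (\<Sum>i\<in>I. T (x i))"
proof -
  interpret vector_space su by fact
  show ?thesis
    using x
  proof (induction I rule: infinite_finite_induct)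
    case (insert i I)
    then show ?case
      by (simp add: lin_maps_add[OF T] subspace_sum[OF U])
  qed (auto simp: lin_maps_zero[OF T])
qed

lemma lin_maps_comp:
  assumes "S \<in> lin_maps sv V sw W" "T \<in> lin_maps su U sv V"
  shows "(\<lambda>x. S (T x)) \<in> lin_maps su U sw W"
  using assms lin_maps_zero[OF assms(1)] by (auto simp: lin_maps_def)

lemma lin_maps_pscale:
  assumes "vector_space sw" "module.subspace sw W" "T \<in> lin_maps su U sw W"
  shows "pscale sw c T \<in> lin_maps su U sw W"
proof -
  interpret vector_space sw by fact
  show ?thesis
    using assms(3) subspace_scale[OF assms(2)]
    by (auto simp: lin_maps_def scale_right_distrib mult.commute)
qed

lemma lin_maps_plus:
  assumes "vector_space sw" "module.subspace sw W"
    and "S \<in> lin_maps su U sw W" "T \<in> lin_maps su U sw W"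
  shows "S + T \<in> lin_maps su U sw W"
proof -
  interpret vector_space sw by fact
  show ?thesis
    using assms(3,4) subspace_add[OF assms(2)]
    by (auto simp: lin_maps_def scale_right_distrib)
qed

lemma lin_maps_sum_maps:
  fixes T :: "'i \<Rightarrow> 'u::ab_group_add \<Rightarrow> 'w::ab_group_add"
  assumes "vector_space sw" "module.subspace sw W"
    and "\<And>i. i \<in> I \<Longrightarrow> T i \<in> lin_maps su U sw W"
  shows "(\<Sum>i\<in>I. T i) \<in> lin_maps su U sw W"
proof -
  interpret vector_space sw by fact
  have 0: "(0 :: 'u \<Rightarrow> 'w) \<in> lin_maps su U sw W"
    using subspace_0[OF assms(2)] by (auto simp: lin_maps_def)
  show ?thesis
    using assms(3)
  proof (induction I rule: infinite_finite_induct)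
    case (insert i I)
    then have "T i + sum T I \<in> lin_maps su U sw W"
      by (intro lin_maps_plus[OF assms(1,2)]) auto
    with insert show ?case
      by (simp add: plus_fun_def)
  qed (use 0 in auto)
qed

lemma lin_maps_eval:
  assumes "T \<in> lin_maps su U (pscale sw) W"
  shows "(\<lambda>x. T x y) \<in> lin_maps su U sw UNIV"
  using assms by (auto simp: lin_maps_def)

lemma lin_maps_eqI:
  assumes "S \<in> lin_maps su U sw W" "T \<in> lin_maps su U sw' W'" "\<And>x. x \<in> U \<Longrightarrow> S x = T x"
  shows "S = T"
  using assms by (intro ext) (metis lin_maps_outside)

lemma lin_maps_eqI_span:
  assumes S: "S \<in> lin_maps su U sw W" and T: "T \<in> lin_maps su U sw W'"
    and "vector_space su" and U: "U = module.span su (range g)"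
    and eq: "\<And>i. S (g i) = T (g i)"
  shows "S = T"
proof (rule lin_maps_eqI[OF S T])
  interpret vector_space su by fact
  fix x assume "x \<in> U"
  then have "x \<in> U \<and> S x = T x"
    unfolding U
  proof (induction rule: span_induct_alt)
    case base
    then show ?case by (simp add: lin_maps_zero[OF S] lin_maps_zero[OF T] span_zero)
  next
    case (step c x y)
    then have "su c x \<in> U" "y \<in> U" "x \<in> U"
      unfolding U by (auto intro: span_base span_scale)
    with step show ?case
      using eq by (auto simp: lin_maps_add[OF S] lin_maps_add[OF T] lin_maps_scale[OF S]
          lin_maps_scale[OF T] U span_add)
  qed
  then show "S x = T x" by simp
qed

text \<open>
  A map prescribed on generators extends linearly as soon as its compositions with a separating
  family of functionals do: a linear relation between generators is then respected by every
  functional of the family, hence by the map.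
\<close>

lemma linear_extension:
  fixes \<phi> :: "'i \<Rightarrow> 'w::ab_group_add" and \<tau> :: "'t \<Rightarrow> 'w \<Rightarrow> 'k::field"
  assumes su: "vector_space su" and sw: "vector_space sw"
    and U: "U = module.span su (range g)" and W: "module.subspace sw W"
    and \<phi>: "\<And>i. \<phi> i \<in> W"
    and \<tau>_add: "\<And>t x y. t \<in> S \<Longrightarrow> \<tau> t (x + y) = \<tau> t x + \<tau> t y"
    and \<tau>_scale: "\<And>t c x. t \<in> S \<Longrightarrow> \<tau> t (sw c x) = c * \<tau> t x"
    and separating: "\<And>w. (\<And>t. t \<in> S \<Longrightarrow> \<tau> t w = 0) \<Longrightarrow> w = 0"
    and T: "\<And>t. t \<in> S \<Longrightarrow> \<exists>T\<in>lin_maps su U (*) UNIV. \<forall>i. T (g i) = \<tau> t (\<phi> i)"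
  shows "\<exists>A\<in>lin_maps su U sw W. \<forall>i. A (g i) = \<phi> i"
proof -
  interpret su: vector_space su by fact
  interpret sw: vector_space sw by fact
  obtain T where T: "\<And>t. t \<in> S \<Longrightarrow> T t \<in> lin_maps su U (*) UNIV"
    "\<And>t i. t \<in> S \<Longrightarrow> T t (g i) = \<tau> t (\<phi> i)"
    using T by metis
  have \<tau>_diff: "\<tau> t (x - y) = \<tau> t x - \<tau> t y" if "t \<in> S" for t x y
    using \<tau>_add[OF that, of "x - y" y] by simp
  have unique: "w = w'" if "\<And>t. t \<in> S \<Longrightarrow> \<tau> t w = \<tau> t w'" for w w'
    using separating[of "w - w'"] that by (simp add: \<tau>_diff)
  have U_sub: "su.subspace U" unfolding U by simp
  have ex: "\<exists>w\<in>W. \<forall>t\<in>S. \<tau> t w = T t u" if "u \<in> U" for u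
  proof -
    have "u \<in> U \<and> (\<exists>w\<in>W. \<forall>t\<in>S. \<tau> t w = T t u)"
      using that unfolding U
    proof (induction rule: su.span_induct_alt)
      case base
      have "\<tau> t 0 = 0" if "t \<in> S" for t using \<tau>_diff[OF that, of 0 0] by simp
      then show ?case
        using lin_maps_zero[OF T(1)] sw.subspace_0[OF W] su.span_zero by auto
    next
      case (step c x y)
      then obtain w i where w: "w \<in> W" "\<And>t. t \<in> S \<Longrightarrow> \<tau> t w = T t y" and i: "x = g i" by auto
      have x: "x \<in> U" "su c x \<in> U" "y \<in> U"
        using step unfolding U by (auto intro: su.span_base su.span_scale)
      have "\<tau> t (sw c (\<phi> i) + w) = T t (su c x + y)" if "t \<in> S" for t
        using that x w i by (simp add: lin_maps_add[OF T(1)] lin_maps_scale[OF T(1)] \<tau>_add \<tau>_scale T(2))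
      moreover have "sw c (\<phi> i) + w \<in> W"
        using \<phi> w by (intro sw.subspace_add[OF W] sw.subspace_scale[OF W])
      ultimately show ?case using su.subspace_add[OF U_sub x(2,3)] unfolding U by blast
    qed
    then show ?thesis by simp
  qed
  define A where "A u = (if u \<in> U then (SOME w. w \<in> W \<and> (\<forall>t\<in>S. \<tau> t w = T t u)) else 0)" for u
  have A: "A u \<in> W" "\<And>t. t \<in> S \<Longrightarrow> \<tau> t (A u) = T t u" if "u \<in> U" for u
    using someI_ex[of "\<lambda>w. w \<in> W \<and> (\<forall>t\<in>S. \<tau> t w = T t u)"] ex[OF that] that
    by (auto simp: A_def)
  have "A \<in> lin_maps su U sw W"
  proof (rule lin_mapsI)
    show "A (x + y) = A x + A y" if "x \<in> U" "y \<in> U" for x y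
      using that su.subspace_add[OF U_sub]
      by (intro unique) (simp add: A(2) \<tau>_add lin_maps_add[OF T(1)])
    show "A (su c x) = sw c (A x)" if "x \<in> U" for c x
      using that su.subspace_scale[OF U_sub]
      by (intro unique) (simp add: A(2) \<tau>_scale lin_maps_scale[OF T(1)])
  qed (use A(1) A_def in auto)
  moreover have "A (g i) = \<phi> i" for i
  proof (rule unique)
    have "g i \<in> U" unfolding U by (auto intro: su.span_base)
    then show "\<tau> t (A (g i)) = \<tau> t (\<phi> i)" if "t \<in> S" for t
      using that by (simp add: A(2) T(2))
  qed
  ultimately show ?thesis by blast
qed

section \<open>Polarization\<close>

text \<open>
  Ryser's formula for the permanent. Expanding the products on the right gives one term for each
  map from the slots to \<open>S\<close>; by inclusion and exclusion over \<open>S\<close> only the surjective maps,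
  that is, the permutations, survive.
\<close>

lemma permanent_inclusion_exclusion:
  fixes a :: "nat \<Rightarrow> nat \<Rightarrow> 'a::comm_ring_1"
  shows "(\<Sum>\<pi> | \<pi> permutes {..<n}. \<Prod>i<n. a i (\<pi> i)) =
    (\<Sum>S\<in>Pow {..<n}. (-1) ^ (n - card S) * (\<Prod>i<n. \<Sum>j\<in>S. a i j))"
proof -
  let ?N = "{..<n}"
  let ?G = "?N \<rightarrow>\<^sub>E ?N"
  \<comment> \<open>inclusion and exclusion: expand the product over all \<open>x\<close> of \<open>1 - [x \<notin> range g]\<close>\<close>
  have sieve: "(\<Sum>S\<in>Pow ?N. (-1) ^ (n - card S) * (if g ` ?N \<subseteq> S then 1 else 0)) =
      (if ?N \<subseteq> g ` ?N then 1 else 0 :: 'a)" if g: "g \<in> ?G" for g :: "nat \<Rightarrow> nat"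
  proof -
    have delta: "(\<Prod>x\<in>X. if P x then 1 else 0 :: 'a) = (if \<forall>x\<in>X. P x then 1 else 0)"
      if "finite X" for X :: "nat set" and P
      using that by (induction X) auto
    have "(\<Prod>x<n. 1 - (if x \<in> g ` ?N then 0 else 1 :: 'a)) =
       (\<Sum>S\<in>Pow ?N. (-1) ^ (n - card S) * (\<Prod>x\<in>?N - S. if x \<notin> g ` ?N then 1 else 0))"
      by (subst prod_diff_conv_sum') (auto intro!: sum.cong arg_cong2[of _ _ _ _ "(*)"] prod.cong)
    also have "\<dots> = (\<Sum>S\<in>Pow ?N. (-1) ^ (n - card S) * (if g ` ?N \<subseteq> S then 1 else 0))"
      using g by (intro sum.cong refl arg_cong2[of _ _ _ _ "(*)"], subst delta) (auto simp: PiE_iff)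
    also have "(\<Prod>x<n. 1 - (if x \<in> g ` ?N then 0 else 1 :: 'a)) =
        (\<Prod>x<n. if x \<in> g ` ?N then 1 else 0)"
      by (intro prod.cong) auto
    also have "\<dots> = (if ?N \<subseteq> g ` ?N then 1 else 0)"
      by (subst delta) auto
    finally show ?thesis by simp
  qed
  have "(\<Sum>S\<in>Pow ?N. (-1) ^ (n - card S) * (\<Prod>i<n. \<Sum>j\<in>S. a i j)) =
      (\<Sum>S\<in>Pow ?N. (-1) ^ (n - card S) * (\<Sum>g\<in>?G. (if g ` ?N \<subseteq> S then 1 else 0) * (\<Prod>i<n. a i (g i))))"
  proof (intro sum.cong refl arg_cong2[of _ _ _ _ "(*)"])
    fix S assume S: "S \<in> Pow ?N"
    then have "finite S" using finite_subset by auto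
    then have "(\<Prod>i<n. \<Sum>j\<in>S. a i j) = (\<Sum>g\<in>?N \<rightarrow>\<^sub>E S. \<Prod>i<n. a i (g i))"
      by (intro prod_sum_PiE) auto
    also have "\<dots> = (\<Sum>g\<in>?G. (if g ` ?N \<subseteq> S then 1 else 0) * (\<Prod>i<n. a i (g i)))"
      using S by (intro sum.mono_neutral_cong_left) (auto simp: finite_PiE PiE_iff)
    finally show "(\<Prod>i<n. \<Sum>j\<in>S. a i j) = \<dots>" .
  qed
  also have "\<dots> = (\<Sum>g\<in>?G. (\<Sum>S\<in>Pow ?N. (-1) ^ (n - card S) * (if g ` ?N \<subseteq> S then 1 else 0)) *
      (\<Prod>i<n. a i (g i)))"
    unfolding sum_distrib_left sum_distrib_right by (subst sum.swap) (simp add: mult.assoc)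
  also have "\<dots> = (\<Sum>g\<in>?G. if ?N \<subseteq> g ` ?N then \<Prod>i<n. a i (g i) else 0)"
    by (intro sum.cong refl) (simp only: sieve if_distrib[of "\<lambda>x. x * _"] mult_1 mult_zero_left)
  also have "\<dots> = (\<Sum>g\<in>{g \<in> ?G. ?N \<subseteq> g ` ?N}. \<Prod>i<n. a i (g i))"
    by (subst sum.inter_filter[symmetric]) (auto simp: finite_PiE)
  also have "\<dots> = (\<Sum>\<pi> | \<pi> permutes ?N. \<Prod>i<n. a i (\<pi> i))"
  proof (rule sum.reindex_bij_witness[of _ "\<lambda>\<pi>. restrict \<pi> ?N" "\<lambda>g i. if i < n then g i else i"])
    fix g assume g: "g \<in> {g \<in> ?G. ?N \<subseteq> g ` ?N}"
    then have img: "g ` ?N = ?N" by (auto simp: PiE_iff)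
    then have "inj_on g ?N" by (intro eq_card_imp_inj_on) auto
    with img have "bij_betw g ?N ?N" by (simp add: bij_betw_def)
    then have "bij_betw (\<lambda>i. if i < n then g i else i) ?N ?N"
      by (subst bij_betw_cong[where g = g]) auto
    then show "(\<lambda>i. if i < n then g i else i) \<in> {\<pi>. \<pi> permutes ?N}"
      by (auto intro!: bij_imp_permutes split: if_splits)
    show "restrict (\<lambda>i. if i < n then g i else i) ?N = g"
      using g by (auto simp: fun_eq_iff PiE_iff extensional_def)
  next
    fix \<pi> assume "\<pi> \<in> {\<pi>. \<pi> permutes ?N}"
    then have \<pi>: "\<pi> permutes ?N" by simp
    show "(\<lambda>i. if i < n then restrict \<pi> ?N i else i) = \<pi>"
      using permutes_not_in[OF \<pi>] by (auto simp: fun_eq_iff)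
    show "restrict \<pi> ?N \<in> {g \<in> ?G. ?N \<subseteq> g ` ?N}"
      using permutes_in_image[OF \<pi>] permutes_image[OF \<pi>] by auto
  qed auto
  finally show ?thesis by simp
qed

section \<open>Binomial coefficients and formal power series in one variable\<close>

lemma prod_diff_eq_choose: "(\<Prod>i<k. n - i) = fact k * (n choose k)"
proof (induction k)
  case (Suc k)
  have "(n - k) * (n choose k) = Suc k * (n choose Suc k)"
    by (simp only: binomial_absorb_comp binomial_absorption)
  with Suc show ?case by (simp add: algebra_simps)
qed simp

lemma fps_divided_power_recurrence:
  fixes a :: "nat \<Rightarrow> 'k::field_char_0 fps"
  assumes "a 0 = 1" "\<And>k. of_nat (Suc k) * a (Suc k) = b * a k"
  shows "fact k * a k = b ^ k"
proof (induction k)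
  case (Suc k)
  have "fact (Suc k) * a (Suc k) = fact k * (of_nat (Suc k) * a (Suc k))"
    by (simp only: fact_Suc of_nat_mult mult_ac)
  also have "\<dots> = b * (fact k * a k)"
    by (simp only: assms(2) mult.left_commute)
  finally show ?case by (simp only: Suc power_Suc)
qed (simp add: assms)

text \<open>
  The product of \<open>exp (b + c)\<close>, \<open>exp (- b)\<close> and \<open>exp (- c)\<close> has derivative zero, hence is 1.
\<close>

lemma fps_exp_compose_add:
  fixes b c :: "'k::field_char_0 fps"
  assumes "fps_nth b 0 = 0" "fps_nth c 0 = 0"
  shows "fps_compose (fps_exp 1) (b + c) = fps_compose (fps_exp 1) b * fps_compose (fps_exp 1) c"
proof -
  define E where "E x = fps_compose (fps_exp 1) (x :: 'k fps)" for x
  have D: "fps_deriv (E x) = E x * fps_deriv x" if "fps_nth x 0 = 0" for x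
    using fps_compose_deriv[OF that, of "fps_exp 1"] by (simp add: E_def)
  have E0: "fps_nth (E x) 0 = 1" for x by (simp add: E_def)
  have const: "x = 1" if "fps_deriv x = 0" "fps_nth x 0 = 1" for x :: "'k fps"
    using that by (simp add: fps_deriv_eq_0_iff)
  have neg: "E x * E (- x) = 1" if "fps_nth x 0 = 0" for x
    by (rule const) (simp_all add: D that E0)
  have "E (b + c) * (E (- b) * E (- c)) = 1"
    by (rule const) (simp_all add: D assms E0 algebra_simps)
  then have "E (b + c) = E (b + c) * (E b * E (- b)) * (E c * E (- c))"
    using neg assms by simp
  also have "\<dots> = E (b + c) * (E (- b) * E (- c)) * (E b * E c)"
    by (simp only: mult_ac)
  also have "\<dots> = E b * E c" using \<open>E (b + c) * _ = 1\<close> by simp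
  finally show ?thesis by (simp add: E_def)
qed

section \<open>Symmetric tensors\<close>

lemma sum_fun_apply [simp]: "(\<Sum>i\<in>I. f i) x = (\<Sum>i\<in>I. f i x)"
  by (induction I rule: infinite_finite_induct) auto

locale scalar_space = vector_space s
  for s :: "'k::real_normed_field \<Rightarrow> 'v::ab_group_add \<Rightarrow> 'v"
begin

lemma dual_iff:
  "\<omega> \<in> dual_space s \<longleftrightarrow> (\<forall>x y. \<omega> (x + y) = \<omega> x + \<omega> y) \<and> (\<forall>c x. \<omega> (s c x) = c * \<omega> x)"
proof -
  interpret k: vector_space "(*) :: 'k \<Rightarrow> 'k \<Rightarrow> 'k" by (rule vector_space_times)
  show ?thesis
    unfolding dual_space_def mem_Collect_eq
    by (auto simp: Vector_Spaces.linear_iff vector_space_axioms vector_space_times)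
qed

lemma dual_add: "\<omega> \<in> dual_space s \<Longrightarrow> \<omega> (x + y) = \<omega> x + \<omega> y"
  and dual_scale: "\<omega> \<in> dual_space s \<Longrightarrow> \<omega> (s c x) = c * \<omega> x"
  by (auto simp: dual_iff)

lemma dual_0: "\<omega> \<in> dual_space s \<Longrightarrow> \<omega> 0 = 0"
  using dual_add[of \<omega> 0 0] by simp

lemma dual_diff: "\<omega> \<in> dual_space s \<Longrightarrow> \<omega> (x - y) = \<omega> x - \<omega> y"
  using dual_add[of \<omega> "x - y" y] by simp

lemma dual_sum: "\<omega> \<in> dual_space s \<Longrightarrow> \<omega> (\<Sum>i\<in>I. f i) = (\<Sum>i\<in>I. \<omega> (f i))"
  by (induction I rule: infinite_finite_induct) (auto simp: dual_add dual_0)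

lemma zero_in_dual [simp]: "0 \<in> dual_space s"
  and plus_in_dual [simp]: "\<omega> \<in> dual_space s \<Longrightarrow> \<theta> \<in> dual_space s \<Longrightarrow> \<omega> + \<theta> \<in> dual_space s"
  and pscale_in_dual [simp]: "\<omega> \<in> dual_space s \<Longrightarrow> pscale (*) c \<omega> \<in> dual_space s"
  by (auto simp: dual_iff algebra_simps)

text \<open>
  A nonzero vector is independent, so some functional takes the value 1 on it.
\<close>

lemma dual_separates:
  assumes "\<And>\<omega>. \<omega> \<in> dual_space s \<Longrightarrow> \<omega> v = 0"
  shows "v = 0"
proof (rule ccontr)
  assume "v \<noteq> 0"
  interpret k: vector_space "(*) :: 'k \<Rightarrow> 'k \<Rightarrow> 'k" by (rule vector_space_times)
  interpret p: vector_space_pair s "(*) :: 'k \<Rightarrow> 'k \<Rightarrow> 'k" ..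
  have "independent {v}" using \<open>v \<noteq> 0\<close> by simp
  from p.linear_independent_extend[OF this, of "\<lambda>_. 1"]
  obtain \<omega> where "Vector_Spaces.linear s (*) \<omega>" "\<omega> v = 1" by auto
  with assms[of \<omega>] show False by (simp add: dual_space_def)
qed

lemma dual_eqI: "(\<And>\<omega>. \<omega> \<in> dual_space s \<Longrightarrow> \<omega> v = \<omega> w) \<Longrightarrow> v = w"
  using dual_separates[of "v - w"] by (simp add: dual_diff)

lemma prod_list_nth: "(\<Prod>i<length xs. xs ! i) = prod_list (xs :: 'k list)"
  by (induction xs) (auto simp: prod.lessThan_Suc_shift simp del: prod.lessThan_Suc)

lemma tpow_apply:
  "tpow s v n \<eta>s =
    (if length \<eta>s = n \<and> set \<eta>s \<subseteq> dual_space s then prod_list (map (\<lambda>\<eta>. \<eta> v) \<eta>s) else 0)"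
proof (cases "length \<eta>s = n")
  case True
  have "(\<Prod>i<n. (\<eta>s ! i) (replicate n v ! i)) = (\<Prod>i<n. map (\<lambda>\<eta>. \<eta> v) \<eta>s ! i)"
    using True by (intro prod.cong) auto
  also have "\<dots> = prod_list (map (\<lambda>\<eta>. \<eta> v) \<eta>s)"
    using True prod_list_nth[of "map (\<lambda>\<eta>. \<eta> v) \<eta>s"] by simp
  finally show ?thesis using True by (auto simp: tpow_def tensor_def)
qed (auto simp: tpow_def tensor_def)

lemma tpow_apply_replicate: "\<omega> \<in> dual_space s \<Longrightarrow> tpow s v n (replicate n \<omega>) = \<omega> v ^ n"
proof -
  assume "\<omega> \<in> dual_space s"
  then have "set (replicate n \<omega>) \<subseteq> dual_space s" by auto
  then show ?thesis by (simp add: tpow_apply)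
qed

lemma sym_tensor_replicate: "sym_tensor s (replicate n v) = tpow s v n"
proof -
  have "permute_list \<pi> (replicate n v) = replicate n v" if "\<pi> permutes {..<n}" for \<pi>
    using that permutes_in_image[OF that]
    by (intro nth_equalityI) (auto simp: permute_list_nth)
  then have "(\<Sum>\<pi> | \<pi> permutes {..<n}. tensor s (permute_list \<pi> (replicate n v)) \<eta>s) =
      (\<Sum>\<pi> | \<pi> permutes {..<n}. tpow s v n \<eta>s)" for \<eta>s
    by (intro sum.cong) (auto simp: tpow_def)
  then show ?thesis
    by (simp add: sym_tensor_def fun_eq_iff card_permutations[of "{..<n}" n])
qed

text \<open>
  Evaluated on functionals, a symmetric tensor is a permanent up to the factor \<open>n!\<close>; the formula for the
  permanent then expresses it by tensor powers of partial sums of the vectors.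
\<close>

lemma sym_tensor_polarization:
  fixes vs :: "'v list"
  defines "n \<equiv> length vs"
  shows "sym_tensor s vs =
    (\<Sum>S\<in>Pow {..<n}. pscale (*) ((-1) ^ (n - card S) / fact n) (tpow s (\<Sum>j\<in>S. vs ! j) n))"
proof (rule ext)
  fix \<eta>s :: "('v \<Rightarrow> 'k) list"
  show "sym_tensor s vs \<eta>s =
    (\<Sum>S\<in>Pow {..<n}. pscale (*) ((-1) ^ (n - card S) / fact n) (tpow s (\<Sum>j\<in>S. vs ! j) n)) \<eta>s"
  proof (cases "length \<eta>s = n \<and> set \<eta>s \<subseteq> dual_space s")
    case False
    then have "tensor s (permute_list \<pi> vs) \<eta>s = 0" for \<pi>
      unfolding tensor_def n_def by (simp only: length_permute_list) auto
    moreover have "tpow s v n \<eta>s = 0" for v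
      using False by (simp only: tpow_apply if_False)
    ultimately show ?thesis by (simp add: sym_tensor_def)
  next
    case True
    have "sym_tensor s vs \<eta>s = 1 / fact n * (\<Sum>\<pi> | \<pi> permutes {..<n}. \<Prod>i<n. (\<eta>s ! i) (vs ! \<pi> i))"
      using True by (auto simp: sym_tensor_def tensor_def n_def permute_list_nth
          intro!: sum.cong prod.cong)
    also have "\<dots> = 1 / fact n *
        (\<Sum>S\<in>Pow {..<n}. (-1) ^ (n - card S) * (\<Prod>i<n. \<Sum>j\<in>S. (\<eta>s ! i) (vs ! j)))"
      by (subst permanent_inclusion_exclusion) simp
    also have "\<dots> = (\<Sum>S\<in>Pow {..<n}. (-1) ^ (n - card S) / fact n * tpow s (\<Sum>j\<in>S. vs ! j) n \<eta>s)"
      unfolding sum_distrib_left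
    proof (intro sum.cong refl)
      fix S assume "S \<in> Pow {..<n}"
      have "tpow s (\<Sum>j\<in>S. vs ! j) n \<eta>s = (\<Prod>i<n. (\<eta>s ! i) (\<Sum>j\<in>S. vs ! j))"
        using True by (simp add: tpow_def tensor_def)
      also have "\<dots> = (\<Prod>i<n. \<Sum>j\<in>S. (\<eta>s ! i) (vs ! j))"
        using True by (intro prod.cong refl dual_sum) auto
      finally show "1 / fact n * ((-1) ^ (n - card S) * (\<Prod>i<n. \<Sum>j\<in>S. (\<eta>s ! i) (vs ! j))) =
         (-1) ^ (n - card S) / fact n * tpow s (\<Sum>j\<in>S. vs ! j) n \<eta>s"
        by simp
    qed
    finally show ?thesis by simp
  qed
qed

lemma sym_power_eq_span: "sym_power s n = form.span (range (\<lambda>v. tpow s v n))"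
proof
  have "sym_tensor s vs \<in> form.span (range (\<lambda>v. tpow s v n))" if "length vs = n" for vs
    unfolding sym_tensor_polarization that
    by (intro form.span_sum form.span_scale form.span_base) auto
  then show "sym_power s n \<subseteq> form.span (range (\<lambda>v. tpow s v n))"
    unfolding sym_power_def by (intro form.span_minimal) auto
  have "tpow s v n \<in> {sym_tensor s vs | vs. length vs = n}" for v
    using sym_tensor_replicate[of n v, symmetric] by (auto intro!: exI[of _ "replicate n v"])
  then show "form.span (range (\<lambda>v. tpow s v n)) \<subseteq> sym_power s n"
    unfolding sym_power_def by (intro form.span_mono) auto
qed

lemma subspace_sym_power [simp]: "form.subspace (sym_power s n)"
  by (simp add: sym_power_def)

lemma tpow_in_sym_power [simp]: "tpow s v n \<in> sym_power s n"
  unfolding sym_power_eq_span by (intro form.span_base) auto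

lemma sym_tensor_in_sym_power: "length vs = n \<Longrightarrow> sym_tensor s vs \<in> sym_power s n"
  unfolding sym_power_def by (intro form.span_base) auto

lemma sym_power_induct [consumes 1, case_names zero step]:
  assumes "f \<in> sym_power s n" "Q 0"
    and "\<And>c v f. f \<in> sym_power s n \<Longrightarrow> Q f \<Longrightarrow> Q (pscale (*) c (tpow s v n) + f)"
  shows "Q f"
proof -
  have "f \<in> sym_power s n \<and> Q f"
    using assms(1) unfolding sym_power_eq_span
  proof (induction rule: form.span_induct_alt)
    case base
    show ?case by (intro conjI assms(2) form.span_zero)
  next
    case (step c x y)
    then obtain v where v: "x = tpow s v n" by blast
    from step have y: "y \<in> sym_power s n" "Q y" unfolding sym_power_eq_span by blast+
    show ?case
      unfolding sym_power_eq_span[symmetric] v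
      by (intro conjI form.subspace_add[OF subspace_sym_power]
          form.subspace_scale[OF subspace_sym_power] assms(3) y tpow_in_sym_power)
  qed
  then show ?thesis by simp
qed

lemma sym_power_outside:
  assumes "f \<in> sym_power s n" "\<not> (length \<eta>s = n \<and> set \<eta>s \<subseteq> dual_space s)"
  shows "f \<eta>s = 0"
  using assms by (induction rule: sym_power_induct) (auto simp: tpow_apply)

lemma sym_power_maps_eqI:
  assumes "S \<in> lin_maps (pscale (*)) (sym_power s n) sw W"
    "T \<in> lin_maps (pscale (*)) (sym_power s n) sw W'"
    and "\<And>v. S (tpow s v n) = T (tpow s v n)"
  shows "S = T"
  using lin_maps_eqI_span[OF assms(1,2) form.vector_space_axioms sym_power_eq_span] assms(3) by simp


section \<open>Polynomials on the dual space\<close>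

lemma homog_in_dual: "\<omega> \<in> dual_space s \<Longrightarrow> homog s n f \<omega> = f (replicate n \<omega>)"
  and homog_outside: "\<omega> \<notin> dual_space s \<Longrightarrow> homog s n f \<omega> = 0"
  by (auto simp: homog_def dual_tpow_def)

lemma homog_zero [simp]: "homog s n 0 = 0"
  and homog_add: "homog s n (f + g) = homog s n f + homog s n g"
  and homog_scale: "homog s n (pscale (*) c f) = pscale (*) c (homog s n f)"
  by (auto simp: fun_eq_iff homog_def dual_tpow_def)

lemma pow_poly_apply:
  "homog s n (tpow s v n) \<omega> = (if \<omega> \<in> dual_space s then \<omega> v ^ n else 0)"
  by (simp add: homog_def dual_tpow_def tpow_apply_replicate)

lemma polysI: "(\<And>k. k \<le> n \<Longrightarrow> f k \<in> sym_power s k) \<Longrightarrow> (\<Sum>k\<le>n. homog s k (f k)) \<in> polys s"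
  by (auto simp: polys_def)

lemma polysE:
  assumes "p \<in> polys s"
  obtains n f where "p = (\<Sum>k\<le>n. homog s k (f k))" "\<And>k. f k \<in> sym_power s k" "\<And>k. k > n \<Longrightarrow> f k = 0"
proof -
  from assms obtain n f where f: "p = (\<Sum>k\<le>n. homog s k (f k))" "\<forall>k\<le>n. f k \<in> sym_power s k"
    by (auto simp: polys_def)
  show ?thesis
    by (rule that[of "\<lambda>k. if k \<le> n then f k else 0" n])
      (use f form.subspace_0[OF subspace_sym_power] in auto)
qed

lemma sum_homog_extend:
  assumes "\<And>k. k > n \<Longrightarrow> f k = 0" "n \<le> m"
  shows "(\<Sum>k\<le>n. homog s k (f k)) = (\<Sum>k\<le>m. homog s k (f k))"
  using assms by (intro sum.mono_neutral_left) auto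

lemma subspace_polys [simp]: "form.subspace (polys s)"
proof (rule form.subspaceI)
  show "0 \<in> polys s"
    using polysI[of 0 "\<lambda>_. 0"] form.subspace_0[OF subspace_sym_power] by simp
next
  fix p q assume "p \<in> polys s" "q \<in> polys s"
  obtain n f where
    f: "p = (\<Sum>k\<le>n. homog s k (f k))" "\<And>k. f k \<in> sym_power s k" "\<And>k. k > n \<Longrightarrow> f k = 0"
    using polysE[OF \<open>p \<in> polys s\<close>] by blast
  obtain m g where
    g: "q = (\<Sum>k\<le>m. homog s k (g k))" "\<And>k. g k \<in> sym_power s k" "\<And>k. k > m \<Longrightarrow> g k = 0"
    using polysE[OF \<open>q \<in> polys s\<close>] by blast
  have "p + q = (\<Sum>k\<le>max n m. homog s k (f k + g k))"
    using sum_homog_extend[of n f "max n m"] sum_homog_extend[of m g "max n m"] f(1,3) g(1,3)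
    by (simp add: homog_add sum.distrib)
  then show "p + q \<in> polys s"
    using f(2) g(2) by (auto intro!: polysI form.subspace_add[OF subspace_sym_power])
next
  fix c p assume "p \<in> polys s"
  then obtain n f where f: "p = (\<Sum>k\<le>n. homog s k (f k))" "\<And>k. f k \<in> sym_power s k"
    using polysE by blast
  have "pscale (*) c p = (\<Sum>k\<le>n. homog s k (pscale (*) c (f k)))"
    unfolding homog_scale f(1) by (rule form.scale_sum_right)
  then show "pscale (*) c p \<in> polys s"
    using f(2) by (auto intro!: polysI form.subspace_scale[OF subspace_sym_power])
qed

lemma homog_in_polys [simp]:
  assumes "f \<in> sym_power s n"
  shows "homog s n f \<in> polys s"
proof -
  have "(\<Sum>k\<le>n. homog s k (if k = n then f else 0)) \<in> polys s"
    using assms form.subspace_0[OF subspace_sym_power] by (intro polysI) auto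
  also have "(\<Sum>k\<le>n. homog s k (if k = n then f else 0)) = homog s n f"
    by (simp add: if_distrib[of "homog s _"] cong: if_cong)
  finally show ?thesis .
qed

lemma polys_add [simp]: "p \<in> polys s \<Longrightarrow> q \<in> polys s \<Longrightarrow> p + q \<in> polys s"
  and polys_scale [simp]: "p \<in> polys s \<Longrightarrow> pscale (*) c p \<in> polys s"
  and polys_diff: "p \<in> polys s \<Longrightarrow> q \<in> polys s \<Longrightarrow> p - q \<in> polys s"
  and polys_zero [simp]: "0 \<in> polys s"
  using subspace_polys form.subspace_add form.subspace_scale form.subspace_diff form.subspace_0
  by blast+

lemma polys_sum [simp]: "(\<And>i. i \<in> I \<Longrightarrow> p i \<in> polys s) \<Longrightarrow> (\<Sum>i\<in>I. p i) \<in> polys s"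
  by (rule form.subspace_sum[OF subspace_polys])

lemma polys_eq_span: "polys s = form.span (range (\<lambda>(n, v). homog s n (tpow s v n)))"
proof
  let ?G = "range (\<lambda>(n, v). homog s n (tpow s v n))"
  have "homog s n f \<in> form.span ?G" if "f \<in> sym_power s n" for n f
    using that
  proof (induction rule: sym_power_induct)
    case (step c v f)
    have "homog s n (tpow s v n) \<in> ?G" by (rule image_eqI[of _ _ "(n, v)"]) auto
    from form.span_add[OF form.span_scale[OF form.span_base[OF this]] step(2)] show ?case
      unfolding homog_add homog_scale .
  next
    case zero
    show ?case unfolding homog_zero by (rule form.span_zero)
  qed
  then show "polys s \<subseteq> form.span ?G"
    by (auto elim!: polysE intro!: form.span_sum)
  show "form.span ?G \<subseteq> polys s"
    by (rule form.span_minimal) auto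
qed

lemma polys_induct [consumes 1, case_names zero step]:
  assumes "p \<in> polys s" "Q 0"
    and "\<And>c n v p. p \<in> polys s \<Longrightarrow> Q p \<Longrightarrow> Q (pscale (*) c (homog s n (tpow s v n)) + p)"
  shows "Q p"
proof -
  have "p \<in> polys s \<and> Q p"
    using assms(1) unfolding polys_eq_span
  proof (induction rule: form.span_induct_alt)
    case base
    show ?case by (intro conjI assms(2) form.span_zero)
  next
    case (step c x y)
    then obtain n v where v: "x = homog s n (tpow s v n)" by auto
    from step have y: "y \<in> polys s" "Q y" unfolding polys_eq_span by blast+
    show ?case
      unfolding polys_eq_span[symmetric] v
      by (intro conjI polys_add polys_scale homog_in_polys assms(3) y tpow_in_sym_power)
  qed
  then show ?thesis by simp
qed

lemma polys_outside: "p \<in> polys s \<Longrightarrow> \<omega> \<notin> dual_space s \<Longrightarrow> p \<omega> = 0"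
  by (induction rule: polys_induct) (auto simp: homog_outside)

lemma poly_maps_eqI:
  assumes "S \<in> lin_maps (pscale (*)) (polys s) sw W"
    "T \<in> lin_maps (pscale (*)) (polys s) sw W'"
    and "\<And>n v. S (homog s n (tpow s v n)) = T (homog s n (tpow s v n))"
  shows "S = T"
  using lin_maps_eqI_span[OF assms(1,2) form.vector_space_axioms polys_eq_span] assms(3)
  by (simp add: case_prod_beta)

lemma zero_lin_map: "(\<lambda>_. 0 :: 'k) \<in> lin_maps su U (*) UNIV"
  by (auto simp: lin_maps_def)

section \<open>Derivatives\<close>

text \<open>
  The directional derivative, made zero off the polynomials so that it is one of the linear maps above.
\<close>

definition poly_deriv where
  "poly_deriv \<theta> p = (if p \<in> polys s then dir_deriv s \<theta> p else 0)"

text \<open>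
  A polynomial derivative \<open>q\<close> is found on the generators and carried along by linearity.
\<close>

lemma poly_has_derivative:
  assumes "p \<in> polys s" "\<theta> \<in> dual_space s"
  shows "\<exists>q\<in>polys s. \<forall>\<omega>\<in>dual_space s.
    ((\<lambda>t. p (\<omega> + pscale (*) t \<theta>)) has_field_derivative q \<omega>) (at 0)"
  using assms(1)
proof (induction rule: polys_induct)
  case zero
  show ?case by (intro bexI[of _ 0]) auto
next
  case (step c n v p)
  from step(2) obtain q where q: "q \<in> polys s" "\<And>\<omega>. \<omega> \<in> dual_space s \<Longrightarrow>
      ((\<lambda>t. p (\<omega> + pscale (*) t \<theta>)) has_field_derivative q \<omega>) (at 0)" by blast
  show ?case
  proof (intro bexI ballI)
    fix \<omega> assume \<omega>: "\<omega> \<in> dual_space s"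
    have "((\<lambda>t. c * (\<omega> v + t * \<theta> v) ^ n + p (\<omega> + pscale (*) t \<theta>)) has_field_derivative
        (c * (of_nat n * \<theta> v) * \<omega> v ^ (n - 1) + q \<omega>)) (at 0)"
      by (rule derivative_eq_intros q(2)[OF \<omega>] refl | simp)+
    then show "((\<lambda>t. (pscale (*) c (homog s n (tpow s v n)) + p) (\<omega> + pscale (*) t \<theta>))
        has_field_derivative (pscale (*) (c * (of_nat n * \<theta> v)) (homog s (n - 1) (tpow s v (n - 1))) + q) \<omega>) (at 0)"
      using \<omega> assms(2) by (simp add: pow_poly_apply)
  qed (intro polys_add polys_scale homog_in_polys tpow_in_sym_power q)
qed

lemma dir_deriv_eqI:
  assumes "q \<in> polys s" "\<And>\<omega>. \<omega> \<in> dual_space s \<Longrightarrow>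
    ((\<lambda>t. p (\<omega> + pscale (*) t \<theta>)) has_field_derivative q \<omega>) (at 0)"
  shows "dir_deriv s \<theta> p = q"
  using assms DERIV_imp_deriv polys_outside[OF assms(1)]
  by (auto simp: dir_deriv_def fun_eq_iff)

lemma poly_deriv_lin:
  assumes \<theta>: "\<theta> \<in> dual_space s"
  shows "poly_deriv \<theta> \<in> lin_maps (pscale (*)) (polys s) (pscale (*)) (polys s)"
proof -
  obtain d where d: "\<And>p. p \<in> polys s \<Longrightarrow> d p \<in> polys s"
    "\<And>p \<omega>. p \<in> polys s \<Longrightarrow> \<omega> \<in> dual_space s \<Longrightarrow>
      ((\<lambda>t. p (\<omega> + pscale (*) t \<theta>)) has_field_derivative d p \<omega>) (at 0)"
    using poly_has_derivative[OF _ \<theta>] by metis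
  have dd: "dir_deriv s \<theta> p = d p" if "p \<in> polys s" for p
    using that d by (intro dir_deriv_eqI) auto
  show ?thesis
  proof (rule lin_mapsI)
    fix p q assume pq: "p \<in> polys s" "q \<in> polys s"
    have "dir_deriv s \<theta> (p + q) = d p + d q"
      using pq d by (intro dir_deriv_eqI) (auto intro!: derivative_intros)
    then show "poly_deriv \<theta> (p + q) = poly_deriv \<theta> p + poly_deriv \<theta> q"
      using pq dd by (simp add: poly_deriv_def)
  next
    fix c p assume p: "p \<in> polys s"
    have "dir_deriv s \<theta> (pscale (*) c p) = pscale (*) c (d p)"
      using p d by (intro dir_deriv_eqI) (auto intro!: DERIV_cmult)
    then show "poly_deriv \<theta> (pscale (*) c p) = pscale (*) c (poly_deriv \<theta> p)"
      using p dd by (simp add: poly_deriv_def)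
  qed (auto simp: poly_deriv_def dd d)
qed

lemma poly_deriv_pow:
  assumes \<theta>: "\<theta> \<in> dual_space s"
  shows "poly_deriv \<theta> (homog s n (tpow s v n)) =
    pscale (*) (of_nat n * \<theta> v) (homog s (n - 1) (tpow s v (n - 1)))"
proof -
  have "dir_deriv s \<theta> (homog s n (tpow s v n)) =
    pscale (*) (of_nat n * \<theta> v) (homog s (n - 1) (tpow s v (n - 1)))"
  proof (rule dir_deriv_eqI)
    fix \<omega> assume \<omega>: "\<omega> \<in> dual_space s"
    have "((\<lambda>t. (\<omega> v + t * \<theta> v) ^ n) has_field_derivative
        ((of_nat n * \<theta> v) * \<omega> v ^ (n - 1))) (at 0)"
      by (rule derivative_eq_intros refl | simp)+
    then show "((\<lambda>t. homog s n (tpow s v n) (\<omega> + pscale (*) t \<theta>))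
        has_field_derivative pscale (*) (of_nat n * \<theta> v) (homog s (n - 1) (tpow s v (n - 1))) \<omega>) (at 0)"
      using \<omega> assms by (simp add: pow_poly_apply)
  qed simp
  then show ?thesis by (simp add: poly_deriv_def)
qed

primrec mderiv where
  "mderiv [] p = (if p \<in> polys s then p else 0)"
| "mderiv (\<eta> # \<eta>s) p = poly_deriv \<eta> (mderiv \<eta>s p)"

lemma mderiv_lin:
  "set \<eta>s \<subseteq> dual_space s \<Longrightarrow> mderiv \<eta>s \<in> lin_maps (pscale (*)) (polys s) (pscale (*)) (polys s)"
proof (induction \<eta>s)
  case Nil
  have "mderiv [] \<in> lin_maps (pscale (*)) (polys s) (pscale (*)) (polys s)"
    by (intro lin_mapsI) simp_all
  then show ?case .
next
  case (Cons \<eta> \<eta>s)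
  from Cons.prems have "\<eta> \<in> dual_space s" "set \<eta>s \<subseteq> dual_space s" by simp_all
  then have "(\<lambda>p. poly_deriv \<eta> (mderiv \<eta>s p)) \<in> lin_maps (pscale (*)) (polys s) (pscale (*)) (polys s)"
    by (intro lin_maps_comp[OF poly_deriv_lin] Cons.IH)
  also have "(\<lambda>p. poly_deriv \<eta> (mderiv \<eta>s p)) = mderiv (\<eta> # \<eta>s)" by (simp add: fun_eq_iff)
  finally show ?case .
qed

lemma mderiv_pow:
  "set \<eta>s \<subseteq> dual_space s \<Longrightarrow> mderiv \<eta>s (homog s n (tpow s v n)) =
    pscale (*) (of_nat (\<Prod>i<length \<eta>s. n - i) * prod_list (map (\<lambda>\<eta>. \<eta> v) \<eta>s))
      (homog s (n - length \<eta>s) (tpow s v (n - length \<eta>s)))"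
proof (induction \<eta>s)
  case (Cons \<eta> \<eta>s)
  then have \<eta>: "\<eta> \<in> dual_space s" "set \<eta>s \<subseteq> dual_space s" by simp_all
  show ?case
    unfolding mderiv.simps Cons.IH[OF \<eta>(2)]
    by (subst lin_maps_scale[OF poly_deriv_lin[OF \<eta>(1)]])
      (simp_all add: poly_deriv_pow[OF \<eta>(1)] fun_eq_iff)
qed (simp add: fun_eq_iff)

lemma subspace_vec_polys:
  "vector_space sw \<Longrightarrow> module.subspace (pscale sw) (vec_polys s sw W)"
  unfolding vec_polys_def
  by (rule module.subspace_span) (simp add: vector_space_pscale module_iff_vector_space)

lemma vec_polys_base:
  assumes "vector_space sw" "p \<in> polys s" "w \<in> W"
  shows "(\<lambda>\<omega>. sw (p \<omega>) w) \<in> vec_polys s sw W"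
proof -
  interpret f: vector_space "pscale sw :: 'k \<Rightarrow> (('v \<Rightarrow> 'k) \<Rightarrow> _) \<Rightarrow> _"
    by (rule vector_space_pscale[OF assms(1)])
  show ?thesis
    unfolding vec_polys_def using assms by (intro f.span_base) auto
qed

lemma vec_polys_values:
  assumes sw: "vector_space sw" and W: "module.subspace sw W" and q: "q \<in> vec_polys s sw W"
  shows "q \<omega> \<in> W" "\<omega> \<notin> dual_space s \<Longrightarrow> q \<omega> = 0"
proof -
  interpret w: vector_space sw by fact
  interpret f: vector_space "pscale sw :: 'k \<Rightarrow> (('v \<Rightarrow> 'k) \<Rightarrow> _) \<Rightarrow> _"
    by (rule vector_space_pscale[OF sw])
  let ?S = "{q. \<forall>\<omega>. q \<omega> \<in> W \<and> (\<omega> \<notin> dual_space s \<longrightarrow> q \<omega> = 0)}"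
  have "f.subspace ?S"
    using w.subspace_0[OF W] w.subspace_add[OF W] w.subspace_scale[OF W]
    by (intro f.subspaceI) auto
  moreover have "{\<lambda>\<omega>. sw (p \<omega>) w | p w. p \<in> polys s \<and> w \<in> W} \<subseteq> ?S"
    using w.subspace_scale[OF W] by (auto simp: polys_outside)
  ultimately have "vec_polys s sw W \<subseteq> ?S"
    unfolding vec_polys_def by (intro f.span_minimal)
  with q show "q \<omega> \<in> W" "\<omega> \<notin> dual_space s \<Longrightarrow> q \<omega> = 0" by auto
qed

text \<open>
  The value of \<open>D\<^sup>k p\<close> at \<open>\<omega>\<close>, evaluated on functionals \<open>\<eta>\<^sub>1, \<dots>, \<eta>\<^sub>k\<close>, must be the iterated
  directional derivative of \<open>p\<close> along the \<open>\<eta>\<^sub>i\<close>. These evaluations are linear in \<open>p\<close> and separate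
  the tensors, so the extension principle applies.
\<close>

lemma Dpow_exists:
  "\<exists>D\<in>lin_maps (pscale (*)) (polys s) (pscale (pscale (*))) (vec_polys s (pscale (*)) (sym_power s k)).
     \<forall>n v \<omega>. D (homog s n (tpow s v n)) \<omega> =
       pscale (*) (of_nat (\<Prod>i<k. n - i) * homog s (n - k) (tpow s v (n - k)) \<omega>) (tpow s v k)"
proof -
  define \<phi> where "\<phi> = (\<lambda>(n, v) \<omega>. pscale (*)
    (of_nat (\<Prod>i<k. n - i) * homog s (n - k) (tpow s v (n - k)) \<omega>) (tpow s v k))"
  have "\<exists>D\<in>lin_maps (pscale (*)) (polys s) (pscale (pscale (*))) (vec_polys s (pscale (*)) (sym_power s k)).
     \<forall>i. D ((\<lambda>(n, v). homog s n (tpow s v n)) i) = \<phi> i"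
  proof (rule linear_extension[where \<tau> = "\<lambda>(\<omega>, \<eta>s) q. q \<omega> \<eta>s" and S = UNIV])
    show "\<phi> i \<in> vec_polys s (pscale (*)) (sym_power s k)" for i
    proof (cases i)
      case (Pair n v)
      have "(\<lambda>\<omega>. pscale (*) ((pscale (*) (of_nat (\<Prod>i<k. n - i)) (homog s (n - k) (tpow s v (n - k)))) \<omega>)
          (tpow s v k)) \<in> vec_polys s (pscale (*)) (sym_power s k)"
        by (intro vec_polys_base form.vector_space_axioms polys_scale homog_in_polys tpow_in_sym_power)
      then show ?thesis by (simp add: Pair \<phi>_def)
    qed
    fix t :: "('v \<Rightarrow> 'k) \<times> ('v \<Rightarrow> 'k) list"
    obtain \<omega> \<eta>s where t: "t = (\<omega>, \<eta>s)" by force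
    show "\<exists>T\<in>lin_maps (pscale (*)) (polys s) (*) UNIV.
        \<forall>i. T ((\<lambda>(n, v). homog s n (tpow s v n)) i) = (\<lambda>(\<omega>, \<eta>s) q. q \<omega> \<eta>s) t (\<phi> i)"
    proof (cases "length \<eta>s = k \<and> set \<eta>s \<subseteq> dual_space s")
      case True
      then show ?thesis
        by (intro bexI[OF _ lin_maps_eval[OF mderiv_lin, of \<eta>s \<omega>]])
          (auto simp: t \<phi>_def mderiv_pow tpow_apply)
    next
      case False
      then show ?thesis
        by (intro bexI[OF _ zero_lin_map]) (auto simp: t \<phi>_def tpow_apply)
    qed
  qed (auto simp: polys_eq_span form.vector_space_axioms vector_space_pscale subspace_vec_polys fun_eq_iff)
  then obtain D where D: "D \<in> lin_maps (pscale (*)) (polys s) (pscale (pscale (*)))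
      (vec_polys s (pscale (*)) (sym_power s k))"
    "\<And>i. D ((\<lambda>(n, v). homog s n (tpow s v n)) i) = \<phi> i" by blast
  show ?thesis
    by (intro bexI[OF _ D(1)] allI) (use D(2)[of "(_, _)"] in \<open>simp add: \<phi>_def\<close>)
qed

lemma Dpow_lin: "Dpow s k \<in> lin_maps (pscale (*)) (polys s) (pscale (pscale (*)))
      (vec_polys s (pscale (*)) (sym_power s k))" (is ?lin)
  and Dpow_pow: "Dpow s k (homog s n (tpow s v n)) \<omega> =
    pscale (*) (of_nat (\<Prod>i<k. n - i) * homog s (n - k) (tpow s v (n - k)) \<omega>) (tpow s v k)" (is ?pow)
proof -
  obtain D where lin: "D \<in> lin_maps (pscale (*)) (polys s) (pscale (pscale (*)))
      (vec_polys s (pscale (*)) (sym_power s k))" and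
    D: "\<And>n v \<omega>. D (homog s n (tpow s v n)) \<omega> =
       pscale (*) (of_nat (\<Prod>i<k. n - i) * homog s (n - k) (tpow s v (n - k)) \<omega>) (tpow s v k)"
    using Dpow_exists by blast
  have "Dpow s k = D"
    unfolding Dpow_def
  proof (rule the_equality)
    fix D'
    assume D': "D' \<in> lin_maps (pscale (*)) (polys s) (pscale (pscale (*)))
        (vec_polys s (pscale (*)) (sym_power s k)) \<and>
      (\<forall>n v. \<forall>\<omega>\<in>dual_space s. D' (homog s n (tpow s v n)) \<omega> =
        pscale (*) (of_nat (\<Prod>i<k. n - i) * \<omega> v ^ (n - k)) (tpow s v k))"
    then have lin': "D' \<in> lin_maps (pscale (*)) (polys s) (pscale (pscale (*)))
        (vec_polys s (pscale (*)) (sym_power s k))" by blast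
    show "D' = D"
    proof (rule poly_maps_eqI[OF lin' lin], rule ext)
      fix n v \<omega>
      show "D' (homog s n (tpow s v n)) \<omega> = D (homog s n (tpow s v n)) \<omega>"
      proof (cases "\<omega> \<in> dual_space s")
        case True
        then show ?thesis using D' D by (simp add: pow_poly_apply)
      next
        case False
        then show ?thesis
          using vec_polys_values(2)[OF form.vector_space_axioms subspace_sym_power lin_maps_in[OF lin]]
            vec_polys_values(2)[OF form.vector_space_axioms subspace_sym_power lin_maps_in[OF lin']]
          by simp
      qed
    qed
  qed (use lin D in \<open>auto simp: pow_poly_apply\<close>)
  with lin D show ?lin ?pow by auto
qed

lemma Dpow_in_sym_power [simp]: "Dpow s k p \<omega> \<in> sym_power s k"
proof (cases "p \<in> polys s")
  case True
  then show ?thesis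
    by (rule vec_polys_values[OF form.vector_space_axioms subspace_sym_power lin_maps_in[OF Dpow_lin]])
next
  case False
  then show ?thesis
    using form.subspace_0[OF subspace_sym_power] by (simp add: lin_maps_outside[OF Dpow_lin])
qed

lemma Dpow_outside: "\<omega> \<notin> dual_space s \<Longrightarrow> Dpow s k p \<omega> = 0"
  using vec_polys_values(2)[OF form.vector_space_axioms subspace_sym_power lin_maps_in[OF Dpow_lin]]
    lin_maps_outside[OF Dpow_lin, of p] by (cases "p \<in> polys s") auto

lemma Dpow_add: "p \<in> polys s \<Longrightarrow> q \<in> polys s \<Longrightarrow> Dpow s k (p + q) = Dpow s k p + Dpow s k q"
  and Dpow_scale: "p \<in> polys s \<Longrightarrow> Dpow s k (pscale (*) c p) = pscale (pscale (*)) c (Dpow s k p)"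
  using lin_maps_add[OF Dpow_lin] lin_maps_scale[OF Dpow_lin] by blast+

lemma Dpow_eq_mderiv:
  assumes "length \<eta>s = k" "set \<eta>s \<subseteq> dual_space s"
  shows "Dpow s k p \<omega> \<eta>s = mderiv \<eta>s p \<omega>"
proof -
  have "(\<lambda>p. Dpow s k p \<omega> \<eta>s) = (\<lambda>p. mderiv \<eta>s p \<omega>)"
    using assms
    by (intro poly_maps_eqI[OF lin_maps_eval[OF lin_maps_eval[OF Dpow_lin]] lin_maps_eval[OF mderiv_lin]])
      (auto simp: Dpow_pow mderiv_pow tpow_apply)
  then show ?thesis by (simp add: fun_eq_iff)
qed

lemma Dpow_finite:
  assumes "p \<in> polys s"
  obtains N where "\<And>k. k > N \<Longrightarrow> Dpow s k p = 0"
proof -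
  have "\<exists>N. \<forall>k>N. Dpow s k p = 0"
    using assms
  proof (induction rule: polys_induct)
    case zero
    have "\<forall>k>0. Dpow s k 0 = 0" by (simp add: lin_maps_zero[OF Dpow_lin])
    then show ?case by (rule exI)
  next
    case (step c n v p)
    then obtain N where N: "\<And>k. k > N \<Longrightarrow> Dpow s k p = 0" by blast
    have "Dpow s k (homog s n (tpow s v n)) = 0" if "k > n" for k
      using that by (auto simp: fun_eq_iff Dpow_pow prod_diff_eq_choose)
    then have "Dpow s k (pscale (*) c (homog s n (tpow s v n)) + p) = 0" if "k > max n N" for k
      using that N step(1) by (subst Dpow_add) (auto simp: Dpow_scale fun_eq_iff)
    then show ?case by blast
  qed
  then show ?thesis using that by blast
qed


section \<open>Homogeneous components\<close>

text \<open>
  The homogeneous component of degree \<open>k\<close>, obtained as a Taylor coefficient at the origin. Its linearity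
  is thereby inherited from \<open>D\<^sup>k\<close>.
\<close>

definition tcomp where
  "tcomp k p = pscale (*) (1 / fact k) (Dpow s k p 0)"

lemma tcomp_lin: "tcomp k \<in> lin_maps (pscale (*)) (polys s) (pscale (*)) (sym_power s k)"
proof (rule lin_mapsI)
  show "tcomp k p \<in> sym_power s k" for p
    unfolding tcomp_def by (intro form.subspace_scale[OF subspace_sym_power] Dpow_in_sym_power)
qed (auto simp: tcomp_def fun_eq_iff Dpow_add Dpow_scale lin_maps_outside[OF Dpow_lin] add_divide_distrib)

lemma tcomp_homog:
  assumes "f \<in> sym_power s n"
  shows "tcomp k (homog s n f) = (if n = k then f else 0)"
  using assms
proof (induction rule: sym_power_induct)
  case zero
  have "tcomp k (homog s n 0) = (if n = k then 0 else 0)" by (simp add: lin_maps_zero[OF tcomp_lin])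
  then show ?case .
next
  case (step c v f)
  have "tcomp k (homog s n (tpow s v n)) = (if n = k then tpow s v n else 0)"
    by (auto simp: tcomp_def Dpow_pow fun_eq_iff pow_poly_apply prod_diff_eq_choose)
  with step show ?case
    unfolding homog_add homog_scale
    by (subst lin_maps_add[OF tcomp_lin]) (auto simp: lin_maps_scale[OF tcomp_lin] fun_eq_iff)
qed

lemma tcomp_sum_homog:
  assumes "\<And>k. k \<le> n \<Longrightarrow> f k \<in> sym_power s k"
  shows "tcomp k (\<Sum>j\<le>n. homog s j (f j)) = (if k \<le> n then f k else 0)"
proof -
  have "tcomp k (\<Sum>j\<le>n. homog s j (f j)) = (\<Sum>j\<le>n. tcomp k (homog s j (f j)))"
    using assms by (intro lin_maps_sum[OF tcomp_lin form.vector_space_axioms subspace_polys]) auto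
  also have "\<dots> = (\<Sum>j\<le>n. if j = k then f j else 0)"
    using assms by (intro sum.cong refl tcomp_homog) auto
  finally show ?thesis by simp
qed

lemma poly_eq_sum_tcomp:
  assumes "p \<in> polys s"
  obtains n where "p = (\<Sum>k\<le>n. homog s k (tcomp k p))"
proof -
  from assms obtain n f where f: "p = (\<Sum>k\<le>n. homog s k (f k))" "\<And>k. f k \<in> sym_power s k"
    using polysE by blast
  have "(\<Sum>k\<le>n. homog s k (f k)) = (\<Sum>k\<le>n. homog s k (tcomp k p))"
    unfolding f(1) by (intro sum.cong) (auto simp: tcomp_sum_homog f)
  then show ?thesis by (rule that[OF trans[OF f(1)]])
qed

lemma homog_inject:
  "f \<in> sym_power s n \<Longrightarrow> g \<in> sym_power s n \<Longrightarrow> homog s n f = homog s n g \<Longrightarrow> f = g"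
  by (metis tcomp_homog)

text \<open>
  A symmetric tensor is determined by its values on the diagonal, because these values form its homogeneous
  polynomial.
\<close>

lemma sym_power_eqI:
  assumes "f \<in> sym_power s n" "g \<in> sym_power s n"
    and "\<And>\<omega>. \<omega> \<in> dual_space s \<Longrightarrow> f (replicate n \<omega>) = g (replicate n \<omega>)"
  shows "f = g"
proof (rule homog_inject[OF assms(1,2)], rule ext)
  show "homog s n f \<omega> = homog s n g \<omega>" for \<omega>
    using assms(3)[of \<omega>] by (cases "\<omega> \<in> dual_space s") (simp_all add: homog_in_dual homog_outside)
qed

lemma tcomp_diag:
  assumes "\<omega> \<in> dual_space s"
  shows "mderiv (replicate k \<omega>) p 0 = fact k * homog s k (tcomp k p) \<omega>"
proof -
  have "set (replicate k \<omega>) \<subseteq> dual_space s" using assms by auto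
  then have "mderiv (replicate k \<omega>) p 0 = Dpow s k p 0 (replicate k \<omega>)"
    by (subst Dpow_eq_mderiv) auto
  then show ?thesis using assms by (simp add: homog_in_dual tcomp_def)
qed


section \<open>Shifts\<close>

lemma shift_op_add: "shift_op s \<theta> (p + q) = shift_op s \<theta> p + shift_op s \<theta> q"
  and shift_op_scale: "shift_op s \<theta> (pscale (*) c p) = pscale (*) c (shift_op s \<theta> p)"
  and shift_op_zero: "shift_op s \<theta> 0 = 0"
  by (auto simp: shift_op_def fun_eq_iff)

lemma shift_op_pow:
  assumes "\<theta> \<in> dual_space s"
  shows "shift_op s \<theta> (homog s n (tpow s v n)) =
    (\<Sum>k\<le>n. pscale (*) (of_nat (n choose k) * \<theta> v ^ (n - k)) (homog s k (tpow s v k)))"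
proof (rule ext)
  fix \<omega>
  show "shift_op s \<theta> (homog s n (tpow s v n)) \<omega> =
    (\<Sum>k\<le>n. pscale (*) (of_nat (n choose k) * \<theta> v ^ (n - k)) (homog s k (tpow s v k))) \<omega>"
    using assms binomial_ring[of "\<omega> v" "\<theta> v" n]
    by (simp add: shift_op_def pow_poly_apply mult.assoc mult.commute mult.left_commute)
qed

lemma shift_op_in_polys [simp]:
  assumes \<theta>: "\<theta> \<in> dual_space s" and "p \<in> polys s"
  shows "shift_op s \<theta> p \<in> polys s"
  using assms(2)
proof (induction rule: polys_induct)
  case zero
  show ?case unfolding shift_op_zero by (rule polys_zero)
next
  case (step c n v p)
  show ?case
    unfolding shift_op_add shift_op_scale shift_op_pow[OF \<theta>]
    by (intro polys_add polys_scale polys_sum homog_in_polys tpow_in_sym_power step)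
qed

lemma shift_op_lin:
  assumes "\<theta> \<in> dual_space s"
  shows "(\<lambda>p. if p \<in> polys s then shift_op s \<theta> p else 0) \<in>
    lin_maps (pscale (*)) (polys s) (pscale (*)) (polys s)"
  using assms by (intro lin_mapsI) (auto simp: shift_op_add shift_op_scale)

text \<open>
  Taylor's formula: the Taylor coefficients at \<open>\<omega>\<close> are the homogeneous components of the
  translate by \<open>\<omega>\<close>.
\<close>

lemma Dpow_eq_tcomp_shift:
  assumes \<omega>: "\<omega> \<in> dual_space s" and p: "p \<in> polys s"
  shows "Dpow s k p \<omega> = pscale (*) (fact k) (tcomp k (shift_op s \<omega> p))"
proof -
  let ?E = "\<lambda>p. if p \<in> polys s then shift_op s \<omega> p else 0"
  have "(\<lambda>p. Dpow s k p \<omega>) = pscale (pscale (*)) (fact k) (\<lambda>p. tcomp k (?E p))"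
  proof (rule poly_maps_eqI[OF lin_maps_eval[OF Dpow_lin]
        lin_maps_pscale[OF form.vector_space_axioms subspace_sym_power
          lin_maps_comp[OF tcomp_lin shift_op_lin[OF \<omega>]]]])
    fix n v
    have "tcomp k (?E (homog s n (tpow s v n))) =
        tcomp k (\<Sum>j\<le>n. homog s j (pscale (*) (of_nat (n choose j) * \<omega> v ^ (n - j)) (tpow s v j)))"
      by (simp add: shift_op_pow[OF \<omega>] homog_scale)
    also have "\<dots> = pscale (*) (of_nat (n choose k) * \<omega> v ^ (n - k)) (tpow s v k)"
      by (subst tcomp_sum_homog) (auto simp: fun_eq_iff intro!: form.subspace_scale[OF subspace_sym_power])
    finally show "Dpow s k (homog s n (tpow s v n)) \<omega> =
        pscale (pscale (*)) (fact k) (\<lambda>p. tcomp k (?E p)) (homog s n (tpow s v n))"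
      using \<omega> by (simp only: Dpow_pow pow_poly_apply prod_diff_eq_choose if_True)
        (simp add: fun_eq_iff)
  qed
  then show ?thesis
    using p by (simp add: fun_eq_iff)
qed

lemma Dpow_shift:
  assumes "\<omega> \<in> dual_space s" "\<theta> \<in> dual_space s" "p \<in> polys s"
  shows "Dpow s k (shift_op s \<theta> p) \<omega> = Dpow s k p (\<omega> + \<theta>)"
proof -
  have "shift_op s \<omega> (shift_op s \<theta> p) = shift_op s (\<omega> + \<theta>) p"
    using assms by (auto simp: fun_eq_iff shift_op_def add.assoc)
  then show ?thesis
    using assms by (simp add: Dpow_eq_tcomp_shift)
qed

section \<open>Symmetric products of linear maps\<close>

abbreviation "sym_maps n \<equiv> lin_maps (pscale (*)) (sym_power s n) (*) (UNIV :: 'k set)"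

lemma sym_lift_eq:
  assumes "A \<in> lin_maps (pscale (*)) (sym_power s n) sw UNIV" "\<And>v. A (tpow s v n) = \<phi> v"
  shows "sym_lift s n sw \<phi> = A"
  unfolding sym_lift_def
  by (rule the_equality) (use assms in \<open>auto intro!: sym_power_maps_eqI\<close>)

lemma unit_functional_lin: "unit_functional s \<in> sym_maps 0"
  unfolding unit_functional_def by (rule lin_maps_restrictI) (auto intro: form.vector_space_axioms)

lemma unit_functional_tpow: "unit_functional s (tpow s v 0) = 1"
  by (simp add: unit_functional_def tpow_apply)

text \<open>
  Freezing the last slots of a symmetric tensor reduces a product of functionals to its factors.
\<close>

lemma slice_lin:
  assumes \<eta>s: "length \<eta>s = m" "set \<eta>s \<subseteq> dual_space s"
  shows "(\<lambda>f. if f \<in> sym_power s (k + m) then \<lambda>\<theta>s. f (\<theta>s @ \<eta>s) else 0) \<in>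
    lin_maps (pscale (*)) (sym_power s (k + m)) (pscale (*)) (sym_power s k)"
proof (rule lin_maps_restrictI)
  show "(\<lambda>\<theta>s. f (\<theta>s @ \<eta>s)) \<in> sym_power s k" if "f \<in> sym_power s (k + m)" for f
    using that
  proof (induction rule: sym_power_induct)
    case zero
    have "0 \<in> sym_power s k" by (rule form.subspace_0[OF subspace_sym_power])
    then show ?case by (simp add: zero_fun_def)
  next
    case (step c v f)
    have "(\<lambda>\<theta>s. (pscale (*) c (tpow s v (k + m)) + f) (\<theta>s @ \<eta>s)) =
        pscale (*) (c * prod_list (map (\<lambda>\<eta>. \<eta> v) \<eta>s)) (tpow s v k) + (\<lambda>\<theta>s. f (\<theta>s @ \<eta>s))"
      using \<eta>s by (auto simp: fun_eq_iff tpow_apply)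
    also have "\<dots> \<in> sym_power s k"
      by (intro form.subspace_add[OF subspace_sym_power] form.subspace_scale[OF subspace_sym_power]
          tpow_in_sym_power step)
    finally show ?case .
  qed
qed (auto intro: form.vector_space_axioms)

text \<open>
  The functional \<open>F\<close> is applied to the first \<open>k\<close> slots, with the remaining slots frozen; the
  outcome is a symmetric tensor in the remaining slots, to which \<open>G\<close> applies.
\<close>

lemma product_of_functionals:
  assumes F: "F \<in> sym_maps k" and G: "G \<in> sym_maps m"
  shows "\<exists>A\<in>sym_maps (k + m). \<forall>v. A (tpow s v (k + m)) = F (tpow s v k) * G (tpow s v m)"
proof -
  have "\<exists>A\<in>lin_maps (pscale (*)) (sym_power s (k + m)) (pscale (*)) (sym_power s m).
      \<forall>v. A (tpow s v (k + m)) = pscale (*) (F (tpow s v k)) (tpow s v m)"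
  proof (rule linear_extension[where \<tau> = "\<lambda>\<eta>s q. q \<eta>s" and S = UNIV])
    fix \<eta>s
    show "\<exists>T\<in>sym_maps (k + m).
        \<forall>v. T (tpow s v (k + m)) = pscale (*) (F (tpow s v k)) (tpow s v m) \<eta>s"
    proof (cases "length \<eta>s = m \<and> set \<eta>s \<subseteq> dual_space s")
      case True
      have "(\<lambda>\<theta>s. tpow s v (k + m) (\<theta>s @ \<eta>s)) =
          pscale (*) (prod_list (map (\<lambda>\<eta>. \<eta> v) \<eta>s)) (tpow s v k)" for v
        using True by (auto simp: fun_eq_iff tpow_apply)
      then show ?thesis
        using True by (intro bexI[OF _ lin_maps_comp[OF F slice_lin]])
          (auto simp: lin_maps_scale[OF F] tpow_apply)
    next
      case False
      then show ?thesis by (intro bexI[OF _ zero_lin_map]) (auto simp: tpow_apply)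
    qed
  qed (auto simp: sym_power_eq_span[symmetric] form.vector_space_axioms fun_eq_iff
      intro!: form.subspace_scale[OF subspace_sym_power])
  then obtain A where A: "A \<in> lin_maps (pscale (*)) (sym_power s (k + m)) (pscale (*)) (sym_power s m)"
    "\<And>v. A (tpow s v (k + m)) = pscale (*) (F (tpow s v k)) (tpow s v m)" by blast
  show ?thesis
    by (intro bexI[OF _ lin_maps_comp[OF G A(1)]]) (simp add: A(2) lin_maps_scale[OF G])
qed

lemma odot_lin: "F \<in> sym_maps k \<Longrightarrow> G \<in> sym_maps m \<Longrightarrow> odot s k F m G \<in> sym_maps (k + m)"
  and odot_tpow: "F \<in> sym_maps k \<Longrightarrow> G \<in> sym_maps m \<Longrightarrow>
    odot s k F m G (tpow s v (k + m)) = F (tpow s v k) * G (tpow s v m)"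
proof -
  assume "F \<in> sym_maps k" "G \<in> sym_maps m"
  from product_of_functionals[OF this] obtain A where "A \<in> sym_maps (k + m)"
    "\<And>v. A (tpow s v (k + m)) = F (tpow s v k) * G (tpow s v m)" by blast
  moreover from this have "odot s k F m G = A"
    unfolding odot_def by (intro sym_lift_eq)
  ultimately show "odot s k F m G \<in> sym_maps (k + m)"
    "odot s k F m G (tpow s v (k + m)) = F (tpow s v k) * G (tpow s v m)" by auto
qed

lemma product_of_functional_list:
  assumes "\<And>l F. (l, F) \<in> set Fs \<Longrightarrow> F \<in> sym_maps l"
  shows "\<exists>A\<in>sym_maps (sum_list (map fst Fs)).
    \<forall>v. A (tpow s v (sum_list (map fst Fs))) = prod_list (map (\<lambda>(l, F). F (tpow s v l)) Fs)"
  using assms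
proof (induction Fs)
  case Nil
  show ?case
    unfolding list.map sum_list.Nil prod_list.Nil
    by (intro bexI[of _ "unit_functional s"] allI unit_functional_lin unit_functional_tpow)
next
  case (Cons lF Fs)
  obtain l F where lF: "lF = (l, F)" by force
  have F: "F \<in> sym_maps l" by (rule Cons.prems) (simp add: lF)
  obtain A where A: "A \<in> sym_maps (sum_list (map fst Fs))"
    "\<And>v. A (tpow s v (sum_list (map fst Fs))) = prod_list (map (\<lambda>(l, F). F (tpow s v l)) Fs)"
    using Cons.IH[OF Cons.prems[OF list.set_intros(2)]] by blast
  have "\<exists>A\<in>sym_maps (sum_list (map fst (lF # Fs))).
    \<forall>v. A (tpow s v (sum_list (map fst (lF # Fs)))) = prod_list (map (\<lambda>(l, F). F (tpow s v l)) (lF # Fs))"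
    using product_of_functionals[OF F A(1)] by (simp add: lF A(2))
  then show ?case .
qed

lemma subspace_UNIV_k: "module.subspace (*) (UNIV :: 'k set)"
proof -
  interpret k: vector_space "(*) :: 'k \<Rightarrow> 'k \<Rightarrow> 'k" by (rule vector_space_times)
  show ?thesis by simp
qed

abbreviation "sym_series \<equiv> fseries s (*) (UNIV :: 'k set)"
abbreviation "vec_series \<equiv> fseries s s (UNIV :: 'v set)"

lemma sym_seriesD: "A \<in> sym_series \<Longrightarrow> A n \<in> sym_maps n"
  and vec_seriesD: "B \<in> vec_series \<Longrightarrow> B n \<in> lin_maps (pscale (*)) (sym_power s n) s UNIV"
  by (auto simp: fseries_def)

lemma series_pair_lin: "B \<in> vec_series \<Longrightarrow> \<omega> \<in> dual_space s \<Longrightarrow> series_pair \<omega> B \<in> sym_series"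
  by (auto simp: fseries_def series_pair_def lin_maps_def dual_add dual_scale dual_0)

text \<open>
  On functionals the prescribed value is an average over permutations of products of functionals of the
  \<open>v\<^sup>i\<close>, and each such product extends linearly.
\<close>

lemma odot_list_exists:
  assumes B: "B \<in> vec_series"
  shows "\<exists>A\<in>lin_maps (pscale (*)) (sym_power s (sum_list is)) (pscale (*)) (sym_power s (length is)).
    \<forall>v. A (tpow s v (sum_list is)) = sym_tensor s (map (\<lambda>i. B i (tpow s v i)) is)"
proof (rule linear_extension[where \<tau> = "\<lambda>\<eta>s q. q \<eta>s" and S = UNIV])
  let ?k = "length is"
  fix \<eta>s :: "('v \<Rightarrow> 'k) list"
  show "\<exists>T\<in>sym_maps (sum_list is). \<forall>v. T (tpow s v (sum_list is)) =
      sym_tensor s (map (\<lambda>i. B i (tpow s v i)) is) \<eta>s"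
  proof (cases "length \<eta>s = ?k \<and> set \<eta>s \<subseteq> dual_space s")
    case False
    then have "sym_tensor s (map (\<lambda>i. B i (tpow s v i)) is) \<eta>s = 0" for v
      by (intro sym_power_outside[OF sym_tensor_in_sym_power[OF refl]]) simp
    then show ?thesis by (intro bexI[OF _ zero_lin_map]) simp
  next
    case True
    have "\<exists>A\<in>sym_maps (sum_list is). \<forall>v. A (tpow s v (sum_list is)) =
        (\<Prod>j<?k. (\<eta>s ! j) (B (is ! \<pi> j) (tpow s v (is ! \<pi> j))))" if \<pi>: "\<pi> permutes {..<?k}" for \<pi>
    proof -
      define Fs where "Fs = map (\<lambda>j. (is ! \<pi> j, \<lambda>f. (\<eta>s ! j) (B (is ! \<pi> j) f))) [0..<?k]"
      have "map fst Fs = permute_list \<pi> is"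
        by (simp add: Fs_def permute_list_def)
      then have "sum_list (map fst Fs) = sum_list is"
        using \<pi> by (metis mset_permute_list sum_mset_sum_list)
      moreover have "F \<in> sym_maps l" if "(l, F) \<in> set Fs" for l F
      proof -
        from that obtain j where j: "j < ?k" "l = is ! \<pi> j" "F = (\<lambda>f. (\<eta>s ! j) (B l f))"
          by (auto simp: Fs_def)
        with True have "\<eta>s ! j \<in> dual_space s" by auto
        from sym_seriesD[OF series_pair_lin[OF B this], of l] show ?thesis
          unfolding series_pair_def j(3) .
      qed
      moreover have "prod_list (map (\<lambda>(l, F). F (tpow s v l)) Fs) =
          (\<Prod>j<?k. (\<eta>s ! j) (B (is ! \<pi> j) (tpow s v (is ! \<pi> j))))" for v
        by (simp add: Fs_def o_def prod_list_nth[symmetric])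
      ultimately show ?thesis using product_of_functional_list[of Fs] by simp
    qed
    then have "\<forall>\<pi>\<in>{\<pi>. \<pi> permutes {..<?k}}. \<exists>A. A \<in> sym_maps (sum_list is) \<and>
        (\<forall>v. A (tpow s v (sum_list is)) = (\<Prod>j<?k. (\<eta>s ! j) (B (is ! \<pi> j) (tpow s v (is ! \<pi> j)))))"
      by blast
    from bchoice[OF this] obtain A where A: "\<And>\<pi>. \<pi> permutes {..<?k} \<Longrightarrow> A \<pi> \<in> sym_maps (sum_list is)"
      "\<And>\<pi> v. \<pi> permutes {..<?k} \<Longrightarrow> A \<pi> (tpow s v (sum_list is)) =
        (\<Prod>j<?k. (\<eta>s ! j) (B (is ! \<pi> j) (tpow s v (is ! \<pi> j))))"
      by blast
    have "pscale (*) (1 / fact ?k) (\<Sum>\<pi> | \<pi> permutes {..<?k}. A \<pi>) \<in> sym_maps (sum_list is)"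
      by (intro lin_maps_pscale lin_maps_sum_maps vector_space_times subspace_UNIV_k) (simp add: A)
    moreover have "pscale (*) (1 / fact ?k) (\<Sum>\<pi> | \<pi> permutes {..<?k}. A \<pi>) (tpow s v (sum_list is)) =
        sym_tensor s (map (\<lambda>i. B i (tpow s v i)) is) \<eta>s" for v
    proof -
      let ?vs = "map (\<lambda>i. B i (tpow s v i)) is"
      have "tensor s (permute_list \<pi> ?vs) \<eta>s = A \<pi> (tpow s v (sum_list is))"
        if "\<pi> permutes {..<?k}" for \<pi>
        using True that permutes_in_image[OF that]
        by (auto simp: tensor_def A permute_list_nth intro!: prod.cong)
      then show ?thesis by (simp add: sym_tensor_def)
    qed
    ultimately show ?thesis by blast
  qed
qed (auto simp: sym_power_eq_span[symmetric] form.vector_space_axioms fun_eq_iff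
    intro!: sym_tensor_in_sym_power)

lemma odot_list_lin:
    "B \<in> vec_series \<Longrightarrow> odot_list s B is \<in>
      lin_maps (pscale (*)) (sym_power s (sum_list is)) (pscale (*)) (sym_power s (length is))"
  and odot_list_tpow: "B \<in> vec_series \<Longrightarrow>
    odot_list s B is (tpow s v (sum_list is)) = sym_tensor s (map (\<lambda>i. B i (tpow s v i)) is)"
proof -
  assume "B \<in> vec_series"
  from odot_list_exists[OF this] obtain A where
    A: "A \<in> lin_maps (pscale (*)) (sym_power s (sum_list is)) (pscale (*)) (sym_power s (length is))"
    "\<And>v. A (tpow s v (sum_list is)) = sym_tensor s (map (\<lambda>i. B i (tpow s v i)) is)" by blast
  then have "odot_list s B is = A"
    unfolding odot_list_def by (intro sym_lift_eq lin_maps_mono[OF A(1)]) auto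
  with A show "odot_list s B is \<in>
      lin_maps (pscale (*)) (sym_power s (sum_list is)) (pscale (*)) (sym_power s (length is))"
    "odot_list s B is (tpow s v (sum_list is)) = sym_tensor s (map (\<lambda>i. B i (tpow s v i)) is)" by auto
qed

lemma sym_tensor_diag:
  assumes "\<omega> \<in> dual_space s"
  shows "sym_tensor s vs (replicate (length vs) \<omega>) = prod_list (map \<omega> vs)"
proof -
  let ?k = "length vs"
  have "tensor s (permute_list \<pi> vs) (replicate ?k \<omega>) = prod_list (map \<omega> vs)"
    if \<pi>: "\<pi> permutes {..<?k}" for \<pi>
  proof -
    have "set (replicate ?k \<omega>) \<subseteq> dual_space s" using assms by auto
    then have "tensor s (permute_list \<pi> vs) (replicate ?k \<omega>) = (\<Prod>i<?k. \<omega> (vs ! \<pi> i))"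
      using \<pi> by (auto simp: tensor_def permute_list_nth intro!: prod.cong)
    also have "\<dots> = (\<Prod>i<?k. \<omega> (vs ! i))"
      using prod.permute[OF \<pi>, of "\<lambda>i. \<omega> (vs ! i)"] by (simp add: o_def)
    also have "\<dots> = prod_list (map \<omega> vs)"
      by (simp add: prod_list_nth[symmetric])
    finally show ?thesis .
  qed
  then show ?thesis
    by (simp add: sym_tensor_def card_permutations[of "{..<?k}" ?k])
qed


section \<open>Formal tensor power series along a vector\<close>

text \<open>
  The series in \<open>t\<close> that represents \<open>A(t v)\<close>.
\<close>

definition fps_at where
  "fps_at A v = Abs_fps (\<lambda>n. A n (tpow s v n))"

lemma fps_at_nth [simp]: "fps_nth (fps_at A v) n = A n (tpow s v n)"
  by (simp add: fps_at_def)

lemma sym_series_eqI: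
  assumes "A \<in> sym_series" "B \<in> sym_series" "\<And>v. fps_at A v = fps_at B v"
  shows "A = B"
proof
  show "A n = B n" for n
    using assms(3) by (intro sym_power_maps_eqI[OF sym_seriesD[OF assms(1)] sym_seriesD[OF assms(2)]])
      (simp add: fps_eq_iff)
qed

lemma series_one_lin: "series_one s \<in> sym_series"
  using unit_functional_lin by (auto simp: fseries_def series_one_def lin_maps_def)

lemma fps_at_series_one: "fps_at (series_one s) v = 1"
  by (auto simp: fps_eq_iff series_one_def unit_functional_tpow)

lemma series_mult_lin:
  assumes "A \<in> sym_series" "B \<in> sym_series"
  shows "series_mult s A B \<in> sym_series"
  unfolding fseries_def mem_Collect_eq
proof
  fix n
  have "odot s k (A k) (n - k) (B (n - k)) \<in> sym_maps n" if "k \<le> n" for k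
    using odot_lin[OF sym_seriesD[OF assms(1)] sym_seriesD[OF assms(2)], of k "n - k"] that by simp
  then show "series_mult s A B n \<in> sym_maps n"
    unfolding series_mult_def
    by (intro lin_maps_sum_maps vector_space_times subspace_UNIV_k) auto
qed

lemma fps_at_series_mult:
  assumes "A \<in> sym_series" "B \<in> sym_series"
  shows "fps_at (series_mult s A B) v = fps_at A v * fps_at B v"
proof (rule fps_ext)
  fix n
  have "odot s k (A k) (n - k) (B (n - k)) (tpow s v n) = A k (tpow s v k) * B (n - k) (tpow s v (n - k))"
    if "k \<le> n" for k
    using odot_tpow[OF sym_seriesD[OF assms(1)] sym_seriesD[OF assms(2)], of k "n - k" v] that by simp
  then show "fps_nth (fps_at (series_mult s A B) v) n = fps_nth (fps_at A v * fps_at B v) n"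
    by (simp add: series_mult_def fps_mult_nth atLeast0AtMost)
qed

lemma series_power_lin: "C \<in> sym_series \<Longrightarrow> series_power s C k \<in> sym_series"
  unfolding series_power_def by (induction k) (auto simp: series_one_lin series_mult_lin)

lemma fps_at_series_power:
  assumes "C \<in> sym_series"
  shows "fps_at (series_power s C k) v = fps_at C v ^ k"
proof (induction k)
  case (Suc k)
  then show ?case
    using fps_at_series_mult[OF assms series_power_lin[OF assms]] by (simp add: series_power_def)
qed (simp add: series_power_def fps_at_series_one)

lemma series_exp_lin: 
  assumes "C \<in> sym_series"
  shows "series_exp s C \<in> sym_series"
  unfolding fseries_def mem_Collect_eq series_exp_def
  by (intro allI lin_maps_sum_maps lin_maps_pscale vector_space_times subspace_UNIV_k
      sym_seriesD series_power_lin assms)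

lemma fps_at_series_exp:
  assumes "C \<in> sym_series"
  shows "fps_at (series_exp s C) v = fps_compose (fps_exp 1) (fps_at C v)"
proof (rule fps_ext)
  show "fps_nth (fps_at (series_exp s C) v) n = fps_nth (fps_compose (fps_exp 1) (fps_at C v)) n" for n
    using fps_at_series_power[OF assms, of _ v]
    by (simp add: fps_compose_nth series_exp_def atLeast0AtMost fps_eq_iff)
qed

lemma series_tpow_lin:
  assumes B: "B \<in> vec_series"
  shows "series_tpow s B k n \<in> lin_maps (pscale (*)) (sym_power s n) (pscale (*)) (sym_power s k)"
  unfolding series_tpow_def
  by (intro lin_maps_sum_maps form.vector_space_axioms subspace_sym_power)
    (use odot_list_lin[OF B] in auto)

text \<open>
  On the diagonal the symmetric products of the \<open>B\<^sub>i v\<^sup>i\<close> become ordinary products, so that the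
  tensor power of the series turns into a power of the scalar series \<open>\<langle>\<omega>, B(t v)\<rangle>\<close>.
\<close>

lemma series_tpow_diag:
  assumes B: "B \<in> vec_series" "B 0 = 0" and \<omega>: "\<omega> \<in> dual_space s"
  shows "series_tpow s B k n (tpow s v n) (replicate k \<omega>) = fps_nth (fps_at (series_pair \<omega> B) v ^ k) n"
proof -
  let ?b = "\<lambda>i. \<omega> (B i (tpow s v i))"
  have "series_tpow s B k n (tpow s v n) (replicate k \<omega>) =
     (\<Sum>is | length is = k \<and> (\<forall>i\<in>set is. 1 \<le> i) \<and> sum_list is = n. prod_list (map ?b is))"
    unfolding series_tpow_def sum_fun_apply
  proof (intro sum.cong refl)
    fix "is" assume "is": "is \<in> {is. length is = k \<and> (\<forall>i\<in>set is. 1 \<le> i) \<and> sum_list is = n}"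
    then have "odot_list s B is (tpow s v n) = sym_tensor s (map (\<lambda>i. B i (tpow s v i)) is)"
      using odot_list_tpow[OF B(1), of "is"] by simp
    then show "odot_list s B is (tpow s v n) (replicate k \<omega>) = prod_list (map ?b is)"
      using sym_tensor_diag[OF \<omega>, of "map (\<lambda>i. B i (tpow s v i)) is"] "is" by (simp add: o_def)
  qed
  \<comment> \<open>compositions with a part 0 may be added, since \<open>B 0 = 0\<close>\<close>
  also have "\<dots> = (\<Sum>is\<in>natpermute n k. prod_list (map ?b is))"
  proof (intro sum.mono_neutral_left natpermute_finite ballI)
    fix "is" assume "is \<in> natpermute n k - {is. length is = k \<and> (\<forall>i\<in>set is. 1 \<le> i) \<and> sum_list is = n}"
    then obtain i where "i \<in> set is" "\<not> 1 \<le> i" by (auto simp: natpermute_def)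
    then have "0 \<in> set is" by (cases "i = 0") auto
    then show "prod_list (map ?b is) = 0"
      using dual_0[OF \<omega>] B(2) by (force simp: prod_list_zero_iff)
  qed (auto simp: natpermute_def)
  also have "\<dots> = fps_nth (fps_at (series_pair \<omega> B) v ^ k) n"
  proof (cases k)
    case 0
    have "natpermute n 0 = (if n = 0 then {[]} else {})" by (auto simp: natpermute_def)
    with 0 show ?thesis by simp
  next
    case (Suc m)
    have "prod_list (map ?b is) = (\<Prod>j=0..m. ?b (is ! j))" if "is \<in> natpermute n k" for "is"
      using that Suc by (simp add: prod_list_nth[symmetric] natpermute_def lessThan_Suc_atMost atLeast0AtMost)
    then show ?thesis
      by (simp add: Suc fps_power_nth_Suc series_pair_def del: power_Suc)
  qed
  finally show ?thesis .
qed

section \<open>The first symmetric power\<close>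

text \<open>
  The inverse of the identification \<open>v \<mapsto> tpow s v 1\<close> of \<open>V\<close> with its first symmetric power.
\<close>

definition vec_of where
  "vec_of = sym_lift s 1 s (\<lambda>v. v)"

lemma vec_of_lin: "vec_of \<in> lin_maps (pscale (*)) (sym_power s 1) s UNIV"
  and vec_of_tpow: "vec_of (tpow s v 1) = v"
proof -
  have "\<exists>A\<in>lin_maps (pscale (*)) (sym_power s 1) s UNIV. \<forall>v. A (tpow s v 1) = v"
  proof (rule linear_extension[where \<tau> = "\<lambda>\<omega> v. \<omega> v" and S = "dual_space s"])
    fix \<omega> assume \<omega>: "\<omega> \<in> dual_space s"
    show "\<exists>T\<in>sym_maps 1. \<forall>v. T (tpow s v 1) = \<omega> v"
      by (intro bexI[OF _ lin_maps_restrictI[where T = "\<lambda>f. f [\<omega>]"]])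
        (use \<omega> in \<open>auto simp: tpow_apply form.vector_space_axioms\<close>)
  qed (auto simp: sym_power_eq_span[symmetric] form.vector_space_axioms vector_space_axioms dual_add dual_scale
      dual_separates)
  then obtain A where "A \<in> lin_maps (pscale (*)) (sym_power s 1) s UNIV" "\<And>v. A (tpow s v 1) = v" by blast
  moreover from this have "vec_of = A" unfolding vec_of_def by (intro sym_lift_eq)
  ultimately show "vec_of \<in> lin_maps (pscale (*)) (sym_power s 1) s UNIV" "vec_of (tpow s v 1) = v" by auto
qed

lemma apply_vec_of:
  assumes "f \<in> sym_power s 1" "\<omega> \<in> dual_space s"
  shows "\<omega> (vec_of f) = f [\<omega>]"
  using assms(1)
proof (induction rule: sym_power_induct)
  case zero
  have "\<omega> (vec_of 0) = 0 [\<omega>]" by (simp add: lin_maps_zero[OF vec_of_lin] dual_0[OF assms(2)])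
  then show ?case .
next
  case (step c v f)
  then show ?case
    using assms(2) by (subst lin_maps_add[OF vec_of_lin])
      (auto simp: lin_maps_scale[OF vec_of_lin] dual_add dual_scale tpow_apply vec_of_tpow[unfolded One_nat_def]
        intro!: form.subspace_scale[OF subspace_sym_power])
qed

lemma tpow_vec_of: "f \<in> sym_power s 1 \<Longrightarrow> tpow s (vec_of f) 1 = f"
  by (rule sym_power_eqI) (auto simp: tpow_apply apply_vec_of)

lemma bij_vec_of: "bij_betw vec_of (sym_power s 1) UNIV"
  by (rule bij_betw_byWitness[where f' = "\<lambda>v. tpow s v 1"])
    (use tpow_vec_of vec_of_tpow in auto)

lemma bij_tpow_1: "bij_betw (\<lambda>v. tpow s v 1) UNIV (sym_power s 1)"
  by (rule bij_betw_byWitness[where f' = vec_of]) (use tpow_vec_of vec_of_tpow in auto)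

lemma series_id_eq: "series_id s n = (if n = 1 then vec_of else 0)"
  by (simp add: series_id_def vec_of_def)

lemma mderiv_append:
  assumes "\<eta> \<in> dual_space s"
  shows "mderiv (\<eta>s @ [\<eta>]) p = mderiv \<eta>s (poly_deriv \<eta> p)"
proof (induction \<eta>s)
  case Nil
  note lin = poly_deriv_lin[OF assms]
  have "mderiv ([] @ [\<eta>]) p = mderiv [] (poly_deriv \<eta> p)"
  proof (cases "p \<in> polys s")
    case True
    then show ?thesis using lin_maps_in[OF lin True] by simp
  next
    case False
    then show ?thesis by (simp add: lin_maps_outside[OF lin False] lin_maps_zero[OF lin])
  qed
  then show ?case .
qed simp

lemma mderiv_replicate_Suc:
  assumes "\<theta> \<in> dual_space s"
  shows "mderiv (replicate (Suc k) \<theta>) p = mderiv (replicate k \<theta>) (poly_deriv \<theta> p)"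
  using mderiv_append[OF assms, of "replicate k \<theta>" p] by (simp add: replicate_append_same)

lemma homog_lin:
  "(\<lambda>f. if f \<in> sym_power s n then homog s n f else 0) \<in>
    lin_maps (pscale (*)) (sym_power s n) (pscale (*)) (polys s)"
  by (rule lin_maps_restrictI) (simp_all add: homog_add homog_scale form.vector_space_axioms)

lemma poly_eq_sum_tcomp_upto:
  assumes "p \<in> polys s" "\<And>k. k > n \<Longrightarrow> tcomp k p = 0"
  shows "p = (\<Sum>k\<le>n. homog s k (tcomp k p))"
proof -
  obtain m where m: "p = (\<Sum>k\<le>m. homog s k (tcomp k p))"
    using poly_eq_sum_tcomp[OF assms(1)] .
  have "(\<Sum>k\<le>m. homog s k (tcomp k p)) = (\<Sum>k\<le>n. homog s k (tcomp k p))"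
  proof (cases "n \<le> m")
    case True
    then show ?thesis using sum_homog_extend[of n "\<lambda>k. tcomp k p" m] assms(2) by simp
  next
    case False
    have "tcomp k p = 0" if "k > m" for k
    proof -
      have "tcomp k (\<Sum>j\<le>m. homog s j (tcomp j p)) = 0"
        using that lin_maps_in[OF tcomp_lin assms(1)] by (subst tcomp_sum_homog) auto
      with m show ?thesis by simp
    qed
    with False show ?thesis using sum_homog_extend[of m "\<lambda>k. tcomp k p" n] by simp
  qed
  with m show ?thesis by (rule trans)
qed

lemma poly_eqI_tcomp:
  assumes "p \<in> polys s" "q \<in> polys s" "\<And>k. tcomp k p = tcomp k q"
  shows "p = q"
proof -
  obtain n where n: "p - q = (\<Sum>k\<le>n. homog s k (tcomp k (p - q)))"
    using poly_eq_sum_tcomp[OF polys_diff[OF assms(1,2)]] .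
  have "tcomp k (p - q) = 0" for k
    using lin_maps_add[OF tcomp_lin polys_diff[OF assms(1,2)] assms(2), of k] assms(3)[of k] by simp
  with n show ?thesis by simp
qed

section \<open>Differential operators of infinite order\<close>

lemma series_D_eq:
  assumes "\<And>k. A k 0 = 0" "\<And>k. k > N \<Longrightarrow> Dpow s k p = 0"
  shows "series_D s A p \<omega> = (\<Sum>k=1..N. A k (Dpow s k p \<omega>))"
proof -
  have "{k. 1 \<le> k \<and> Dpow s k p \<noteq> 0} \<subseteq> {1..N}"
    using assms(2) by (auto simp: not_le[symmetric])
  then show ?thesis
    unfolding series_D_def using assms(1) by (intro sum.mono_neutral_left) auto
qed

lemma series_D_outside:
  assumes "\<And>k. A k 0 = 0" "\<omega> \<notin> dual_space s"
  shows "series_D s A p \<omega> = 0"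
  unfolding series_D_def using assms by (intro sum.neutral) (simp add: Dpow_outside)

lemma series_D_lin:
  assumes sw: "vector_space sw"
    and A: "\<And>k. A k \<in> lin_maps (pscale (*)) (sym_power s k) sw UNIV"
  shows "series_D s A \<in> lin_maps (pscale (*)) (polys s) (pscale sw) UNIV"
proof -
  interpret w: vector_space sw by fact
  note A0 = lin_maps_zero[OF A]
  show ?thesis
  proof (rule lin_mapsI)
    fix p q assume p: "p \<in> polys s" and q: "q \<in> polys s"
    obtain N1 where N1: "\<And>k. k > N1 \<Longrightarrow> Dpow s k p = 0" using Dpow_finite[OF p] by blast
    obtain N2 where N2: "\<And>k. k > N2 \<Longrightarrow> Dpow s k q = 0" using Dpow_finite[OF q] by blast
    let ?N = "max N1 N2"
    have pq: "Dpow s k (p + q) = 0" if "k > ?N" for k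
      using N1 N2 that by (simp add: Dpow_add p q)
    show "series_D s A (p + q) = series_D s A p + series_D s A q"
    proof (rule ext)
      fix \<omega>
      have "series_D s A (p + q) \<omega> = (\<Sum>k=1..?N. A k (Dpow s k (p + q) \<omega>))"
        by (rule series_D_eq[of A, OF A0 pq])
      also have "\<dots> = (\<Sum>k=1..?N. A k (Dpow s k p \<omega>) + A k (Dpow s k q \<omega>))"
        by (intro sum.cong refl) (simp add: Dpow_add p q lin_maps_add[OF A])
      also have "\<dots> = series_D s A p \<omega> + series_D s A q \<omega>"
        using series_D_eq[of A ?N p \<omega>] series_D_eq[of A ?N q \<omega>] A0 N1 N2 by (simp add: sum.distrib)
      finally show "series_D s A (p + q) \<omega> = (series_D s A p + series_D s A q) \<omega>" by simp
    qed
  next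
    fix c p assume p: "p \<in> polys s"
    obtain N where N: "\<And>k. k > N \<Longrightarrow> Dpow s k p = 0" using Dpow_finite[OF p] by blast
    have cp: "Dpow s k (pscale (*) c p) = 0" if "k > N" for k
      using N[OF that] by (simp add: Dpow_scale p fun_eq_iff)
    show "series_D s A (pscale (*) c p) = pscale sw c (series_D s A p)"
    proof (rule ext)
      fix \<omega>
      have "series_D s A (pscale (*) c p) \<omega> = (\<Sum>k=1..N. A k (Dpow s k (pscale (*) c p) \<omega>))"
        by (rule series_D_eq[of A, OF A0 cp])
      also have "\<dots> = (\<Sum>k=1..N. sw c (A k (Dpow s k p \<omega>)))"
        by (intro sum.cong refl) (simp only: Dpow_scale[OF p] pscale_apply lin_maps_scale[OF A Dpow_in_sym_power])
      also have "\<dots> = sw c (series_D s A p \<omega>)"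
        using series_D_eq[of A N p \<omega>] A0 N by (simp add: w.scale_sum_right)
      finally show "series_D s A (pscale (*) c p) \<omega> = pscale sw c (series_D s A p) \<omega>" by simp
    qed
  next
    fix p assume "p \<notin> polys s"
    then show "series_D s A p = 0"
      by (simp add: series_D_def fun_eq_iff lin_maps_outside[OF Dpow_lin])
  qed simp
qed

lemma series_D_shift:
  assumes A0: "\<And>k. A k 0 = 0" and "\<theta> \<in> dual_space s" "\<omega> \<in> dual_space s" and p: "p \<in> polys s"
  shows "series_D s A (shift_op s \<theta> p) \<omega> = series_D s A p (\<omega> + \<theta>)"
proof -
  obtain N1 where N1: "\<And>k. k > N1 \<Longrightarrow> Dpow s k p = 0" using Dpow_finite[OF p] by blast
  obtain N2 where N2: "\<And>k. k > N2 \<Longrightarrow> Dpow s k (shift_op s \<theta> p) = 0"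
    using Dpow_finite[OF shift_op_in_polys[OF assms(2) p]] by blast
  show ?thesis
    using series_D_eq[of A "max N1 N2" p] series_D_eq[of A "max N1 N2" "shift_op s \<theta> p"] assms N1 N2
    by (simp add: Dpow_shift)
qed

lemma dual_series_D:
  "\<theta> \<in> dual_space s \<Longrightarrow> \<theta> (series_D s L p \<omega>) = series_D s (series_pair \<theta> L) p \<omega>"
  by (simp add: series_D_def series_pair_def dual_sum)

lemma fseries1D:
  assumes "B \<in> fseries1 s"
  shows "B \<in> vec_series" "B 0 = 0"
  using assms by (auto simp: fseries1_def)

text \<open>
  Let \<open>A\<close> be formed from the row with index 1 of a matrix \<open>X\<close>, and let the tensor powers of \<open>C\<close> have the
  entries of a matrix \<open>Y\<close> as coefficients. If row 1 of the product of \<open>X\<close> and \<open>Y\<close> is that of the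
  identity matrix, then \<open>A(C(v)) = v\<close>. The parameter \<open>X\<close> stands for the row only.
\<close>

lemma series_comp_eq_id:
  assumes X: "\<And>n. X n \<in> lin_maps (pscale (*)) (sym_power s n) (pscale (*)) (sym_power s 1)" "X 0 = 0"
    and Y: "\<And>k n. Y k n \<in> lin_maps (pscale (*)) (sym_power s n) (pscale (*)) (sym_power s k)"
    and XY: "\<And>n f. f \<in> sym_power s n \<Longrightarrow> (\<Sum>k\<le>n. X k (Y k n f)) = (if n = 1 then f else 0)"
    and A: "\<And>n f. A n f = s (1 / fact n) (vec_of (X n f))"
    and C: "\<And>k n. k \<ge> 1 \<Longrightarrow> series_tpow s C k n = pscale (pscale (*)) (fact k / fact n) (Y k n)"
  shows "series_comp s A C = series_id s"
proof (intro ext)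
  fix n f
  show "series_comp s A C n f = series_id s n f"
  proof (cases "n = 0")
    case True
    then show ?thesis
      by (simp add: series_comp_def series_id_eq A X(2) lin_maps_zero[OF vec_of_lin])
  next
    case n: False
    show ?thesis
    proof (cases "f \<in> sym_power s n")
      case False
      have "A k 0 = 0" for k
        using lin_maps_zero[OF X(1)] lin_maps_zero[OF vec_of_lin] by (simp add: A)
      then have "series_comp s A C n f = 0"
        using n False by (simp add: series_comp_def C lin_maps_outside[OF Y])
      then show ?thesis
        using False lin_maps_outside[OF vec_of_lin, of f] by (cases "n = 1") (simp_all add: series_id_eq)
    next
      case True
      note Yf = lin_maps_in[OF Y True] and Xf = lin_maps_in[OF X(1)]
      have "series_comp s A C n f =
          (\<Sum>k=1..n. s (1 / fact k) (vec_of (X k (pscale (*) (fact k / fact n) (Y k n f)))))"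
        using n by (simp add: series_comp_def C A)
      also have "\<dots> = (\<Sum>k=1..n. s (1 / fact n) (vec_of (X k (Y k n f))))"
        by (intro sum.cong refl)
          (simp only: lin_maps_scale[OF X(1) Yf] lin_maps_scale[OF vec_of_lin Xf[OF Yf]], simp)
      also have "\<dots> = (\<Sum>k\<le>n. s (1 / fact n) (vec_of (X k (Y k n f))))"
        using X(2) lin_maps_zero[OF vec_of_lin]
        by (intro sum.mono_neutral_left) (auto simp: not_less_eq_eq)
      also have "\<dots> = s (1 / fact n) (vec_of (\<Sum>k\<le>n. X k (Y k n f)))"
        using lin_maps_sum[OF vec_of_lin form.vector_space_axioms subspace_sym_power, of "{..n}" "\<lambda>k. X k (Y k n f)"]
          Xf[OF Yf] by (simp add: scale_sum_right)
      also have "\<dots> = series_id s n f"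
        unfolding XY[OF True] by (simp add: series_id_eq lin_maps_zero[OF vec_of_lin])
      finally show ?thesis .
    qed
  qed
qed

end

section \<open>Normalized polynomial operators\<close>

locale normalized_operator = scalar_space s
  for s :: "'k::real_normed_field \<Rightarrow> 'v::ab_group_add \<Rightarrow> 'v" +
  fixes P :: "(('v \<Rightarrow> 'k) \<Rightarrow> 'k) \<Rightarrow> (('v \<Rightarrow> 'k) \<Rightarrow> 'k)"
    and M :: "nat \<Rightarrow> nat \<Rightarrow> ('v, 'k) tensor \<Rightarrow> ('v, 'k) tensor"
  assumes poly_operator: "poly_operator s P M"
    and degree_0: "\<And>\<omega>. \<omega> \<in> dual_space s \<Longrightarrow> poly_seq s P 0 \<omega> = unit_functional s"
    and at_0: "\<And>n. n \<ge> 1 \<Longrightarrow> poly_seq s P n 0 = 0"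
begin

text \<open>
  The polynomial \<open>\<omega> \<mapsto> (\<omega> v)\<^sup>n\<close>.
\<close>

abbreviation "ppow n v \<equiv> homog s n (tpow s v n)"

lemma P_lin: "P \<in> lin_maps (pscale (*)) (polys s) (pscale (*)) (polys s)"
  and M_lin: "M k n \<in> lin_maps (pscale (*)) (sym_power s n) (pscale (*)) (sym_power s k)"
  and M_above: "n < k \<Longrightarrow> M k n = 0"
  and M_bij: "bij_betw (M n n) (sym_power s n) (sym_power s n)"
  and P_homog: "f \<in> sym_power s n \<Longrightarrow> P (homog s n f) = (\<Sum>k\<le>n. homog s k (M k n f))"
  using poly_operator by (auto simp: poly_operator_def)

lemma P_in_polys [simp]: "p \<in> polys s \<Longrightarrow> P p \<in> polys s"
  by (rule lin_maps_in[OF P_lin])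

lemma M_in_sym_power [simp]: "f \<in> sym_power s n \<Longrightarrow> M k n f \<in> sym_power s k"
  by (rule lin_maps_in[OF M_lin])

lemma P_sum: "(\<And>i. i \<in> I \<Longrightarrow> p i \<in> polys s) \<Longrightarrow> P (\<Sum>i\<in>I. p i) = (\<Sum>i\<in>I. P (p i))"
  by (rule lin_maps_sum[OF P_lin form.vector_space_axioms subspace_polys])

lemma tcomp_P:
  assumes "f \<in> sym_power s n"
  shows "tcomp k (P (homog s n f)) = M k n f"
  using assms by (simp add: P_homog tcomp_sum_homog M_above)

lemma poly_seq_lin:
  assumes "\<omega> \<in> dual_space s"
  shows "poly_seq s P n \<omega> \<in> sym_maps n"
  unfolding poly_seq_def
  by (rule lin_maps_restrictI)
    (simp_all add: form.vector_space_axioms homog_add homog_scale lin_maps_add[OF P_lin] lin_maps_scale[OF P_lin])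

lemma poly_seq_tpow: "poly_seq s P n \<omega> (tpow s v n) = P (ppow n v) \<omega>"
  by (simp add: poly_seq_def)

lemma P_ppow_0: "P (ppow 0 v) = ppow 0 v"
proof (rule ext)
  show "P (ppow 0 v) \<omega> = ppow 0 v \<omega>" for \<omega>
  proof (cases "\<omega> \<in> dual_space s")
    case True
    then show ?thesis
      using degree_0[OF True] poly_seq_tpow[of 0 \<omega> v] by (simp add: unit_functional_tpow pow_poly_apply)
  next
    case False
    then show ?thesis by (simp add: polys_outside)
  qed
qed

lemma P_ppow_at_0: "P (ppow n v) 0 = (if n = 0 then 1 else 0)"
proof (cases "n = 0")
  case True
  then show ?thesis by (simp add: P_ppow_0 pow_poly_apply)
next
  case False
  then show ?thesis using at_0[of n] poly_seq_tpow[of n 0 v] by simp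
qed

text \<open>
  Since \<open>P\<^sub>0 = 1\<close> and \<open>P\<^sub>n(0) = 0\<close> for \<open>n \<ge> 1\<close>, both sides agree on the powers.
\<close>

lemma P_at_0:
  assumes "p \<in> polys s"
  shows "P p 0 = p 0"
proof -
  have "(\<lambda>p. P p 0) = (\<lambda>p. if p \<in> polys s then p 0 else 0)"
    by (rule poly_maps_eqI[OF lin_maps_eval[OF P_lin] lin_maps_restrictI])
      (auto simp: form.vector_space_axioms P_ppow_at_0 pow_poly_apply)
  with assms show ?thesis by (simp add: fun_eq_iff)
qed

lemma M_0: "M 0 n (tpow s v n) [] = (if n = 0 then 1 else 0)"
proof -
  have "mderiv [] (P (ppow n v)) 0 = homog s 0 (tcomp 0 (P (ppow n v))) 0"
    using tcomp_diag[of 0 0 "P (ppow n v)"] by simp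
  then show ?thesis by (simp add: tcomp_P homog_in_dual P_ppow_at_0)
qed

lemma P_ppow_apply:
  "\<omega> \<in> dual_space s \<Longrightarrow> P (ppow n v) \<omega> = (\<Sum>k\<le>n. M k n (tpow s v n) (replicate k \<omega>))"
  by (simp add: P_homog homog_in_dual)


subsection \<open>The inverse operator\<close>

text \<open>
  The component of highest degree of \<open>P p\<close> is the image of that of \<open>p\<close> under a diagonal entry, which is
  injective.
\<close>

lemma P_eq_0:
  assumes "p \<in> polys s" "P p = 0"
  shows "p = 0"
proof (rule ccontr)
  assume "p \<noteq> 0"
  obtain N where N: "p = (\<Sum>k\<le>N. homog s k (tcomp k p))"
    using poly_eq_sum_tcomp[OF assms(1)] .
  let ?S = "{k. k \<le> N \<and> tcomp k p \<noteq> 0}"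
  have "?S \<noteq> {}"
  proof
    assume "?S = {}"
    then have "(\<Sum>k\<le>N. homog s k (tcomp k p)) = 0" by (intro sum.neutral) auto
    with N \<open>p \<noteq> 0\<close> show False by (metis (no_types))
  qed
  moreover have "finite ?S" by simp
  ultimately obtain n where n: "n \<in> ?S" "\<And>k. k \<in> ?S \<Longrightarrow> k \<le> n"
    using Max_in Max_ge by blast
  note T = lin_maps_in[OF tcomp_lin assms(1)]
  have "(\<Sum>k\<le>n. homog s k (tcomp k p)) = (\<Sum>k\<le>N. homog s k (tcomp k p))"
    using n by (intro sum.mono_neutral_left) force+
  with N have p: "p = (\<Sum>k\<le>n. homog s k (tcomp k p))" by (rule trans[OF _ sym])
  have "P p = (\<Sum>k\<le>n. P (homog s k (tcomp k p)))"
    by (subst p, rule P_sum) (simp add: T)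
  then have "tcomp n (P p) = (\<Sum>k\<le>n. tcomp n (P (homog s k (tcomp k p))))"
    using lin_maps_sum[OF tcomp_lin form.vector_space_axioms subspace_polys,
        of "{..n}" "\<lambda>k. P (homog s k (tcomp k p))" n] T by simp
  also have "\<dots> = M n n (tcomp n p)"
    by (simp add: tcomp_P T M_above lessThan_Suc_atMost[symmetric])
  finally have "M n n (tcomp n p) = M n n 0"
    using assms(2) by (simp add: lin_maps_zero[OF tcomp_lin] lin_maps_zero[OF M_lin])
  then have "tcomp n p = 0"
    using T form.subspace_0[OF subspace_sym_power] by (rule inj_onD[OF bij_betw_imp_inj_on[OF M_bij]])
  with n show False by simp
qed

text \<open>
  Back substitution in a triangular system. The bound on the degree makes the matrix of the inverse
  triangular as well.
\<close>

lemma P_preimage_homog: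
  assumes "f \<in> sym_power s n"
  shows "\<exists>q\<in>polys s. P q = homog s n f \<and> (\<forall>k>n. tcomp k q = 0)"
  using assms
proof (induction n arbitrary: f rule: less_induct)
  case (less n)
  from less.prems have "f \<in> M n n ` sym_power s n"
    unfolding bij_betw_imp_surj_on[OF M_bij[of n]] .
  then obtain g where g: "g \<in> sym_power s n" "M n n g = f"
    by (elim imageE) (rule that, simp_all)
  have "\<forall>k\<in>{..<n}. \<exists>q. q \<in> polys s \<and> P q = homog s k (M k n g) \<and> (\<forall>j>k. tcomp j q = 0)"
    using less.IH[OF _ M_in_sym_power[OF g(1)]] by blast
  from bchoice[OF this] obtain q where q: "\<And>k. k < n \<Longrightarrow> q k \<in> polys s"
    "\<And>k. k < n \<Longrightarrow> P (q k) = homog s k (M k n g)" "\<And>k j. k < n \<Longrightarrow> j > k \<Longrightarrow> tcomp j (q k) = 0"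
    by blast
  let ?r = "homog s n g + (\<Sum>k<n. pscale (*) (-1) (q k))"
  have q': "\<And>k. k \<in> {..<n} \<Longrightarrow> pscale (*) (-1) (q k) \<in> polys s" "(\<Sum>k<n. pscale (*) (-1) (q k)) \<in> polys s"
    by (intro polys_sum polys_scale q(1), simp)+
  have "P ?r = P (homog s n g) + P (\<Sum>k<n. pscale (*) (-1) (q k))"
    by (rule lin_maps_add[OF P_lin homog_in_polys[OF g(1)] q'(2)])
  also have "P (\<Sum>k<n. pscale (*) (-1) (q k)) = (\<Sum>k<n. P (pscale (*) (-1) (q k)))"
    by (rule P_sum[OF q'(1)])
  also have "\<dots> = (\<Sum>k<n. pscale (*) (-1) (homog s k (M k n g)))"
    by (intro sum.cong refl) (simp only: lin_maps_scale[OF P_lin q(1)] q(2) lessThan_iff)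
  also have "P (homog s n g) = (\<Sum>k<n. homog s k (M k n g)) + homog s n f"
    unfolding P_homog[OF g(1)] lessThan_Suc_atMost[symmetric] sum.lessThan_Suc g(2) ..
  also have "(\<Sum>k<n. homog s k (M k n g)) + homog s n f + (\<Sum>k<n. pscale (*) (-1) (homog s k (M k n g)))
      = homog s n f"
    by (rule ext) (simp add: sum_negf)
  finally have "P ?r = homog s n f" .
  moreover have "tcomp k ?r = 0" if "k > n" for k
  proof -
    have "tcomp k (\<Sum>k<n. pscale (*) (-1) (q k)) = (\<Sum>j<n. tcomp k (pscale (*) (-1) (q j)))"
      by (rule lin_maps_sum[OF tcomp_lin form.vector_space_axioms subspace_polys q'(1)])
    also have "\<dots> = 0"
      using that by (intro sum.neutral ballI) (simp add: lin_maps_scale[OF tcomp_lin q(1)] q(3) del: form.scale_minus_left)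
    finally show ?thesis
      using that lin_maps_add[OF tcomp_lin homog_in_polys[OF g(1)] q'(2)] g(1) by (simp add: tcomp_homog)
  qed
  ultimately show ?case
    using polys_add[OF homog_in_polys[OF g(1)] q'(2)] by blast
qed

lemma P_bij: "bij_betw P (polys s) (polys s)"
  unfolding bij_betw_def
proof
  show "inj_on P (polys s)"
  proof (rule inj_onI)
    fix p q assume pq: "p \<in> polys s" "q \<in> polys s" "P p = P q"
    have "P (p - q) = 0"
      using lin_maps_add[OF P_lin polys_diff[OF pq(1,2)] pq(2)] pq(3) by simp
    from P_eq_0[OF polys_diff[OF pq(1,2)] this] show "p = q" by simp
  qed
  show "P ` polys s = polys s"
  proof
    show "polys s \<subseteq> P ` polys s"
    proof
      fix p assume "p \<in> polys s"
      then obtain n f where f: "p = (\<Sum>k\<le>n. homog s k (f k))" "\<And>k. f k \<in> sym_power s k"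
        using polysE by blast
      have "\<forall>k. \<exists>q. q \<in> polys s \<and> P q = homog s k (f k)"
        using P_preimage_homog[OF f(2)] by blast
      from choice[OF this] obtain q where q: "\<And>k. q k \<in> polys s" "\<And>k. P (q k) = homog s k (f k)"
        by blast
      have "p = P (\<Sum>k\<le>n. q k)" by (simp add: P_sum q f(1))
      then show "p \<in> P ` polys s" using q by auto
    qed
  qed auto
qed

definition P_inv where
  "P_inv p = (if p \<in> polys s then inv_into (polys s) P p else 0)"

definition M_inv where
  "M_inv k n f = tcomp k (P_inv (if f \<in> sym_power s n then homog s n f else 0))"

lemma P_inv_P: "p \<in> polys s \<Longrightarrow> P_inv (P p) = p"
  using bij_betw_inv_into_left[OF P_bij, of p] P_in_polys[of p] by (simp only: P_inv_def if_True)

lemma P_P_inv: "p \<in> polys s \<Longrightarrow> P (P_inv p) = p"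
  using bij_betw_inv_into_right[OF P_bij, of p] by (simp only: P_inv_def if_True)

lemma P_inv_in_polys [simp]: "p \<in> polys s \<Longrightarrow> P_inv p \<in> polys s"
  using bij_betwE[OF bij_betw_inv_into[OF P_bij]] by (simp only: P_inv_def if_True)

lemma P_inject: "p \<in> polys s \<Longrightarrow> q \<in> polys s \<Longrightarrow> P p = P q \<Longrightarrow> p = q"
  using P_inv_P by metis

lemma P_inv_lin: "P_inv \<in> lin_maps (pscale (*)) (polys s) (pscale (*)) (polys s)"
proof (rule lin_mapsI)
  fix p q assume "p \<in> polys s" "q \<in> polys s"
  then show "P_inv (p + q) = P_inv p + P_inv q"
    by - (rule P_inject, simp_all add: P_P_inv lin_maps_add[OF P_lin])
next
  fix c p assume "p \<in> polys s"
  then show "P_inv (pscale (*) c p) = pscale (*) c (P_inv p)"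
    by - (rule P_inject, simp_all add: P_P_inv lin_maps_scale[OF P_lin])
next
  show "P_inv p \<in> polys s" if "p \<in> polys s" for p using that by (rule P_inv_in_polys)
  show "P_inv p = 0" if "p \<notin> polys s" for p using that by (simp only: P_inv_def if_False)
qed

lemma M_inv_lin: "M_inv k n \<in> lin_maps (pscale (*)) (sym_power s n) (pscale (*)) (sym_power s k)"
proof -
  have "(\<lambda>f. tcomp k (P_inv (if f \<in> sym_power s n then homog s n f else 0))) \<in>
      lin_maps (pscale (*)) (sym_power s n) (pscale (*)) (sym_power s k)"
    by (rule lin_maps_comp[OF tcomp_lin lin_maps_comp[OF P_inv_lin homog_lin]])
  then show ?thesis by (simp add: M_inv_def[abs_def])
qed

lemma M_inv_above:
  assumes "n < k"
  shows "M_inv k n = 0"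
proof
  fix f show "M_inv k n f = 0 f"
  proof (cases "f \<in> sym_power s n")
    case True
    from P_preimage_homog[OF True] obtain q where
      q: "q \<in> polys s" "P q = homog s n f" "\<forall>k>n. tcomp k q = 0" by blast
    from P_inv_P[OF q(1)] q show ?thesis using assms True by (simp add: M_inv_def)
  next
    case False
    then show ?thesis using lin_maps_outside[OF M_inv_lin] by simp
  qed
qed

lemma tcomp_P_inv: "f \<in> sym_power s n \<Longrightarrow> tcomp k (P_inv (homog s n f)) = M_inv k n f"
  by (simp add: M_inv_def)

lemma P_inv_homog:
  assumes f: "f \<in> sym_power s n"
  shows "P_inv (homog s n f) = (\<Sum>k\<le>n. homog s k (M_inv k n f))"
proof -
  have "tcomp k (P_inv (homog s n f)) = 0" if "n < k" for k
    using M_inv_above[OF that] tcomp_P_inv[OF f, of k] by simp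
  from poly_eq_sum_tcomp_upto[OF P_inv_in_polys[OF homog_in_polys[OF f]] this]
  show ?thesis using f by (simp add: M_inv_def)
qed

lemma M_M_inv:
  assumes f: "f \<in> sym_power s n"
  shows "(\<Sum>k\<le>n. M j k (M_inv k n f)) = (if j = n then f else 0)"
proof -
  note N = lin_maps_in[OF M_inv_lin f]
  have "(\<Sum>k\<le>n. M j k (M_inv k n f)) = (\<Sum>k\<le>n. tcomp j (P (homog s k (M_inv k n f))))"
    by (simp add: tcomp_P N)
  also have "\<dots> = tcomp j (\<Sum>k\<le>n. P (homog s k (M_inv k n f)))"
    by (rule lin_maps_sum[OF tcomp_lin form.vector_space_axioms subspace_polys, symmetric]) (simp add: N)
  also have "(\<Sum>k\<le>n. P (homog s k (M_inv k n f))) = P (P_inv (homog s n f))"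
    by (simp add: P_inv_homog[OF f] P_sum N)
  also have "\<dots> = homog s n f" using f by (simp add: P_P_inv)
  finally show ?thesis by (simp only: tcomp_homog[OF f] eq_commute[of n j])
qed

lemma M_inv_M:
  assumes f: "f \<in> sym_power s n"
  shows "(\<Sum>k\<le>n. M_inv j k (M k n f)) = (if j = n then f else 0)"
proof -
  have "(\<Sum>k\<le>n. M_inv j k (M k n f)) = (\<Sum>k\<le>n. tcomp j (P_inv (homog s k (M k n f))))"
    using f by (simp add: M_inv_def)
  also have "\<dots> = tcomp j (\<Sum>k\<le>n. P_inv (homog s k (M k n f)))"
    using f by (intro lin_maps_sum[OF tcomp_lin form.vector_space_axioms subspace_polys, symmetric]) simp
  also have "(\<Sum>k\<le>n. P_inv (homog s k (M k n f))) = P_inv (\<Sum>k\<le>n. homog s k (M k n f))"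
    using f by (intro lin_maps_sum[OF P_inv_lin form.vector_space_axioms subspace_polys, symmetric]) simp
  also have "\<dots> = homog s n f" using f by (simp add: P_homog[symmetric] P_inv_P)
  finally show ?thesis by (simp only: tcomp_homog[OF f] eq_commute[of n j])
qed

text \<open>
  Everything proved for \<open>P\<close> thereby applies to its inverse.
\<close>

lemma inverse_normalized_operator: "normalized_operator s P_inv M_inv"
proof unfold_locales
  have single: "(\<Sum>k\<le>n. x k) = x n" if "\<And>k. k < n \<Longrightarrow> x k = 0" for n :: nat and x :: "nat \<Rightarrow> ('v, 'k) tensor"
    using that by (simp add: lessThan_Suc_atMost[symmetric])
  have "bij_betw (M_inv n n) (sym_power s n) (sym_power s n)" for n
  proof (rule bij_betw_byWitness[where f' = "M n n"])
    show "\<forall>f\<in>sym_power s n. M n n (M_inv n n f) = f"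
      using M_M_inv[of _ n n] by (simp add: single M_above)
    show "\<forall>f\<in>sym_power s n. M_inv n n (M n n f) = f"
      using M_inv_M[of _ n n] by (simp add: single M_inv_above)
  qed (use lin_maps_in[OF M_inv_lin] in auto)
  then show "poly_operator s P_inv M_inv"
    by (simp add: poly_operator_def P_inv_lin M_inv_lin M_inv_above P_inv_homog)
  have lin: "poly_seq s P_inv n \<omega> \<in> sym_maps n" for n \<omega>
    unfolding poly_seq_def
    by (rule lin_maps_restrictI)
      (simp_all add: form.vector_space_axioms homog_add homog_scale lin_maps_add[OF P_inv_lin]
        lin_maps_scale[OF P_inv_lin])
  show "poly_seq s P_inv 0 \<omega> = unit_functional s" if "\<omega> \<in> dual_space s" for \<omega>
  proof (rule sym_power_maps_eqI[OF lin unit_functional_lin])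
    show "poly_seq s P_inv 0 \<omega> (tpow s v 0) = unit_functional s (tpow s v 0)" for v
      using that P_inv_P[of "ppow 0 v"] by (simp add: poly_seq_def P_ppow_0 unit_functional_tpow pow_poly_apply)
  qed
  show "poly_seq s P_inv n 0 = 0" if "n \<ge> 1" for n
  proof
    show "poly_seq s P_inv n 0 f = 0 f" for f
    proof (cases "f \<in> sym_power s n")
      case True
      have "P_inv (homog s n f) 0 = homog s n f 0"
        using P_at_0[of "P_inv (homog s n f)"] True by (simp add: P_P_inv)
      also have "\<dots> = 0" using True
      proof (induction rule: sym_power_induct)
        case zero
        have "homog s n 0 0 = 0" by simp
        then show ?case .
      next
        case (step c v f)
        have "homog s n f 0 = 0" by (rule step(2))
        then have "homog s n (pscale (*) c (tpow s v n) + f) 0 = 0"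
          using that by (simp add: homog_add homog_scale pow_poly_apply)
        then show ?case .
      qed
      finally show ?thesis using True by (simp add: poly_seq_def)
    qed (simp add: poly_seq_def)
  qed
qed


subsection \<open>Lowering operators\<close>

lemma polys_eq_span_P: "polys s = form.span (range (\<lambda>(n, v). P (ppow n v)))"
proof
  let ?G = "range (\<lambda>(n, v). P (ppow n v))"
  have "P q \<in> form.span ?G" if "q \<in> polys s" for q
    using that
  proof (induction rule: polys_induct)
    case zero
    have "P 0 \<in> form.span ?G" unfolding lin_maps_zero[OF P_lin] by (rule form.span_zero)
    then show ?case .
  next
    case (step c n v p)
    have "P (ppow n v) \<in> ?G" by (rule image_eqI[of _ _ "(n, v)"]) auto
    from form.span_add[OF form.span_scale[OF form.span_base[OF this]] step(2), of c]
    have "P (pscale (*) c (ppow n v) + p) \<in> form.span ?G"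
      using step(1) lin_maps_add[OF P_lin polys_scale[OF homog_in_polys[OF tpow_in_sym_power]]]
      by (simp add: lin_maps_scale[OF P_lin])
    then show ?case .
  qed
  note * = this
  show "polys s \<subseteq> form.span ?G"
  proof
    fix p assume "p \<in> polys s"
    from *[OF P_inv_in_polys[OF this]] P_P_inv[OF this] show "p \<in> form.span ?G" by (simp only:)
  qed
  show "form.span ?G \<subseteq> polys s"
    by (rule form.span_minimal) auto
qed

lemma P_maps_eqI:
  assumes "S \<in> lin_maps (pscale (*)) (polys s) sw W"
    "T \<in> lin_maps (pscale (*)) (polys s) sw W'"
    and "\<And>n v. S (P (ppow n v)) = T (P (ppow n v))"
  shows "S = T"
  using lin_maps_eqI_span[OF assms(1,2) form.vector_space_axioms polys_eq_span_P] assms(3)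
  by (simp add: case_prod_beta)

lemma lowering_op_eq:
  assumes "\<theta> \<in> dual_space s"
  shows "lowering_op s P \<theta> = (\<lambda>p. P (poly_deriv \<theta> (P_inv p)))"
proof
  show "lowering_op s P \<theta> p = P (poly_deriv \<theta> (P_inv p))" for p
  proof (cases "p \<in> polys s")
    case True
    then show ?thesis
      using P_inv_in_polys[OF True] by (simp add: lowering_op_def poly_deriv_def P_inv_def)
  next
    case False
    then show ?thesis
      by (simp add: lowering_op_def P_inv_def lin_maps_zero[OF poly_deriv_lin[OF assms]] lin_maps_zero[OF P_lin])
  qed
qed

lemma lowering_op_lin:
  assumes "\<theta> \<in> dual_space s"
  shows "lowering_op s P \<theta> \<in> lin_maps (pscale (*)) (polys s) (pscale (*)) (polys s)"
  unfolding lowering_op_eq[OF assms]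
  by (rule lin_maps_comp[OF P_lin lin_maps_comp[OF poly_deriv_lin[OF assms] P_inv_lin]])

lemma lowering_op_P_ppow:
  assumes "\<theta> \<in> dual_space s"
  shows "lowering_op s P \<theta> (P (ppow n v)) = pscale (*) (of_nat n * \<theta> v) (P (ppow (n - 1) v))"
  by (simp add: lowering_op_eq assms P_inv_P poly_deriv_pow lin_maps_scale[OF P_lin])

text \<open>
  Functionals \<open>\<theta>\<close> and points \<open>\<omega>\<close> separate the vector-valued polynomials, and composing the
  prescribed map with them gives the lowering operator of \<open>\<theta>\<close>, evaluated at \<open>\<omega>\<close>, which is linear.
\<close>

lemma lowering_diff_exists:
  "\<exists>Q\<in>lin_maps (pscale (*)) (polys s) (pscale s) (vec_polys s s UNIV).
    \<forall>n v. Q (P (ppow n v)) = (\<lambda>\<omega>. s (of_nat n * P (ppow (n - 1) v) \<omega>) v)"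
proof -
  define \<phi> where "\<phi> = (\<lambda>(n, v) \<omega>. s (of_nat n * P (ppow (n - 1) v) \<omega>) v)"
  have "\<exists>Q\<in>lin_maps (pscale (*)) (polys s) (pscale s) (vec_polys s s UNIV).
      \<forall>i. Q ((\<lambda>(n, v). P (ppow n v)) i) = \<phi> i"
  proof (rule linear_extension[where \<tau> = "\<lambda>(\<theta>, \<omega>) q. \<theta> (q \<omega>)" and S = "dual_space s \<times> UNIV"])
    show "\<phi> i \<in> vec_polys s s UNIV" for i
    proof (cases i)
      case (Pair n v)
      have "(\<lambda>\<omega>. s ((pscale (*) (of_nat n) (P (ppow (n - 1) v))) \<omega>) v) \<in> vec_polys s s UNIV"
        by (intro vec_polys_base vector_space_axioms polys_scale P_in_polys homog_in_polys tpow_in_sym_power UNIV_I)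
      then show ?thesis by (simp add: Pair \<phi>_def)
    qed
    show "w = 0" if "\<And>t. t \<in> dual_space s \<times> UNIV \<Longrightarrow> (\<lambda>(\<theta>, \<omega>) q. \<theta> (q \<omega>)) t w = 0"
      for w :: "('v \<Rightarrow> 'k) \<Rightarrow> 'v"
    proof
      show "w \<omega> = 0 \<omega>" for \<omega>
        using dual_separates[of "w \<omega>"] that by auto
    qed
    fix t :: "('v \<Rightarrow> 'k) \<times> ('v \<Rightarrow> 'k)"
    assume "t \<in> dual_space s \<times> UNIV"
    then obtain \<theta> \<omega> where t: "t = (\<theta>, \<omega>)" and \<theta>: "\<theta> \<in> dual_space s" by auto
    show "\<exists>T\<in>lin_maps (pscale (*)) (polys s) (*) UNIV.
        \<forall>i. T ((\<lambda>(n, v). P (ppow n v)) i) = (\<lambda>(\<theta>, \<omega>) q. \<theta> (q \<omega>)) t (\<phi> i)"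
      by (intro bexI[OF _ lin_maps_eval[OF lowering_op_lin[OF \<theta>], of \<omega>]])
        (auto simp: t \<phi>_def lowering_op_P_ppow \<theta> dual_scale)
  qed (auto simp: polys_eq_span_P[symmetric] form.vector_space_axioms vector_space_pscale vector_space_axioms
      subspace_vec_polys dual_add dual_scale)
  then obtain Q where Q: "Q \<in> lin_maps (pscale (*)) (polys s) (pscale s) (vec_polys s s UNIV)"
    "\<And>i. Q ((\<lambda>(n, v). P (ppow n v)) i) = \<phi> i" by blast
  show ?thesis
    by (intro bexI[OF _ Q(1)] allI) (use Q(2)[of "(_, _)"] in \<open>simp add: \<phi>_def\<close>)
qed

lemma lowering_diff_lin:
    "lowering_diff s P \<in> lin_maps (pscale (*)) (polys s) (pscale s) (vec_polys s s UNIV)" (is ?lin)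
  and lowering_diff_P_ppow:
    "lowering_diff s P (P (ppow n v)) = (\<lambda>\<omega>. s (of_nat n * P (ppow (n - 1) v) \<omega>) v)" (is ?eq)
  and dual_lowering_diff:
    "\<theta> \<in> dual_space s \<Longrightarrow> \<theta> (lowering_diff s P p \<omega>) = lowering_op s P \<theta> p \<omega>"
proof -
  obtain Q where Q: "Q \<in> lin_maps (pscale (*)) (polys s) (pscale s) (vec_polys s s UNIV)"
    "\<And>n v. Q (P (ppow n v)) = (\<lambda>\<omega>. s (of_nat n * P (ppow (n - 1) v) \<omega>) v)"
    using lowering_diff_exists by blast
  have dual_Q: "\<theta> (Q p \<omega>) = lowering_op s P \<theta> p \<omega>" if \<theta>: "\<theta> \<in> dual_space s" for \<theta> p \<omega>
  proof -
    have "(\<lambda>p. \<theta> (Q p \<omega>)) = (\<lambda>p. lowering_op s P \<theta> p \<omega>)"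
    proof (rule P_maps_eqI)
      show "(\<lambda>p. \<theta> (Q p \<omega>)) \<in> lin_maps (pscale (*)) (polys s) (*) UNIV"
        using Q(1) \<theta> by (auto simp: lin_maps_def dual_add dual_scale dual_0)
      show "(\<lambda>p. lowering_op s P \<theta> p \<omega>) \<in> lin_maps (pscale (*)) (polys s) (*) UNIV"
        by (rule lin_maps_eval[OF lowering_op_lin[OF \<theta>]])
    qed (simp add: Q(2) lowering_op_P_ppow \<theta> dual_scale)
    then show ?thesis by (simp add: fun_eq_iff)
  qed
  have "lowering_diff s P = Q"
    unfolding lowering_diff_def
  proof (rule the_equality)
    fix R assume R: "R \<in> lin_maps (pscale (*)) (polys s) (pscale s) (vec_polys s s UNIV) \<and>
      (\<forall>p\<in>polys s. \<forall>\<theta>\<in>dual_space s. \<forall>\<omega>\<in>dual_space s. \<theta> (R p \<omega>) = lowering_op s P \<theta> p \<omega>)"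
    then have R_lin: "R \<in> lin_maps (pscale (*)) (polys s) (pscale s) (vec_polys s s UNIV)" by blast
    show "R = Q"
    proof (rule lin_maps_eqI[OF R_lin Q(1)], rule ext)
      fix p \<omega> assume p: "p \<in> polys s"
      show "R p \<omega> = Q p \<omega>"
      proof (cases "\<omega> \<in> dual_space s")
        case True
        then show ?thesis using R p dual_Q by (intro dual_eqI) auto
      next
        case False
        then show ?thesis
          using vec_polys_values(2)[OF vector_space_axioms subspace_UNIV lin_maps_in[OF R_lin p]]
            vec_polys_values(2)[OF vector_space_axioms subspace_UNIV lin_maps_in[OF Q(1) p]] by simp
      qed
    qed
  qed (use Q(1) dual_Q in auto)
  with Q dual_Q show ?lin ?eq "\<theta> \<in> dual_space s \<Longrightarrow> \<theta> (lowering_diff s P p \<omega>) = lowering_op s P \<theta> p \<omega>"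
    by auto
qed

lemma vec_shift_invariant_iff:
  "vec_shift_invariant s (lowering_diff s P) \<longleftrightarrow>
    (\<forall>\<theta>\<in>dual_space s. shift_invariant s (lowering_op s P \<theta>))"
proof -
  have "vec_shift_invariant s (lowering_diff s P) \<longleftrightarrow>
    (\<forall>\<theta>\<in>dual_space s. \<forall>p\<in>polys s. \<forall>\<omega>\<in>dual_space s. \<forall>\<eta>\<in>dual_space s.
      lowering_op s P \<theta> (shift_op s \<eta> p) \<omega> = lowering_op s P \<theta> p (\<omega> + \<eta>))"
    using lowering_diff_lin unfolding vec_shift_invariant_def
    by (auto simp: dual_lowering_diff[symmetric] intro!: dual_eqI)
  also have "\<dots> \<longleftrightarrow> (\<forall>\<theta>\<in>dual_space s. shift_invariant s (lowering_op s P \<theta>))"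
    unfolding shift_invariant_def
  proof (intro ball_cong refl)
    fix \<theta> assume \<theta>: "\<theta> \<in> dual_space s"
    have "lowering_op s P \<theta> (shift_op s \<eta> p) = shift_op s \<eta> (lowering_op s P \<theta> p) \<longleftrightarrow>
      (\<forall>\<omega>\<in>dual_space s. lowering_op s P \<theta> (shift_op s \<eta> p) \<omega> = lowering_op s P \<theta> p (\<omega> + \<eta>))"
      if "p \<in> polys s" "\<eta> \<in> dual_space s" for p \<eta>
      using that polys_outside[OF lin_maps_in[OF lowering_op_lin[OF \<theta>] shift_op_in_polys]]
      by (auto simp: fun_eq_iff shift_op_def)
    then show "(\<forall>p\<in>polys s. \<forall>\<omega>\<in>dual_space s. \<forall>\<eta>\<in>dual_space s.
        lowering_op s P \<theta> (shift_op s \<eta> p) \<omega> = lowering_op s P \<theta> p (\<omega> + \<eta>)) \<longleftrightarrow>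
      lowering_op s P \<theta> \<in> lin_maps (pscale (*)) (polys s) (pscale (*)) (polys s) \<and>
        (\<forall>\<eta>\<in>dual_space s. \<forall>p\<in>polys s. lowering_op s P \<theta> (shift_op s \<eta> p) = shift_op s \<eta> (lowering_op s P \<theta> p))"
      using lowering_op_lin[OF \<theta>] by blast
  qed
  finally show ?thesis .
qed

section \<open>Convolution operators\<close>

text \<open>
  In terms of the exponential generating function of the \<open>P (ppow n v)\<close>, such an operator multiplies by the
  exponential generating function of the scalars \<open>a k v\<close>.
\<close>

definition convolution_op where
  "convolution_op T a \<longleftrightarrow> T \<in> lin_maps (pscale (*)) (polys s) (pscale (*)) (polys s) \<and>
    (\<forall>n v. T (P (ppow n v)) = (\<Sum>k\<le>n. pscale (*) (of_nat (n choose k) * a k v) (P (ppow (n - k) v))))"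

lemma convolution_ops_commute:
  assumes S: "convolution_op S a" and T: "convolution_op T b" and p: "p \<in> polys s"
  shows "S (T p) = T (S p)"
proof -
  have S_lin: "S \<in> lin_maps (pscale (*)) (polys s) (pscale (*)) (polys s)" and
    T_lin: "T \<in> lin_maps (pscale (*)) (polys s) (pscale (*)) (polys s)"
    using S T by (auto simp: convolution_op_def)
  have comp: "U (V (P (ppow n v))) \<omega> = (\<Sum>i\<le>n. \<Sum>j\<le>n.
      of_nat ((n choose i) * (n - i choose j)) * d i v * c j v * P (ppow (n - i - j) v) \<omega>)"
    if U: "convolution_op U c" and V: "convolution_op V d" for U V c d n v \<omega>
  proof -
    have U_lin: "U \<in> lin_maps (pscale (*)) (polys s) (pscale (*)) (polys s)"
      using U by (auto simp: convolution_op_def)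
    have "V (P (ppow n v)) = (\<Sum>k\<le>n. pscale (*) (of_nat (n choose k) * d k v) (P (ppow (n - k) v)))"
      using V by (auto simp: convolution_op_def)
    then have "U (V (P (ppow n v))) = (\<Sum>k\<le>n. U (pscale (*) (of_nat (n choose k) * d k v) (P (ppow (n - k) v))))"
      using lin_maps_sum[OF U_lin form.vector_space_axioms subspace_polys,
          of "{..n}" "\<lambda>k. pscale (*) (of_nat (n choose k) * d k v) (P (ppow (n - k) v))"] by simp
    also have "\<dots> = (\<Sum>k\<le>n. pscale (*) (of_nat (n choose k) * d k v) (U (P (ppow (n - k) v))))"
      by (intro sum.cong refl lin_maps_scale[OF U_lin]) simp
    finally have "U (V (P (ppow n v))) \<omega> =
        (\<Sum>i\<le>n. of_nat (n choose i) * d i v * U (P (ppow (n - i) v)) \<omega>)" by simp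
    also have "\<dots> = (\<Sum>i\<le>n. \<Sum>j\<le>n.
      of_nat ((n choose i) * (n - i choose j)) * d i v * c j v * P (ppow (n - i - j) v) \<omega>)"
    proof (intro sum.cong refl)
      fix i assume "i \<in> {..n}"
      have "U (P (ppow (n - i) v)) \<omega> =
          (\<Sum>j\<le>n - i. of_nat (n - i choose j) * c j v * P (ppow (n - i - j) v) \<omega>)"
        using U by (simp add: convolution_op_def)
      also have "\<dots> = (\<Sum>j\<le>n. of_nat (n - i choose j) * c j v * P (ppow (n - i - j) v) \<omega>)"
        by (intro sum.mono_neutral_left) (auto simp: binomial_eq_0)
      finally show "of_nat (n choose i) * d i v * U (P (ppow (n - i) v)) \<omega> =
         (\<Sum>j\<le>n. of_nat ((n choose i) * (n - i choose j)) * d i v * c j v * P (ppow (n - i - j) v) \<omega>)"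
        by (simp add: sum_distrib_left algebra_simps)
    qed
    finally show ?thesis .
  qed
  \<comment> \<open>both sides vanish for \<open>i + j > n\<close>, so the sums over \<open>i\<close> and \<open>j\<close> can be exchanged\<close>
  have trinomial: "(n choose i) * (n - i choose j) = (n choose j) * (n - j choose i)"
    if "i \<le> n" "j \<le> n" for i j n
  proof (cases "i + j \<le> n")
    case True
    then show ?thesis
      using choose_mult[of i "i + j" n] choose_mult[of j "i + j" n] binomial_symmetric[of i "i + j"]
      by (simp add: mult.commute)
  next
    case False
    with that have "n - i < j" "n - j < i" by auto
    then show ?thesis by (simp add: binomial_eq_0)
  qed
  have "(\<lambda>p. S (T p)) = (\<lambda>p. T (S p))"
  proof (rule P_maps_eqI[OF lin_maps_comp[OF S_lin T_lin] lin_maps_comp[OF T_lin S_lin]], rule ext)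
    fix n v \<omega>
    have "S (T (P (ppow n v))) \<omega> = (\<Sum>i\<le>n. \<Sum>j\<le>n.
      of_nat ((n choose j) * (n - j choose i)) * b i v * a j v * P (ppow (n - j - i) v) \<omega>)"
      unfolding comp[OF S T]
      by (intro sum.cong refl) (simp add: trinomial add.commute diff_commute)
    also have "\<dots> = T (S (P (ppow n v))) \<omega>"
      unfolding comp[OF T S] by (subst sum.swap) (simp add: mult.assoc mult.left_commute)
    finally show "S (T (P (ppow n v))) \<omega> = T (S (P (ppow n v))) \<omega>" .
  qed
  then show ?thesis by (simp add: fun_eq_iff)
qed

lemma lowering_convolution_op:
  assumes "\<theta> \<in> dual_space s"
  shows "convolution_op (lowering_op s P \<theta>) (\<lambda>k v. if k = 1 then \<theta> v else 0)"
  unfolding convolution_op_def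
proof (intro conjI allI lowering_op_lin assms)
  fix n v
  have "(\<Sum>k\<le>n. pscale (*) (of_nat (n choose k) * (if k = 1 then \<theta> v else 0)) (P (ppow (n - k) v))) =
      (\<Sum>k\<le>n. if k = 1 then pscale (*) (of_nat n * \<theta> v) (P (ppow (n - 1) v)) else 0)"
    by (intro sum.cong refl) (simp add: fun_eq_iff)
  also have "\<dots> = pscale (*) (of_nat n * \<theta> v) (P (ppow (n - 1) v))"
    by (cases n) (simp_all add: fun_eq_iff)
  finally show "lowering_op s P \<theta> (P (ppow n v)) =
      (\<Sum>k\<le>n. pscale (*) (of_nat (n choose k) * (if k = 1 then \<theta> v else 0)) (P (ppow (n - k) v)))"
    by (simp only: lowering_op_P_ppow[OF assms])
qed


section \<open>Binomial sequences\<close>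

text \<open>
  The binomial identity as an identity between polynomials, with \<open>\<eta>\<close> as a parameter. It makes the
  shifts convolution operators.
\<close>

definition umbral where
  "umbral \<longleftrightarrow> (\<forall>n v. \<forall>\<eta>\<in>dual_space s. shift_op s \<eta> (P (ppow n v)) =
    (\<Sum>k\<le>n. pscale (*) (of_nat (n choose k) * P (ppow k v) \<eta>) (P (ppow (n - k) v))))"

lemma umbral_shift: "umbral \<Longrightarrow> \<eta> \<in> dual_space s \<Longrightarrow> shift_op s \<eta> (P (ppow n v)) =
    (\<Sum>k\<le>n. pscale (*) (of_nat (n choose k) * P (ppow k v) \<eta>) (P (ppow (n - k) v)))"
  by (simp add: umbral_def)

lemma umbral_convolution_op:
  assumes "umbral" "\<eta> \<in> dual_space s"
  shows "convolution_op (\<lambda>p. if p \<in> polys s then shift_op s \<eta> p else 0) (\<lambda>k v. P (ppow k v) \<eta>)"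
  unfolding convolution_op_def
  using shift_op_lin[OF assms(2)] umbral_shift[OF assms] by simp

lemma shift_0: "\<eta> \<in> dual_space s \<Longrightarrow> shift_op s \<eta> (P (ppow 0 v)) = P (ppow 0 v)"
  by (auto simp: P_ppow_0 shift_op_def fun_eq_iff pow_poly_apply)

lemma binomial_seq_iff_umbral: "binomial_seq s (poly_seq s P) \<longleftrightarrow> umbral"
proof -
  have "binomial_seq s (poly_seq s P) \<longleftrightarrow>
    (\<forall>n\<ge>1. \<forall>\<eta>\<in>dual_space s. \<forall>\<omega>\<in>dual_space s. \<forall>v. P (ppow n v) (\<omega> + \<eta>) =
      (\<Sum>k\<le>n. of_nat (n choose k) * (P (ppow k v) \<eta> * P (ppow (n - k) v) \<omega>)))"
  proof -
    have eq: "poly_seq s P n (\<omega> + \<theta>) = (\<Sum>k\<le>n. pscale (*) (of_nat (n choose k))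
          (odot s k (poly_seq s P k \<omega>) (n - k) (poly_seq s P (n - k) \<theta>))) \<longleftrightarrow>
        (\<forall>v. P (ppow n v) (\<theta> + \<omega>) =
          (\<Sum>k\<le>n. of_nat (n choose k) * (P (ppow k v) \<omega> * P (ppow (n - k) v) \<theta>)))"
      if \<omega>: "\<omega> \<in> dual_space s" and \<theta>: "\<theta> \<in> dual_space s" for n \<omega> \<theta>
    proof -
      let ?R = "\<Sum>k\<le>n. pscale (*) (of_nat (n choose k))
          (odot s k (poly_seq s P k \<omega>) (n - k) (poly_seq s P (n - k) \<theta>))"
      have lin: "odot s k (poly_seq s P k \<omega>) (n - k) (poly_seq s P (n - k) \<theta>) \<in> sym_maps n" and
        val: "odot s k (poly_seq s P k \<omega>) (n - k) (poly_seq s P (n - k) \<theta>) (tpow s v n) =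
          P (ppow k v) \<omega> * P (ppow (n - k) v) \<theta>" if "k \<le> n" for k v
        using odot_lin[OF poly_seq_lin[OF \<omega>] poly_seq_lin[OF \<theta>], of k "n - k"]
          odot_tpow[OF poly_seq_lin[OF \<omega>] poly_seq_lin[OF \<theta>], of k "n - k" v] that
        by (simp_all add: poly_seq_tpow)
      have R_lin: "?R \<in> sym_maps n"
        by (intro lin_maps_sum_maps lin_maps_pscale vector_space_times subspace_UNIV_k lin) simp
      have R_val: "?R (tpow s v n) =
          (\<Sum>k\<le>n. of_nat (n choose k) * (P (ppow k v) \<omega> * P (ppow (n - k) v) \<theta>))" for v
        by (simp add: val)
      have L_lin: "poly_seq s P n (\<omega> + \<theta>) \<in> sym_maps n"
        using \<omega> \<theta> by (intro poly_seq_lin) simp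
      show ?thesis
      proof
        assume "poly_seq s P n (\<omega> + \<theta>) = ?R"
        then have "poly_seq s P n (\<omega> + \<theta>) (tpow s v n) = ?R (tpow s v n)" for v by (simp only:)
        then show "\<forall>v. P (ppow n v) (\<theta> + \<omega>) =
          (\<Sum>k\<le>n. of_nat (n choose k) * (P (ppow k v) \<omega> * P (ppow (n - k) v) \<theta>))"
          unfolding R_val poly_seq_tpow add.commute[of \<theta> \<omega>] by blast
      next
        assume "\<forall>v. P (ppow n v) (\<theta> + \<omega>) =
          (\<Sum>k\<le>n. of_nat (n choose k) * (P (ppow k v) \<omega> * P (ppow (n - k) v) \<theta>))"
        then show "poly_seq s P n (\<omega> + \<theta>) = ?R"
          by (intro sym_power_maps_eqI[OF L_lin R_lin]) (simp only: R_val poly_seq_tpow add.commute[of \<omega> \<theta>])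
      qed
    qed
    show ?thesis
      unfolding binomial_seq_def by (simp add: degree_0 eq cong: ball_cong)
  qed
  also have "\<dots> \<longleftrightarrow> umbral"
    unfolding umbral_def
  proof safe
    fix n v \<eta> assume *: "\<forall>n\<ge>1. \<forall>\<eta>\<in>dual_space s. \<forall>\<omega>\<in>dual_space s. \<forall>v. P (ppow n v) (\<omega> + \<eta>) =
      (\<Sum>k\<le>n. of_nat (n choose k) * (P (ppow k v) \<eta> * P (ppow (n - k) v) \<omega>))" and \<eta>: "\<eta> \<in> dual_space s"
    show "shift_op s \<eta> (P (ppow n v)) =
      (\<Sum>k\<le>n. pscale (*) (of_nat (n choose k) * P (ppow k v) \<eta>) (P (ppow (n - k) v)))"
    proof (cases "n = 0")
      case True
      then show ?thesis
        using shift_0[OF \<eta>, of v] \<eta> by (simp add: P_ppow_0 pow_poly_apply)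
    next
      case False
      show ?thesis
      proof (rule ext)
        fix \<omega>
        show "shift_op s \<eta> (P (ppow n v)) \<omega> =
          (\<Sum>k\<le>n. pscale (*) (of_nat (n choose k) * P (ppow k v) \<eta>) (P (ppow (n - k) v))) \<omega>"
          using * \<eta> False by (cases "\<omega> \<in> dual_space s") (simp_all add: shift_op_def mult.assoc polys_outside)
      qed
    qed
  next
    fix n \<eta> \<omega> v
    assume "\<forall>n v. \<forall>\<eta>\<in>dual_space s. shift_op s \<eta> (P (ppow n v)) =
      (\<Sum>k\<le>n. pscale (*) (of_nat (n choose k) * P (ppow k v) \<eta>) (P (ppow (n - k) v)))"
      and \<eta>: "\<eta> \<in> dual_space s" and \<omega>: "\<omega> \<in> dual_space s"
    then have "shift_op s \<eta> (P (ppow n v)) \<omega> =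
      (\<Sum>k\<le>n. pscale (*) (of_nat (n choose k) * P (ppow k v) \<eta>) (P (ppow (n - k) v))) \<omega>" by simp
    with \<omega> show "P (ppow n v) (\<omega> + \<eta>) =
      (\<Sum>k\<le>n. of_nat (n choose k) * (P (ppow k v) \<eta> * P (ppow (n - k) v) \<omega>))"
      by (simp add: shift_op_def mult.assoc)
  qed
  finally show ?thesis .
qed

lemma umbral_imp_shift_invariant:
  assumes "umbral" "\<theta> \<in> dual_space s"
  shows "shift_invariant s (lowering_op s P \<theta>)"
  unfolding shift_invariant_def
proof (intro conjI ballI lowering_op_lin assms(2))
  fix \<eta> p assume \<eta>: "\<eta> \<in> dual_space s" and p: "p \<in> polys s"
  from convolution_ops_commute[OF lowering_convolution_op[OF assms(2)] umbral_convolution_op[OF assms(1) \<eta>] p]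
  show "lowering_op s P \<theta> (shift_op s \<eta> p) = shift_op s \<eta> (lowering_op s P \<theta> p)"
    using p lin_maps_in[OF lowering_op_lin[OF assms(2)] p] by simp
qed

text \<open>
  The inverse image of \<open>p\<close> under \<open>P\<close> has all directional derivatives zero, so it is constant, and its
  value at 0 is that of \<open>p\<close>.
\<close>

lemma lowering_kernel:
  assumes p: "p \<in> polys s" and "p 0 = 0"
    and low: "\<And>\<theta>. \<theta> \<in> dual_space s \<Longrightarrow> lowering_op s P \<theta> p = 0"
  shows "p = 0"
proof -
  define r where "r = P_inv p"
  have r: "r \<in> polys s" using p by (simp add: r_def)
  have deriv: "poly_deriv \<theta> r = 0" if "\<theta> \<in> dual_space s" for \<theta>
    using low[OF that] lin_maps_in[OF poly_deriv_lin[OF that] r]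
    by - (rule P_eq_0, simp_all add: lowering_op_eq[OF that] r_def)
  have "tcomp k r = 0" for k
  proof (rule sym_power_eqI[OF lin_maps_in[OF tcomp_lin r] form.subspace_0[OF subspace_sym_power]])
    fix \<theta> assume \<theta>: "\<theta> \<in> dual_space s"
    have "mderiv (replicate k \<theta>) r 0 = 0"
    proof (cases k)
      case 0
      have "r 0 = 0" using P_at_0[OF r] P_P_inv[OF p] \<open>p 0 = 0\<close> by (simp add: r_def)
      then show ?thesis using 0 r by simp
    next
      case (Suc j)
      have "set (replicate j \<theta>) \<subseteq> dual_space s" using \<theta> by auto
      then show ?thesis
        using Suc mderiv_replicate_Suc[OF \<theta>, of j r] deriv[OF \<theta>] lin_maps_zero[OF mderiv_lin]
        by simp
    qed
    then show "tcomp k r (replicate k \<theta>) = 0 (replicate k \<theta>)"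
      using tcomp_diag[OF \<theta>, of k r] \<theta> by (simp add: homog_in_dual)
  qed
  then have "r = 0"
    by (intro poly_eqI_tcomp[OF r polys_zero]) (simp add: lin_maps_zero[OF tcomp_lin])
  then show ?thesis
    using P_P_inv[OF p] lin_maps_zero[OF P_lin] by (simp add: r_def)
qed

text \<open>
  Let \<open>R n\<close> be the right-hand side of the umbral identity. A lowering operator takes \<open>R n\<close> to
  \<open>n \<theta>(v) R (n - 1)\<close>, and, being shift-invariant, it acts in the same way on the left-hand side. By
  induction the difference is annihilated by all lowering operators; its value at 0 is zero.
\<close>

lemma shift_invariant_imp_umbral:
  assumes inv: "\<And>\<theta>. \<theta> \<in> dual_space s \<Longrightarrow> shift_invariant s (lowering_op s P \<theta>)"
  shows umbral
  unfolding umbral_def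
proof (intro allI ballI)
  fix n v \<eta> assume \<eta>: "\<eta> \<in> dual_space s"
  define R where "R n = (\<Sum>k\<le>n. pscale (*) (of_nat (n choose k) * P (ppow k v) \<eta>) (P (ppow (n - k) v)))" for n
  have R_polys: "R n \<in> polys s" for n unfolding R_def by (intro polys_sum polys_scale) simp
  have R_low: "lowering_op s P \<theta> (R n) = pscale (*) (of_nat n * \<theta> v) (R (n - 1))"
    if \<theta>: "\<theta> \<in> dual_space s" for \<theta> n
  proof (cases n)
    case 0
    then show ?thesis
      by (simp add: R_def lin_maps_scale[OF lowering_op_lin[OF \<theta>]] lowering_op_P_ppow[OF \<theta>] fun_eq_iff)
  next
    case (Suc m)
    have "lowering_op s P \<theta> (R n) = (\<Sum>k\<le>n. lowering_op s P \<theta>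
        (pscale (*) (of_nat (n choose k) * P (ppow k v) \<eta>) (P (ppow (n - k) v))))"
      unfolding R_def
      by (intro lin_maps_sum[OF lowering_op_lin[OF \<theta>] form.vector_space_axioms subspace_polys]) simp
    also have "\<dots> = (\<Sum>k\<le>n. pscale (*) (of_nat n * \<theta> v)
        (pscale (*) (of_nat (n - 1 choose k) * P (ppow k v) \<eta>) (P (ppow (n - 1 - k) v))))"
    proof (intro sum.cong refl)
      fix k assume "k \<in> {..n}"
      have "of_nat (n choose k) * of_nat (n - k) = (of_nat n * of_nat (n - 1 choose k) :: 'k)"
        using binomial_absorb_comp[of n k] by (metis mult.commute of_nat_mult)
      then show "lowering_op s P \<theta> (pscale (*) (of_nat (n choose k) * P (ppow k v) \<eta>) (P (ppow (n - k) v))) =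
        pscale (*) (of_nat n * \<theta> v)
        (pscale (*) (of_nat (n - 1 choose k) * P (ppow k v) \<eta>) (P (ppow (n - 1 - k) v)))"
        by (subst lin_maps_scale[OF lowering_op_lin[OF \<theta>]])
          (simp_all add: lowering_op_P_ppow[OF \<theta>] fun_eq_iff mult.assoc mult.left_commute diff_right_commute)
    qed
    also have "\<dots> = pscale (*) (of_nat n * \<theta> v) (\<Sum>k\<le>n.
        pscale (*) (of_nat (n - 1 choose k) * P (ppow k v) \<eta>) (P (ppow (n - 1 - k) v)))"
      by (rule form.scale_sum_right[symmetric])
    also have "(\<Sum>k\<le>n. pscale (*) (of_nat (n - 1 choose k) * P (ppow k v) \<eta>) (P (ppow (n - 1 - k) v))) = R (n - 1)"
      unfolding R_def using Suc by (intro sum.mono_neutral_right) (auto simp: fun_eq_iff)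
    finally show ?thesis .
  qed
  have R_0: "R n 0 = P (ppow n v) \<eta>" for n
  proof -
    have "R n 0 = (\<Sum>k\<le>n. if k = n then P (ppow n v) \<eta> else 0)"
      unfolding R_def sum_fun_apply by (intro sum.cong refl) (simp add: P_ppow_at_0)
    then show ?thesis by simp
  qed
  have "shift_op s \<eta> (P (ppow n v)) = R n" for n
  proof (induction n)
    case 0
    show ?case unfolding shift_0[OF \<eta>] using \<eta> by (simp add: R_def fun_eq_iff P_ppow_0 pow_poly_apply)
  next
    case (Suc n)
    have IH: "shift_op s \<eta> (P (ppow n v)) = R n" by (rule Suc)
    let ?d = "shift_op s \<eta> (P (ppow (Suc n) v)) - R (Suc n)"
    have E: "shift_op s \<eta> (P (ppow m v)) \<in> polys s" for m using \<eta> by simp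
    have "?d = 0"
    proof (rule lowering_kernel)
      show d: "?d \<in> polys s" by (rule polys_diff[OF E R_polys])
      show "?d 0 = 0" by (simp add: R_0 shift_op_def)
      fix \<theta> assume \<theta>: "\<theta> \<in> dual_space s"
      have "lowering_op s P \<theta> (shift_op s \<eta> (P (ppow (Suc n) v))) =
          shift_op s \<eta> (lowering_op s P \<theta> (P (ppow (Suc n) v)))"
        using inv[OF \<theta>] \<eta> by (simp add: shift_invariant_def)
      also have "\<dots> = pscale (*) (of_nat (Suc n) * \<theta> v) (R n)"
        unfolding lowering_op_P_ppow[OF \<theta>] shift_op_scale using IH by (simp only: diff_Suc_1)
      also have "\<dots> = lowering_op s P \<theta> (R (Suc n))"
        unfolding R_low[OF \<theta>] diff_Suc_1 ..
      finally show "lowering_op s P \<theta> ?d = 0"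
        using lin_maps_add[OF lowering_op_lin[OF \<theta>] d R_polys[of "Suc n"]] by simp
    qed
    then show ?case by simp
  qed
  then show "shift_op s \<eta> (P (ppow n v)) =
      (\<Sum>k\<le>n. pscale (*) (of_nat (n choose k) * P (ppow k v) \<eta>) (P (ppow (n - k) v)))"
    by (simp add: R_def)
qed

text \<open>
  The components of degree \<open>k\<close> of the umbral expansion of the shift by \<open>\<omega>\<close>, by Taylor's formula.
\<close>

lemma Dpow_P:
  assumes umbral and \<omega>: "\<omega> \<in> dual_space s"
  shows "Dpow s k (P (ppow n v)) \<omega> = (\<Sum>j\<le>n. pscale (*)
    (of_nat (n choose j) * P (ppow j v) \<omega> * fact k) (M k (n - j) (tpow s v (n - j))))"
proof -
  have "Dpow s k (P (ppow n v)) \<omega> = pscale (*) (fact k) (tcomp k (shift_op s \<omega> (P (ppow n v))))"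
    by (rule Dpow_eq_tcomp_shift[OF \<omega>]) simp
  also have "tcomp k (shift_op s \<omega> (P (ppow n v))) = (\<Sum>j\<le>n. tcomp k
      (pscale (*) (of_nat (n choose j) * P (ppow j v) \<omega>) (P (ppow (n - j) v))))"
    unfolding umbral_shift[OF assms]
    by (rule lin_maps_sum[OF tcomp_lin form.vector_space_axioms subspace_polys]) simp
  also have "\<dots> = (\<Sum>j\<le>n. pscale (*) (of_nat (n choose j) * P (ppow j v) \<omega>) (M k (n - j) (tpow s v (n - j))))"
    by (intro sum.cong refl) (simp add: lin_maps_scale[OF tcomp_lin] tcomp_P)
  finally show ?thesis
    by (simp add: fun_eq_iff sum_distrib_left mult.assoc mult.left_commute)
qed

lemma poly_deriv_convolution_op:
  assumes umbral and \<theta>: "\<theta> \<in> dual_space s"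
  shows "convolution_op (poly_deriv \<theta>) (\<lambda>k v. M 1 k (tpow s v k) [\<theta>])"
  unfolding convolution_op_def
proof (intro conjI allI poly_deriv_lin[OF \<theta>] ext)
  fix n v \<omega>
  show "poly_deriv \<theta> (P (ppow n v)) \<omega> = (\<Sum>k\<le>n. pscale (*)
    (of_nat (n choose k) * M 1 k (tpow s v k) [\<theta>]) (P (ppow (n - k) v))) \<omega>"
  proof (cases "\<omega> \<in> dual_space s")
    case False
    then show ?thesis
      by (simp add: polys_outside lin_maps_in[OF poly_deriv_lin[OF \<theta>]])
  next
    case True
    have "poly_deriv \<theta> (P (ppow n v)) \<omega> = Dpow s 1 (P (ppow n v)) \<omega> [\<theta>]"
      using \<theta> by (subst Dpow_eq_mderiv) simp_all
    also have "\<dots> = (\<Sum>j\<le>n. of_nat (n choose j) * P (ppow j v) \<omega> * M 1 (n - j) (tpow s v (n - j)) [\<theta>])"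
      by (simp add: Dpow_P[OF assms(1) True])
    also have "\<dots> = (\<Sum>k\<le>n. of_nat (n choose k) * P (ppow (n - k) v) \<omega> * M 1 k (tpow s v k) [\<theta>])"
      by (rule sum.reindex_bij_witness[of _ "\<lambda>k. n - k" "\<lambda>k. n - k"])
        (auto simp: binomial_symmetric[symmetric])
    finally show ?thesis by (simp add: mult.assoc mult.commute[of "P _ _"])
  qed
qed

text \<open>
  The Taylor coefficient of order \<open>k + 1\<close> at 0 is reached by one directional derivative followed by \<open>k\<close>
  others; the first of them is a convolution operator.
\<close>

lemma umbral_recurrence:
  assumes umbral and \<theta>: "\<theta> \<in> dual_space s"
  shows "of_nat (Suc k) * M (Suc k) n (tpow s v n) (replicate (Suc k) \<theta>) =
    (\<Sum>j\<le>n. of_nat (n choose j) * M 1 j (tpow s v j) [\<theta>] *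
      M k (n - j) (tpow s v (n - j)) (replicate k \<theta>))"
proof -
  have diag: "mderiv (replicate k \<theta>) (P (ppow n v)) 0 =
      fact k * M k n (tpow s v n) (replicate k \<theta>)" for k n
    using tcomp_diag[OF \<theta>, of k "P (ppow n v)"] by (simp add: tcomp_P homog_in_dual \<theta>)
  have \<theta>s: "set (replicate k \<theta>) \<subseteq> dual_space s" using \<theta> by auto
  note lin = mderiv_lin[OF \<theta>s]
  have "fact (Suc k) * M (Suc k) n (tpow s v n) (replicate (Suc k) \<theta>) =
      mderiv (replicate k \<theta>) (poly_deriv \<theta> (P (ppow n v))) 0"
    unfolding diag[symmetric] by (subst mderiv_replicate_Suc[OF \<theta>]) simp_all
  also have "poly_deriv \<theta> (P (ppow n v)) = (\<Sum>j\<le>n. pscale (*)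
      (of_nat (n choose j) * M 1 j (tpow s v j) [\<theta>]) (P (ppow (n - j) v)))"
    using poly_deriv_convolution_op[OF assms] by (simp add: convolution_op_def)
  also have "mderiv (replicate k \<theta>) \<dots> = (\<Sum>j\<le>n. mderiv (replicate k \<theta>) (pscale (*)
      (of_nat (n choose j) * M 1 j (tpow s v j) [\<theta>]) (P (ppow (n - j) v))))"
    by (rule lin_maps_sum[OF lin form.vector_space_axioms subspace_polys]) simp
  also have "\<dots> 0 = (\<Sum>j\<le>n. of_nat (n choose j) * M 1 j (tpow s v j) [\<theta>] *
      (fact k * M k (n - j) (tpow s v (n - j)) (replicate k \<theta>)))"
    unfolding sum_fun_apply by (intro sum.cong refl) (simp add: lin_maps_scale[OF lin] diag)
  also have "\<dots> = fact k * (\<Sum>j\<le>n. of_nat (n choose j) * M 1 j (tpow s v j) [\<theta>] *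
      M k (n - j) (tpow s v (n - j)) (replicate k \<theta>))"
    by (simp add: sum_distrib_left mult.left_commute)
  finally have "fact k * (of_nat (Suc k) * M (Suc k) n (tpow s v n) (replicate (Suc k) \<theta>)) =
      fact k * (\<Sum>j\<le>n. of_nat (n choose j) * M 1 j (tpow s v j) [\<theta>] *
      M k (n - j) (tpow s v (n - j)) (replicate k \<theta>))"
    by (simp only: fact_Suc mult.assoc mult.left_commute)
  then show ?thesis by simp
qed

section \<open>The generating series\<close>

definition gen_series :: "nat \<Rightarrow> ('v, 'k) tensor \<Rightarrow> 'v" where
  "gen_series n f = s (1 / fact n) (vec_of (M 1 n f))"

lemma gen_series_in_fseries1: "gen_series \<in> fseries1 s"
proof -
  have "pscale s (1 / fact n) (\<lambda>f. vec_of (M 1 n f)) \<in> lin_maps (pscale (*)) (sym_power s n) s UNIV" for n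
    by (rule lin_maps_pscale[OF vector_space_axioms subspace_UNIV lin_maps_comp[OF vec_of_lin M_lin]])
  then have "gen_series n \<in> lin_maps (pscale (*)) (sym_power s n) s UNIV" for n
    by (simp add: gen_series_def[abs_def] pscale_def)
  moreover have "gen_series 0 = 0"
    by (simp add: gen_series_def M_above fun_eq_iff lin_maps_zero[OF vec_of_lin])
  moreover have "bij_betw (vec_of \<circ> (M 1 1 \<circ> (\<lambda>v. tpow s v 1))) UNIV UNIV"
    by (intro bij_betw_trans[OF _ bij_vec_of] bij_betw_trans[OF bij_tpow_1 M_bij])
  then have "bij (\<lambda>v. gen_series 1 (tpow s v 1))"
    by (simp add: gen_series_def o_def)
  ultimately show ?thesis by (simp add: fseries1_def fseries_def)
qed

lemma dual_gen_series:
  assumes "\<omega> \<in> dual_space s"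
  shows "\<omega> (gen_series n (tpow s v n)) = M 1 n (tpow s v n) [\<omega>] / fact n"
  using apply_vec_of[OF M_in_sym_power assms] by (simp add: gen_series_def dual_scale[OF assms])

definition coeff_identity where
  "coeff_identity B \<longleftrightarrow> (\<forall>k\<ge>1. (\<lambda>n. if k \<le> n then pscale (pscale (*)) (fact k / fact n) (M k n) else 0)
             = series_tpow s B k)"

definition exp_identity where
  "exp_identity B \<longleftrightarrow> (\<forall>\<omega>\<in>dual_space s.
     (\<lambda>n. pscale (*) (1 / fact n) (poly_seq s P n \<omega>)) = series_exp s (series_pair \<omega> B))"

lemma coeff_identity_alt:
  "coeff_identity B \<longleftrightarrow>
    (\<forall>k\<ge>1. \<forall>n. series_tpow s B k n = pscale (pscale (*)) (fact k / fact n) (M k n))"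
proof -
  have "(if k \<le> n then pscale (pscale (*)) (fact k / fact n) (M k n) else 0) =
      pscale (pscale (*)) (fact k / fact n) (M k n)" for k n
    using M_above[of n k] by (auto simp: fun_eq_iff)
  then show ?thesis by (auto simp: coeff_identity_def fun_eq_iff)
qed

text \<open>
  The coefficient identity \<open>B5\<close>, tested on tensor powers of vectors and on the diagonal.
\<close>

lemma coeff_identity_iff:
  assumes B: "B \<in> vec_series" "B 0 = 0"
  shows "coeff_identity B \<longleftrightarrow> (\<forall>k n v. \<forall>\<omega>\<in>dual_space s.
    fact k / fact n * M k n (tpow s v n) (replicate k \<omega>) = fps_nth (fps_at (series_pair \<omega> B) v ^ k) n)"
    (is "_ \<longleftrightarrow> ?R")
proof
  assume *: "coeff_identity B"
  show ?R
  proof (intro allI ballI)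
    fix k n v \<omega> assume \<omega>: "\<omega> \<in> dual_space s"
    show "fact k / fact n * M k n (tpow s v n) (replicate k \<omega>) = fps_nth (fps_at (series_pair \<omega> B) v ^ k) n"
    \<comment> \<open>for \<open>k = 0\<close> the identity expresses the normalization of \<open>P\<close>\<close>
    proof (cases "k = 0")
      case True
      then show ?thesis using M_0[of n v] by simp
    next
      case False
      then show ?thesis
        using * series_tpow_diag[OF B \<omega>, of k n v] by (simp add: coeff_identity_alt)
    qed
  qed
next
  assume *: ?R
  show "coeff_identity B"
    unfolding coeff_identity_alt
  proof (intro allI impI)
    fix k n :: nat
    have M': "pscale (pscale (*)) (fact k / fact n) (M k n) \<in>
        lin_maps (pscale (*)) (sym_power s n) (pscale (*)) (sym_power s k)"
      by (rule lin_maps_pscale[OF form.vector_space_axioms subspace_sym_power M_lin])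
    show "series_tpow s B k n = pscale (pscale (*)) (fact k / fact n) (M k n)"
    proof (rule sym_power_maps_eqI[OF series_tpow_lin[OF B(1)] M'])
      fix v
      show "series_tpow s B k n (tpow s v n) = pscale (pscale (*)) (fact k / fact n) (M k n) (tpow s v n)"
        using * series_tpow_diag[OF B]
        by (intro sym_power_eqI[OF lin_maps_in[OF series_tpow_lin[OF B(1)]] lin_maps_in[OF M']]) simp_all
    qed
  qed
qed

text \<open>
  Divided by factorials, the recurrence for the matrix entries says that their generating functions
  \<open>a k\<close> satisfy \<open>(k + 1) a\<^sub>k\<^sub>+\<^sub>1 = b a\<^sub>k\<close>.
\<close>

lemma umbral_imp_coeff_identity:
  assumes umbral
  shows "coeff_identity gen_series"
  unfolding coeff_identity_iff[OF fseries1D[OF gen_series_in_fseries1]]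
proof (intro allI ballI)
  fix k n v \<omega> assume \<omega>: "\<omega> \<in> dual_space s"
  let ?b = "fps_at (series_pair \<omega> gen_series) v"
  define a where "a k = Abs_fps (\<lambda>n. M k n (tpow s v n) (replicate k \<omega>) / fact n)" for k
  have "fact k * a k = ?b ^ k"
  proof (rule fps_divided_power_recurrence)
    show "a 0 = 1" by (auto simp: a_def fps_eq_iff M_0)
    fix k
    show "of_nat (Suc k) * a (Suc k) = ?b * a k"
    proof (rule fps_ext)
      fix n
      have "fps_nth (of_nat (Suc k) * a (Suc k)) n =
          of_nat (Suc k) * M (Suc k) n (tpow s v n) (replicate (Suc k) \<omega>) / fact n"
        by (simp only: a_def fps_of_nat[symmetric] fps_mult_left_const_nth fps_nth_Abs_fps times_divide_eq_right)
      also have "\<dots> = (\<Sum>j\<le>n. of_nat (n choose j) * M 1 j (tpow s v j) [\<omega>] *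
          M k (n - j) (tpow s v (n - j)) (replicate k \<omega>)) / fact n"
        by (simp only: umbral_recurrence[OF assms \<omega>])
      also have "\<dots> = (\<Sum>j\<le>n. M 1 j (tpow s v j) [\<omega>] / fact j *
          (M k (n - j) (tpow s v (n - j)) (replicate k \<omega>) / fact (n - j)))"
        unfolding sum_divide_distrib by (intro sum.cong refl) (simp add: binomial_fact)
      also have "\<dots> = fps_nth (?b * a k) n"
        by (simp add: fps_mult_nth a_def atLeast0AtMost series_pair_def dual_gen_series[OF \<omega>])
      finally show "fps_nth (of_nat (Suc k) * a (Suc k)) n = fps_nth (?b * a k) n" .
    qed
  qed
  moreover have "fact k = fps_const (fact k :: 'k)"
    by (metis fps_of_nat of_nat_fact)
  ultimately have "fps_nth (fps_const (fact k) * a k) n = fps_nth (?b ^ k) n"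
    by metis
  then show "fact k / fact n * M k n (tpow s v n) (replicate k \<omega>) = fps_nth (?b ^ k) n"
    by (simp add: a_def)
qed

text \<open>
  The identity for \<open>k = 1\<close> determines the series.
\<close>

lemma coeff_identity_unique:
  assumes B: "B \<in> fseries1 s" and "coeff_identity B"
  shows "B = gen_series"
proof
  fix n
  show "B n = gen_series n"
  proof (rule sym_power_maps_eqI[OF vec_seriesD vec_seriesD])
    show "B n (tpow s v n) = gen_series n (tpow s v n)" for v
    proof (rule dual_eqI)
      fix \<omega> assume \<omega>: "\<omega> \<in> dual_space s"
      have "fact 1 / fact n * M 1 n (tpow s v n) (replicate 1 \<omega>) = fps_nth (fps_at (series_pair \<omega> B) v ^ 1) n"
        using assms \<omega> unfolding coeff_identity_iff[OF fseries1D[OF B]] by blast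
      then show "\<omega> (B n (tpow s v n)) = \<omega> (gen_series n (tpow s v n))"
        by (simp add: dual_gen_series[OF \<omega>] series_pair_def)
    qed
  qed (use fseries1D[OF B] fseries1D[OF gen_series_in_fseries1] in auto)
qed

lemma exp_identity_iff:
  assumes B: "B \<in> vec_series"
  shows "exp_identity B \<longleftrightarrow> (\<forall>n v. \<forall>\<omega>\<in>dual_space s. P (ppow n v) \<omega> / fact n =
    fps_nth (fps_compose (fps_exp 1) (fps_at (series_pair \<omega> B) v)) n)"
proof -
  have "(\<lambda>n. pscale (*) (1 / fact n) (poly_seq s P n \<omega>)) = series_exp s (series_pair \<omega> B) \<longleftrightarrow>
      (\<forall>n v. P (ppow n v) \<omega> / fact n =
        fps_nth (fps_compose (fps_exp 1) (fps_at (series_pair \<omega> B) v)) n)" (is "?L = ?E \<longleftrightarrow> ?R")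
    if \<omega>: "\<omega> \<in> dual_space s" for \<omega>
  proof -
    have L: "?L \<in> sym_series"
      unfolding fseries_def mem_Collect_eq
      by (intro allI lin_maps_pscale vector_space_times subspace_UNIV_k poly_seq_lin[OF \<omega>])
    have E: "?E \<in> sym_series" by (rule series_exp_lin[OF series_pair_lin[OF B \<omega>]])
    have fps: "fps_nth (fps_at ?L v) n = P (ppow n v) \<omega> / fact n"
      "fps_at ?E v = fps_compose (fps_exp 1) (fps_at (series_pair \<omega> B) v)" for n v
      using fps_at_series_exp[OF series_pair_lin[OF B \<omega>]] by (simp_all add: poly_seq_tpow)
    show ?thesis
    proof
      assume "?L = ?E"
      then have "fps_at ?L v = fps_at ?E v" for v by simp
      then show ?R unfolding fps_eq_iff fps by blast
    next
      assume ?R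
      then show "?L = ?E"
        by (intro sym_series_eqI[OF L E]) (simp only: fps_eq_iff fps, simp)
    qed
  qed
  then show ?thesis unfolding exp_identity_def by blast
qed

text \<open>
  One direction is summation over \<open>k\<close>. For the other, the exponential formula exhibits \<open>P (ppow n v)\<close> as
  a sum of homogeneous polynomials, and components of equal degree are compared.
\<close>

lemma coeff_identity_iff_exp_identity:
  assumes B: "B \<in> fseries1 s"
  shows "coeff_identity B \<longleftrightarrow> exp_identity B"
proof
  note B' = fseries1D[OF B]
  assume *: "coeff_identity B"
  show "exp_identity B"
    unfolding exp_identity_iff[OF B'(1)]
  proof (intro allI ballI)
    fix n v \<omega> assume \<omega>: "\<omega> \<in> dual_space s"
    let ?b = "fps_at (series_pair \<omega> B) v"
    have "P (ppow n v) \<omega> / fact n = (\<Sum>k\<le>n. 1 / fact k * (fact k / fact n * M k n (tpow s v n) (replicate k \<omega>)))"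
      by (simp add: P_ppow_apply[OF \<omega>] sum_divide_distrib)
    also have "\<dots> = (\<Sum>k\<le>n. 1 / fact k * fps_nth (?b ^ k) n)"
      using * \<omega> unfolding coeff_identity_iff[OF B'] by simp
    finally show "P (ppow n v) \<omega> / fact n = fps_nth (fps_compose (fps_exp 1) ?b) n"
      by (simp add: fps_compose_nth atLeast0AtMost)
  qed
next
  note B' = fseries1D[OF B]
  assume *: "exp_identity B"
  show "coeff_identity B"
    unfolding coeff_identity_iff[OF B']
  proof (intro allI ballI)
    fix k n v \<omega> assume \<omega>: "\<omega> \<in> dual_space s"
    let ?b = "\<lambda>\<omega>. fps_at (series_pair \<omega> B) v"
    let ?f = "\<lambda>k. pscale (*) (fact n / fact k) (series_tpow s B k n (tpow s v n))"
    have f: "?f k \<in> sym_power s k" for k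
      by (intro form.subspace_scale[OF subspace_sym_power] lin_maps_in[OF series_tpow_lin[OF B'(1)]] tpow_in_sym_power)
    have "P (ppow n v) = (\<Sum>k\<le>n. homog s k (?f k))"
    proof (rule ext)
      fix \<omega>
      show "P (ppow n v) \<omega> = (\<Sum>k\<le>n. homog s k (?f k)) \<omega>"
      proof (cases "\<omega> \<in> dual_space s")
        case True
        have "P (ppow n v) \<omega> = fact n * (\<Sum>k\<le>n. 1 / fact k * fps_nth (?b \<omega> ^ k) n)"
          using * True unfolding exp_identity_iff[OF B'(1)]
          by (simp add: fps_compose_nth atLeast0AtMost field_simps)
        also have "\<dots> = (\<Sum>k\<le>n. homog s k (?f k)) \<omega>"
          by (simp add: homog_in_dual[OF True] series_tpow_diag[OF B' True] sum_distrib_left)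
        finally show ?thesis .
      next
        case False
        then show ?thesis by (simp add: polys_outside homog_outside)
      qed
    qed
    then have "M k n (tpow s v n) = (if k \<le> n then ?f k else 0)"
      using tcomp_sum_homog[of n ?f k] f tcomp_P[of "tpow s v n" n k] by simp
    moreover have "fps_nth (?b \<omega> ^ k) n = 0" if "n < k"
      using startsby_zero_power_prefix[of "?b \<omega>" k] that B'(2) dual_0[OF \<omega>] by (simp add: series_pair_def)
    ultimately show "fact k / fact n * M k n (tpow s v n) (replicate k \<omega>) = fps_nth (?b \<omega> ^ k) n"
      by (simp add: series_tpow_diag[OF B' \<omega>])
  qed
qed

text \<open>
  The exponent is additive in the functional, and the exponential turns the sum into a product.
\<close>

lemma exp_identity_imp_umbral:
  assumes B: "B \<in> fseries1 s" and "exp_identity B"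
  shows umbral
  unfolding umbral_def
proof (intro allI ballI, rule ext)
  note B' = fseries1D[OF B]
  fix n v \<eta> \<omega> assume \<eta>: "\<eta> \<in> dual_space s"
  show "shift_op s \<eta> (P (ppow n v)) \<omega> =
      (\<Sum>k\<le>n. pscale (*) (of_nat (n choose k) * P (ppow k v) \<eta>) (P (ppow (n - k) v))) \<omega>"
  proof (cases "\<omega> \<in> dual_space s")
    case False
    then show ?thesis by (simp add: shift_op_def polys_outside)
  next
    case \<omega>: True
    let ?b = "\<lambda>\<omega>. fps_at (series_pair \<omega> B) v"
    have E: "P (ppow n v) \<omega> / fact n = fps_nth (fps_compose (fps_exp 1) (?b \<omega>)) n"
      if "\<omega> \<in> dual_space s" for n \<omega>
      using assms(2) that unfolding exp_identity_iff[OF B'(1)] by blast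
    have "P (ppow n v) (\<omega> + \<eta>) / fact n = fps_nth (fps_compose (fps_exp 1) (?b \<eta> + ?b \<omega>)) n"
    proof -
      have "?b (\<omega> + \<eta>) = ?b \<eta> + ?b \<omega>" by (simp add: fps_eq_iff series_pair_def)
      then show ?thesis using E[of "\<omega> + \<eta>" n] \<omega> \<eta> by simp
    qed
    also have "fps_compose (fps_exp 1) (?b \<eta> + ?b \<omega>) =
        fps_compose (fps_exp 1) (?b \<eta>) * fps_compose (fps_exp 1) (?b \<omega>)"
      by (rule fps_exp_compose_add) (simp_all add: series_pair_def B'(2) dual_0 \<omega> \<eta>)
    also have "fps_nth \<dots> n = (\<Sum>k\<le>n. P (ppow k v) \<eta> / fact k * (P (ppow (n - k) v) \<omega> / fact (n - k)))"
      by (simp only: fps_mult_nth atLeast0AtMost E[OF \<omega>] E[OF \<eta>])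
    finally have "P (ppow n v) (\<omega> + \<eta>) / fact n =
        (\<Sum>k\<le>n. P (ppow k v) \<eta> / fact k * (P (ppow (n - k) v) \<omega> / fact (n - k)))" .
    moreover have "x = fact n * y" if "x / fact n = y" for x y :: 'k
      using that by (simp add: field_simps)
    ultimately have "P (ppow n v) (\<omega> + \<eta>) =
        fact n * (\<Sum>k\<le>n. P (ppow k v) \<eta> / fact k * (P (ppow (n - k) v) \<omega> / fact (n - k)))"
      by blast
    also have "\<dots> = (\<Sum>k\<le>n. of_nat (n choose k) * P (ppow k v) \<eta> * P (ppow (n - k) v) \<omega>)"
      unfolding sum_distrib_left by (intro sum.cong refl) (simp add: binomial_fact)
    finally show ?thesis using \<omega> by (simp add: shift_op_def)
  qed
qed


section \<open>The lowering differential as a differential operator\<close>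

text \<open>
  The entries \<open>k! L\<^sub>k\<close>, as a row, times the matrix of \<open>P\<close> give the row with index 1 of the identity matrix.
\<close>

definition left_inverse_equations where
  "left_inverse_equations L \<longleftrightarrow> (\<forall>n v.
    (\<Sum>k=1..n. s (fact k) (L k (M k n (tpow s v n)))) = (if n = 1 then v else 0))"

text \<open>
  The operator \<open>L(D)\<close> acts on the \<open>P (ppow n v)\<close> as a convolution with vector coefficients.
\<close>

lemma series_D_P:
  assumes umbral and L: "L \<in> vec_series" and \<omega>: "\<omega> \<in> dual_space s"
  shows "series_D s L (P (ppow n v)) \<omega> = (\<Sum>j\<le>n. s (of_nat (n choose j) * P (ppow j v) \<omega>)
    (\<Sum>k=1..n - j. s (fact k) (L k (M k (n - j) (tpow s v (n - j))))))"
proof -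
  note L_lin = vec_seriesD[OF L]
  note L0 = lin_maps_zero[OF L_lin]
  have "Dpow s k (P (ppow n v)) = 0" if "k > n" for k
  proof
    show "Dpow s k (P (ppow n v)) \<omega> = 0 \<omega>" for \<omega>
      using that by (cases "\<omega> \<in> dual_space s")
        (simp_all add: Dpow_outside Dpow_P[OF assms(1)] M_above fun_eq_iff)
  qed
  then have "series_D s L (P (ppow n v)) \<omega> = (\<Sum>k=1..n. L k (Dpow s k (P (ppow n v)) \<omega>))"
    by (intro series_D_eq L0)
  also have "\<dots> = (\<Sum>k=1..n. \<Sum>j\<le>n. s (of_nat (n choose j) * P (ppow j v) \<omega>)
      (s (fact k) (L k (M k (n - j) (tpow s v (n - j))))))"
  proof (rule sum.cong[OF refl])
    fix k
    have "L k (Dpow s k (P (ppow n v)) \<omega>) = (\<Sum>j\<le>n. L k (pscale (*)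
        (of_nat (n choose j) * P (ppow j v) \<omega> * fact k) (M k (n - j) (tpow s v (n - j)))))"
      unfolding Dpow_P[OF assms(1) \<omega>]
      by (intro lin_maps_sum[OF L_lin form.vector_space_axioms subspace_sym_power]
          form.subspace_scale[OF subspace_sym_power]) simp
    also have "\<dots> = (\<Sum>j\<le>n. s (of_nat (n choose j) * P (ppow j v) \<omega>)
      (s (fact k) (L k (M k (n - j) (tpow s v (n - j))))))"
      by (intro sum.cong refl) (simp add: lin_maps_scale[OF L_lin])
    finally show "L k (Dpow s k (P (ppow n v)) \<omega>) = (\<Sum>j\<le>n. s (of_nat (n choose j) * P (ppow j v) \<omega>)
      (s (fact k) (L k (M k (n - j) (tpow s v (n - j))))))" .
  qed
  also have "\<dots> = (\<Sum>j\<le>n. s (of_nat (n choose j) * P (ppow j v) \<omega>)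
      (\<Sum>k=1..n. s (fact k) (L k (M k (n - j) (tpow s v (n - j))))))"
    by (subst sum.swap) (simp only: scale_sum_right)
  also have "\<dots> = (\<Sum>j\<le>n. s (of_nat (n choose j) * P (ppow j v) \<omega>)
    (\<Sum>k=1..n - j. s (fact k) (L k (M k (n - j) (tpow s v (n - j))))))"
  proof (rule sum.cong[OF refl], rule arg_cong[of _ _ "s _"])
    fix j
    show "(\<Sum>k=1..n. s (fact k) (L k (M k (n - j) (tpow s v (n - j))))) =
        (\<Sum>k=1..n - j. s (fact k) (L k (M k (n - j) (tpow s v (n - j)))))"
      by (intro sum.mono_neutral_right) (auto simp: M_above L0)
  qed
  finally show ?thesis .
qed

text \<open>
  At the origin only the term \<open>j = 0\<close> of the convolution remains, which isolates the equations. If they hold,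
  the convolution reduces to the term \<open>j = n - 1\<close>, which is the lowering differential.
\<close>

lemma lowering_diff_eq_series_D_iff:
  assumes umbral and L: "L \<in> vec_series"
  shows "lowering_diff s P = series_D s L \<longleftrightarrow> left_inverse_equations L"
proof
  assume *: "lowering_diff s P = series_D s L"
  show "left_inverse_equations L"
    unfolding left_inverse_equations_def
  proof (intro allI)
    fix n v
    let ?S = "\<lambda>n. \<Sum>k=1..n. s (fact k) (L k (M k n (tpow s v n)))"
    have "series_D s L (P (ppow n v)) 0 = (\<Sum>j\<le>n. if j = 0 then ?S n else 0)"
      unfolding series_D_P[OF assms zero_in_dual] by (intro sum.cong refl) (simp add: P_ppow_at_0)
    then have "?S n = series_D s L (P (ppow n v)) 0" by simp
    also have "\<dots> = s (of_nat n * P (ppow (n - 1) v) 0) v"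
      unfolding *[symmetric] lowering_diff_P_ppow ..
    also have "\<dots> = (if n = 1 then v else 0)"
      by (cases "n = 0") (simp_all add: P_ppow_at_0)
    finally show "?S n = (if n = 1 then v else 0)" .
  qed
next
  assume *: "left_inverse_equations L"
  note L_lin = vec_seriesD[OF L]
  show "lowering_diff s P = series_D s L"
  proof (rule P_maps_eqI[OF lowering_diff_lin series_D_lin[OF vector_space_axioms L_lin]], rule ext)
    fix n v \<omega>
    show "lowering_diff s P (P (ppow n v)) \<omega> = series_D s L (P (ppow n v)) \<omega>"
    proof (cases "\<omega> \<in> dual_space s")
      case False
      then show ?thesis
        using series_D_outside[of L \<omega>] lin_maps_zero[OF L_lin]
        by (simp add: lowering_diff_P_ppow polys_outside)
    next
      case True
      have "series_D s L (P (ppow n v)) \<omega> =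
          (\<Sum>j\<le>n. s (of_nat (n choose j) * P (ppow j v) \<omega>) (if n - j = 1 then v else 0))"
        using * unfolding series_D_P[OF assms True] left_inverse_equations_def by simp
      also have "\<dots> = s (of_nat n * P (ppow (n - 1) v) \<omega>) v"
      proof (cases n)
        case (Suc m)
        have "(\<Sum>j\<le>n. s (of_nat (n choose j) * P (ppow j v) \<omega>) (if n - j = 1 then v else 0)) =
            (\<Sum>j\<le>n. if j = m then s (of_nat (n choose m) * P (ppow m v) \<omega>) v else 0)"
          using Suc by (intro sum.cong refl) auto
        then show ?thesis using Suc by simp
      qed simp
      finally show ?thesis by (simp add: lowering_diff_P_ppow)
    qed
  qed
qed

definition inv_gen_series :: "nat \<Rightarrow> ('v, 'k) tensor \<Rightarrow> 'v" where
  "inv_gen_series n f = s (1 / fact n) (vec_of (M_inv 1 n f))"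

lemma inv_gen_series_eq: "inv_gen_series = normalized_operator.gen_series s M_inv"
proof -
  interpret I: normalized_operator s P_inv M_inv by (rule inverse_normalized_operator)
  show ?thesis by (simp add: inv_gen_series_def I.gen_series_def fun_eq_iff)
qed

lemma inv_gen_series_in_fseries1: "inv_gen_series \<in> fseries1 s"
  unfolding inv_gen_series_eq
  by (rule normalized_operator.gen_series_in_fseries1[OF inverse_normalized_operator])

lemma left_inverse_equations_inv_gen_series: "left_inverse_equations inv_gen_series"
  unfolding left_inverse_equations_def
proof (intro allI)
  fix n v
  let ?f = "tpow s v n"
  note N = lin_maps_in[OF M_inv_lin M_in_sym_power[OF tpow_in_sym_power]]
  have "(\<Sum>k=1..n. s (fact k) (inv_gen_series k (M k n ?f))) = (\<Sum>k=1..n. vec_of (M_inv 1 k (M k n ?f)))"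
    by (simp add: inv_gen_series_def)
  also have "\<dots> = (\<Sum>k\<le>n. vec_of (M_inv 1 k (M k n ?f)))"
    by (intro sum.mono_neutral_left) (auto simp: not_less_eq_eq M_inv_above lin_maps_zero[OF vec_of_lin])
  also have "\<dots> = vec_of (\<Sum>k\<le>n. M_inv 1 k (M k n ?f))"
    by (rule lin_maps_sum[OF vec_of_lin form.vector_space_axioms subspace_sym_power N, symmetric])
  also have "\<dots> = (if n = 1 then v else 0)"
    unfolding M_inv_M[OF tpow_in_sym_power]
    using vec_of_tpow[of v] by (simp add: lin_maps_zero[OF vec_of_lin])
  finally show "(\<Sum>k=1..n. s (fact k) (inv_gen_series k (M k n ?f))) = (if n = 1 then v else 0)" .
qed

text \<open>
  Multiply the equations by the inverse matrix from the right.
\<close>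

lemma left_inverse_equations_unique:
  assumes L: "L \<in> vec_series" "L 0 = 0" and eq: "left_inverse_equations L"
  shows "L = inv_gen_series"
proof (intro ext)
  fix m g
  note L_lin = vec_seriesD[OF L(1)]
  note L0 = lin_maps_zero[OF L_lin]
  have linear: "(\<Sum>k=1..n. s (fact k) (L k (M k n f))) = (if n = 1 then vec_of f else 0)"
    if f: "f \<in> sym_power s n" for n f
  proof -
    have "(\<Sum>k=1..n. pscale s (fact k) (\<lambda>f. L k (M k n f))) = (if n = 1 then vec_of else 0)"
    proof (rule sym_power_maps_eqI)
      show "(\<Sum>k=1..n. pscale s (fact k) (\<lambda>f. L k (M k n f))) \<in>
          lin_maps (pscale (*)) (sym_power s n) s UNIV"
        by (intro lin_maps_sum_maps lin_maps_pscale vector_space_axioms subspace_UNIV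
            lin_maps_comp[OF L_lin M_lin])
      show "(if n = 1 then vec_of else 0) \<in> lin_maps (pscale (*)) (sym_power s n) s UNIV"
        using vec_of_lin by (auto simp: lin_maps_def)
      show "(\<Sum>k=1..n. pscale s (fact k) (\<lambda>f. L k (M k n f))) (tpow s v n) =
          (if n = 1 then vec_of else 0) (tpow s v n)" for v
        using eq vec_of_tpow[of v] unfolding left_inverse_equations_def by simp
    qed
    then have "(\<Sum>k=1..n. pscale s (fact k) (\<lambda>f. L k (M k n f))) f = (if n = 1 then vec_of else 0) f"
      by (rule fun_cong)
    then show ?thesis by (simp split: if_splits)
  qed
  show "L m g = inv_gen_series m g"
  proof (cases "m = 0 \<or> g \<notin> sym_power s m")
    case True
    then show ?thesis
      using L(2) fseries1D[OF inv_gen_series_in_fseries1] lin_maps_outside[OF L_lin]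
        lin_maps_outside[OF vec_seriesD[OF fseries1D(1)[OF inv_gen_series_in_fseries1]]]
      by auto
  next
    case False
    then have m: "m \<ge> 1" and g: "g \<in> sym_power s m" by auto
    note N = lin_maps_in[OF M_inv_lin g]
    have "s (fact m) (L m g) = (\<Sum>k=1..m. if k = m then s (fact m) (L m g) else 0)"
      using m by simp
    also have "\<dots> = (\<Sum>k=1..m. s (fact k) (L k (\<Sum>n\<le>m. M k n (M_inv n m g))))"
      by (intro sum.cong refl) (simp add: M_M_inv[OF g] L0)
    also have "\<dots> = (\<Sum>k=1..m. \<Sum>n\<le>m. s (fact k) (L k (M k n (M_inv n m g))))"
      unfolding scale_sum_right[symmetric]
      by (intro sum.cong refl arg_cong[of _ _ "s _"]
          lin_maps_sum[OF L_lin form.vector_space_axioms subspace_sym_power] M_in_sym_power N)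
    also have "\<dots> = (\<Sum>n\<le>m. \<Sum>k=1..m. s (fact k) (L k (M k n (M_inv n m g))))"
      by (rule sum.swap)
    also have "\<dots> = (\<Sum>n\<le>m. \<Sum>k=1..n. s (fact k) (L k (M k n (M_inv n m g))))"
    proof (rule sum.cong[OF refl])
      fix n assume "n \<in> {..m}"
      then show "(\<Sum>k=1..m. s (fact k) (L k (M k n (M_inv n m g)))) =
          (\<Sum>k=1..n. s (fact k) (L k (M k n (M_inv n m g))))"
        by (intro sum.mono_neutral_right) (auto simp: M_above L0)
    qed
    also have "\<dots> = (\<Sum>n\<le>m. if n = 1 then vec_of (M_inv 1 m g) else 0)"
      by (intro sum.cong refl) (simp only: linear[OF N] split: if_splits, simp)
    also have "\<dots> = vec_of (M_inv 1 m g)" using m by simp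
    finally have "s (1 / fact m) (s (fact m) (L m g)) = s (1 / fact m) (vec_of (M_inv 1 m g))"
      by simp
    then show ?thesis by (simp add: inv_gen_series_def)
  qed
qed

text \<open>
  The derivative \<open>D(\<theta>)\<close> and the conjugate of a shift by \<open>P\<close> are both convolution operators with respect to
  \<open>P\<close>, so they commute. Conjugating back shows that the lowering operators of the inverse are
  shift-invariant.
\<close>

lemma inverse_umbral:
  assumes umbral
  shows "normalized_operator.umbral s P_inv"
proof -
  interpret I: normalized_operator s P_inv M_inv by (rule inverse_normalized_operator)
  have I_inv: "I.P_inv p = P p" if "p \<in> polys s" for p
    using I.P_inv_P[OF P_in_polys[OF that]] P_inv_P[OF that] by simp
  show I.umbral
  proof (rule I.shift_invariant_imp_umbral)
    fix \<theta> assume \<theta>: "\<theta> \<in> dual_space s"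
    show "shift_invariant s (lowering_op s P_inv \<theta>)"
      unfolding shift_invariant_def
    proof (intro conjI ballI I.lowering_op_lin[OF \<theta>])
      fix \<eta> p assume \<eta>: "\<eta> \<in> dual_space s" and p: "p \<in> polys s"
      let ?E = "\<lambda>p. if p \<in> polys s then shift_op s \<eta> p else 0"
      have "convolution_op (\<lambda>q. P (?E (P_inv q))) (\<lambda>k v. \<eta> v ^ k)"
        unfolding convolution_op_def
      proof (intro conjI allI)
        show "(\<lambda>q. P (?E (P_inv q))) \<in> lin_maps (pscale (*)) (polys s) (pscale (*)) (polys s)"
          by (rule lin_maps_comp[OF P_lin lin_maps_comp[OF shift_op_lin[OF \<eta>] P_inv_lin]])
        fix n v
        have "P (?E (P_inv (P (ppow n v)))) =
            P (\<Sum>k\<le>n. pscale (*) (of_nat (n choose k) * \<eta> v ^ (n - k)) (ppow k v))"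
          by (simp add: P_inv_P shift_op_pow[OF \<eta>])
        also have "(\<Sum>k\<le>n. pscale (*) (of_nat (n choose k) * \<eta> v ^ (n - k)) (ppow k v)) =
            (\<Sum>k\<le>n. pscale (*) (of_nat (n choose k) * \<eta> v ^ k) (ppow (n - k) v))"
          by (rule sum.reindex_bij_witness[of _ "\<lambda>k. n - k" "\<lambda>k. n - k"])
            (auto simp: binomial_symmetric[symmetric])
        also have "P \<dots> = (\<Sum>k\<le>n. P (pscale (*) (of_nat (n choose k) * \<eta> v ^ k) (ppow (n - k) v)))"
          by (rule P_sum) simp
        also have "\<dots> = (\<Sum>k\<le>n. pscale (*) (of_nat (n choose k) * \<eta> v ^ k) (P (ppow (n - k) v)))"
          by (intro sum.cong refl lin_maps_scale[OF P_lin]) simp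
        finally show "P (?E (P_inv (P (ppow n v)))) =
            (\<Sum>k\<le>n. pscale (*) (of_nat (n choose k) * \<eta> v ^ k) (P (ppow (n - k) v)))" .
      qed
      from convolution_ops_commute[OF poly_deriv_convolution_op[OF assms \<theta>] this P_in_polys[OF p]]
      have "poly_deriv \<theta> (P (shift_op s \<eta> p)) = P (shift_op s \<eta> (P_inv (poly_deriv \<theta> (P p))))"
        using p lin_maps_in[OF poly_deriv_lin[OF \<theta>] P_in_polys[OF p]] by (simp add: P_inv_P)
      then have "P_inv (poly_deriv \<theta> (P (shift_op s \<eta> p))) = shift_op s \<eta> (P_inv (poly_deriv \<theta> (P p)))"
        using p \<eta> lin_maps_in[OF poly_deriv_lin[OF \<theta>] P_in_polys[OF p]] by (simp add: P_inv_P)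
      then show "lowering_op s P_inv \<theta> (shift_op s \<eta> p) = shift_op s \<eta> (lowering_op s P_inv \<theta> p)"
        using p \<eta> by (simp add: I.lowering_op_eq[OF \<theta>] I_inv)
    qed
  qed
qed

text \<open>
  The coefficient identity for \<open>P\<close> and for its inverse describes the tensor powers of both series by the two
  matrices, so the two compositions are row 1 of the two matrix products.
\<close>

lemma is_comp_inverse_gen_series:
  assumes umbral
  shows "is_comp_inverse s gen_series inv_gen_series"
proof -
  interpret I: normalized_operator s P_inv M_inv by (rule inverse_normalized_operator)
  have B: "series_tpow s gen_series k n = pscale (pscale (*)) (fact k / fact n) (M k n)" if "k \<ge> 1" for k n
    using umbral_imp_coeff_identity[OF assms] that by (simp add: coeff_identity_alt)
  have L: "series_tpow s inv_gen_series k n = pscale (pscale (*)) (fact k / fact n) (M_inv k n)"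
    if "k \<ge> 1" for k n
    using I.umbral_imp_coeff_identity[OF inverse_umbral[OF assms]] that
    by (simp add: I.coeff_identity_alt inv_gen_series_eq)
  have "series_comp s inv_gen_series gen_series = series_id s"
    by (rule series_comp_eq_id[where X = "M_inv 1" and Y = M])
      (use M_inv_M M_inv_lin M_lin M_inv_above B in \<open>auto simp: inv_gen_series_def\<close>)
  moreover have "series_comp s gen_series inv_gen_series = series_id s"
    by (rule series_comp_eq_id[where X = "M 1" and Y = M_inv])
      (use M_M_inv M_inv_lin M_lin M_above L in \<open>auto simp: gen_series_def\<close>)
  ultimately show ?thesis
    by (simp add: is_comp_inverse_def gen_series_in_fseries1 inv_gen_series_in_fseries1)
qed

text \<open>
  Each \<open>D\<^sup>k\<close> commutes with shifts, hence so does \<open>L(D)\<close>.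
\<close>

lemma series_D_imp_umbral:
  assumes L: "L \<in> vec_series" and eq: "lowering_diff s P = series_D s L"
  shows umbral
proof -
  have "vec_shift_invariant s (lowering_diff s P)"
    unfolding vec_shift_invariant_def
    using lowering_diff_lin series_D_shift[of L] lin_maps_zero[OF vec_seriesD[OF L]] by (auto simp: eq)
  then show ?thesis
    unfolding vec_shift_invariant_iff by (blast intro: shift_invariant_imp_umbral)
qed

lemma lowering_diff_eq_series_D_iff_dual:
  "lowering_diff s P = series_D s L \<longleftrightarrow>
    (\<forall>\<theta>\<in>dual_space s. lowering_op s P \<theta> = series_D s (series_pair \<theta> L))"
proof -
  have "lowering_diff s P = series_D s L \<longleftrightarrow>
    (\<forall>p \<omega>. \<forall>\<theta>\<in>dual_space s. \<theta> (lowering_diff s P p \<omega>) = \<theta> (series_D s L p \<omega>))"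
    unfolding fun_eq_iff by (metis dual_eqI)
  then show ?thesis
    by (auto simp: dual_lowering_diff dual_series_D fun_eq_iff)
qed

end

section \<open>Equivalent descriptions of binomial sequences\<close>

theorem theorem4p3:
  fixes s :: "'k::real_normed_field \<Rightarrow> 'v::ab_group_add \<Rightarrow> 'v"
    and P :: "(('v \<Rightarrow> 'k) \<Rightarrow> 'k) \<Rightarrow> (('v \<Rightarrow> 'k) \<Rightarrow> 'k)"
    and M :: "nat \<Rightarrow> nat \<Rightarrow> ('v, 'k) tensor \<Rightarrow> ('v, 'k) tensor"
    and B1 B2 B2' :: bool
    and B3 B3' B4 B5 :: "(nat \<Rightarrow> ('v, 'k) tensor \<Rightarrow> 'v) \<Rightarrow> bool"
  assumes "vector_space s"
    and "poly_operator s P M"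
    and "\<forall>\<omega>\<in>dual_space s. poly_seq s P 0 \<omega> = unit_functional s"
    and "\<forall>n\<ge>1. poly_seq s P n 0 = 0"
  defines "B1 \<equiv> binomial_seq s (poly_seq s P)"
    and "B2 \<equiv> vec_shift_invariant s (lowering_diff s P)"
    and "B2' \<equiv> (\<forall>\<theta>\<in>dual_space s. shift_invariant s (lowering_op s P \<theta>))"
    and "B3 \<equiv> (\<lambda>L. lowering_diff s P = series_D s L)"
    and "B3' \<equiv> (\<lambda>L. \<forall>\<theta>\<in>dual_space s. lowering_op s P \<theta> = series_D s (series_pair \<theta> L))"
    and "B4 \<equiv> (\<lambda>B. \<forall>\<omega>\<in>dual_space s.
           (\<lambda>n. pscale (*) (1 / fact n) (poly_seq s P n \<omega>)) = series_exp s (series_pair \<omega> B))"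
    and "B5 \<equiv> (\<lambda>B. \<forall>k\<ge>1.
           (\<lambda>n. if k \<le> n then pscale (pscale (*)) (fact k / fact n) (M k n) else 0)
             = series_tpow s B k)"
  shows "(B1 \<longleftrightarrow> B2) \<and> (B2 \<longleftrightarrow> B2') \<and>
    (B1 \<longleftrightarrow> (\<exists>L\<in>fseries1 s. B3 L)) \<and> (\<forall>L\<in>fseries1 s. B3 L \<longleftrightarrow> B3' L) \<and>
    (B1 \<longleftrightarrow> (\<exists>B\<in>fseries1 s. B4 B)) \<and>
    (B1 \<longleftrightarrow> (\<exists>B\<in>fseries1 s. B5 B)) \<and>
    (\<forall>B\<in>fseries1 s. \<forall>B'\<in>fseries1 s. B4 B \<and> B5 B' \<longrightarrow> B = B') \<and>
    (\<forall>B\<in>fseries1 s. \<forall>L\<in>fseries1 s. B4 B \<and> B3 L \<longrightarrow> is_comp_inverse s B L)"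
proof -
  interpret vector_space s by fact
  interpret normalized_operator s P M
    by unfold_locales (use assms(2-4) in auto)
  have B1: "B1 \<longleftrightarrow> umbral" unfolding B1_def by (rule binomial_seq_iff_umbral)
  have B2: "B2 \<longleftrightarrow> B2'" unfolding B2_def B2'_def by (rule vec_shift_invariant_iff)
  have B2': "B2' \<longleftrightarrow> umbral"
    unfolding B2'_def by (blast intro: umbral_imp_shift_invariant shift_invariant_imp_umbral)
  have B3': "B3 L \<longleftrightarrow> B3' L" for L
    unfolding B3_def B3'_def by (rule lowering_diff_eq_series_D_iff_dual)
  have B3_umbral: umbral if "L \<in> fseries1 s" "B3 L" for L
    using series_D_imp_umbral[OF fseries1D(1)] that by (simp add: B3_def)
  have B3: "B3 L \<longleftrightarrow> L = inv_gen_series" if umbral "L \<in> fseries1 s" for L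
    unfolding B3_def lowering_diff_eq_series_D_iff[OF that(1) fseries1D(1)[OF that(2)]]
    using left_inverse_equations_unique[OF fseries1D[OF that(2)]] left_inverse_equations_inv_gen_series
    by blast
  have B5: "B5 = coeff_identity" by (simp add: B5_def coeff_identity_def fun_eq_iff)
  have B4: "B4 B \<longleftrightarrow> coeff_identity B" if "B \<in> fseries1 s" for B
    unfolding coeff_identity_iff_exp_identity[OF that] by (simp add: B4_def exp_identity_def)
  have umbral_iff: "umbral \<longleftrightarrow> (\<exists>B\<in>fseries1 s. coeff_identity B)"
    using umbral_imp_coeff_identity gen_series_in_fseries1 exp_identity_imp_umbral
      coeff_identity_iff_exp_identity by blast
  show ?thesis
  proof (intro conjI)
    show "B1 \<longleftrightarrow> B2" "B2 \<longleftrightarrow> B2'" using B1 B2 B2' by blast+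
    show "B1 \<longleftrightarrow> (\<exists>L\<in>fseries1 s. B3 L)"
      unfolding B1 using B3 B3_umbral inv_gen_series_in_fseries1 by blast
    show "\<forall>L\<in>fseries1 s. B3 L \<longleftrightarrow> B3' L" using B3' by blast
    show "B1 \<longleftrightarrow> (\<exists>B\<in>fseries1 s. B4 B)" "B1 \<longleftrightarrow> (\<exists>B\<in>fseries1 s. B5 B)"
      unfolding B1 umbral_iff B5 using B4 by blast+
    show "\<forall>B\<in>fseries1 s. \<forall>B'\<in>fseries1 s. B4 B \<and> B5 B' \<longrightarrow> B = B'"
      unfolding B5 using B4 coeff_identity_unique by blast
    show "\<forall>B\<in>fseries1 s. \<forall>L\<in>fseries1 s. B4 B \<and> B3 L \<longrightarrow> is_comp_inverse s B L"
      using B4 coeff_identity_unique B3 B3_umbral is_comp_inverse_gen_series by blast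
  qed
qed

end
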